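(* Let $\tau_c$ be the connection time of the Erdős–Rényi graph process $\{G(n,m)\}_{m}$, i.e. the smallest $m$ such that $G(n,m)$ is connected. Then there is a constant $C$ such that with high probability $$\lambda(G(n,\tau_c)) \le \frac{C}{\sqrt{\log n}} .$$
   Context: The Erdős–Rényi graph process $\{G(n,m)\}_{0\le m\le \binom n2}$ starts with the empty graph on $n$ vertices, and at each step a new edge is added, chosen uniformly at random from all edges not already present; $G(n,m)$ is the graph after $m$ edges have been added. "With high probability" means with probability tending to $1$ as $n\to\infty$. For a finite graph $G$ with adjacency matrix $A$ and diagonal degree matrix $T$, the normalized Laplacian is $L = \pi_+ - T^{-1/2} A T^{-1/2}$, where $\pi_+$ is the coordinate projection onto the vertices of positive degree and $T^{-1/2}$ is taken to be $0$ in coordinates where the degree is $0$. Its eigenvalues (with multiplicity) are $0=\lambda_1 \le \lambda_2 \le \dots \le \lambda_{|V(G)|} \le 2$. Define $\lambda(G) = \max_{i\neq 1} |1-\lambda_i|$. *)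

theory Defs
  imports
    "HOL-Probability.Probability"
    "Jordan_Normal_Form.Char_Poly"
begin

text \<open>
  A graph on \<open>n\<close> vertices has vertex set \<open>{..<n}\<close> and is given by its set of edges, each edge
  being a two-element set of vertices.
\<close>

definition all_edges :: "nat \<Rightarrow> nat set set" where
  "all_edges n = {e. e \<subseteq> {..<n} \<and> card e = 2}"

definition graph_connected :: "nat \<Rightarrow> nat set set \<Rightarrow> bool" where
  "graph_connected n E \<longleftrightarrow> (\<forall>u<n. \<forall>v<n. (u, v) \<in> {(x, y). {x, y} \<in> E}\<^sup>*)"

definition degree_of :: "nat set set \<Rightarrow> nat \<Rightarrow> nat" where
  "degree_of E v = card {e \<in> E. v \<in> e}"

definition adjacency_mat :: "nat \<Rightarrow> nat set set \<Rightarrow> real mat" where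
  "adjacency_mat n E = Matrix.mat n n (\<lambda>(i, j). if {i, j} \<in> E then 1 else 0)"

definition inv_sqrt_degree_mat :: "nat \<Rightarrow> nat set set \<Rightarrow> real mat" where
  "inv_sqrt_degree_mat n E =
     mat_diag n (\<lambda>v. if degree_of E v = 0 then 0 else 1 / sqrt (real (degree_of E v)))"

definition pos_degree_proj :: "nat \<Rightarrow> nat set set \<Rightarrow> real mat" where
  "pos_degree_proj n E = mat_diag n (\<lambda>v. if degree_of E v > 0 then 1 else 0)"

definition normalized_laplacian :: "nat \<Rightarrow> nat set set \<Rightarrow> real mat" where
  "normalized_laplacian n E =
     pos_degree_proj n E - inv_sqrt_degree_mat n E * adjacency_mat n E * inv_sqrt_degree_mat n E"

text \<open>
  The eigenvalues in increasing order, repeated according to their multiplicity as roots of the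
  characteristic polynomial. For real symmetric matrices, the only ones used below, this is also
  the geometric multiplicity, and no eigenvalues are lost by looking only at real roots.
\<close>

definition sorted_eigenvalues :: "real mat \<Rightarrow> real list" where
  "sorted_eigenvalues M = sorted_list_of_multiset (proots (char_poly M))"

text \<open>
  List indices start at 0, so the excluded smallest eigenvalue is the one at index 0.
  For \<open>n < 2\<close> the maximum ranges over the empty set and the value is unspecified.
\<close>

definition spectral_lambda :: "nat \<Rightarrow> nat set set \<Rightarrow> real" where
  "spectral_lambda n E =
     Max ((\<lambda>i. \<bar>1 - sorted_eigenvalues (normalized_laplacian n E) ! i\<bar>) ` {1..<n})"

text \<open>
  The first \<open>m\<close> steps of the graph process, recorded as the list of edges in the order in which
  they are added. Only values \<open>m \<le> n choose 2\<close> are meaningful, since afterwards no edge is left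
  to choose from.
\<close>

primrec edge_process :: "nat \<Rightarrow> nat \<Rightarrow> nat set list pmf" where
  "edge_process n 0 = return_pmf []"
| "edge_process n (Suc m) =
     edge_process n m \<bind>
       (\<lambda>es. map_pmf (\<lambda>e. es @ [e]) (pmf_of_set (all_edges n - set es)))"

definition graph_process :: "nat \<Rightarrow> nat set list pmf" where
  "graph_process n = edge_process n (n choose 2)"

definition graph_at :: "nat set list \<Rightarrow> nat \<Rightarrow> nat set set" where
  "graph_at es m = set (take m es)"

definition connection_time :: "nat \<Rightarrow> nat set list \<Rightarrow> nat" where
  "connection_time n es = (LEAST m. graph_connected n (graph_at es m))"

end

theory Submission
  imports
    Defs
    "Jordan_Normal_Form.Schur_Decomposition"
    "HOL-Real_Asymp.Real_Asymp"
begin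

text \<open>
  Substituting \<open>x = T\<^sup>1\<^sup>/\<^sup>2 y\<close>, the bound says that \<open>\<bar>\<langle>y, A y\<rangle>\<bar>\<close> is at most \<open>C / sqrt (ln n)\<close> times the
  sum of \<open>deg v * (y v)\<^sup>2\<close> whenever the sum of \<open>deg v * y v\<close> vanishes. With high probability the connection
  time lies between \<open>2 / 5 * n * ln n\<close> (there are isolated vertices before) and \<open>2 * n * ln n\<close>. For all
  \<open>m\<close> in this window simultaneously, the method of Kahn and Szemeredi bounds the norm of the centred
  adjacency matrix by a multiple of \<open>sqrt (ln n)\<close>: pairs with a small product of coordinates are handled by
  an exponential moment and a union bound over a net of integer vectors, and the other pairs by the
  maximum degree and a discrepancy estimate, both of which are monotone in the graph and hence only needed
  at the end of the window. This proves the claim for vectors supported on vertices whose degree is at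
  least \<open>ln n / 100\<close>. Throughout the window, the vertices of smaller degree are pairwise nonadjacent and no
  vertex has more than three of them as neighbours, so their contribution is of lower order.
\<close>

text \<open>The connection time depends on the graph, so no estimate can be made at one fixed time:
  each must be monotone or survive a union bound over about \<open>n * ln n\<close> times. The
  threshold \<open>ln n / 100\<close> and the lower end 2/5 of the window belong together. Fewer
  than \<open>n * ln n / 2\<close> edges leave isolated vertices, while from
  \<open>2 / 5 * n * ln n\<close> edges on, where the mean degree is at least
  \<open>4 / 5 * ln n\<close>, a vertex has small degree with probability about
  \<open>n powr - (27 / 50)\<close> at most. What counts is the excess over 1/2. Up to logarithms, a
  vertex with four small neighbours exists with probability at most
  \<open>n powr - (29 / 25)\<close>, which survives the union over times; for three the same
  estimate would not. For an edge between small vertices the bound is only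
  \<open>n powr - (2 / 25)\<close>, good for a single time, hence the argument by steps. With a
  fixed number of edges there is no independence; the exponential tail bounds all go through one
  inequality for products of edge weights.\<close>

unbundle no inner_syntax

section \<open>Spectra of symmetric real matrices\<close>

lemma scalar_prod_symmetric_mat:
  fixes A :: "'a :: comm_semiring_0 mat"
  assumes A: "A \<in> carrier_mat n n" "transpose_mat A = A"
    and x: "x \<in> carrier_vec n" "y \<in> carrier_vec n"
  shows "(A *\<^sub>v y) \<bullet> x = y \<bullet> (A *\<^sub>v x)"
  using transpose_vec_mult_scalar[OF A(1) x] A(2) by simp

lemma symmetric_eigenvalue_real:
  fixes A :: "real mat"
  assumes A: "A \<in> carrier_mat n n" "transpose_mat A = A"
    and e: "eigenvalue (map_mat of_real A :: complex mat) e"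
  shows "e \<in> \<real>"
proof -
  let ?A = "map_mat of_real A :: complex mat"
  have cA: "?A \<in> carrier_mat n n" using A by auto
  have tA: "transpose_mat ?A = ?A" using A(2) by (simp add: map_mat_transpose)
  from e obtain v where v: "v \<in> carrier_vec n" "v \<noteq> 0\<^sub>v n" "?A *\<^sub>v v = e \<cdot>\<^sub>v v"
    using cA unfolding eigenvalue_def eigenvector_def by auto
  have cv: "conjugate v \<in> carrier_vec n" using v by simp
  have conjA: "?A *\<^sub>v conjugate v = conjugate (?A *\<^sub>v v)"
  proof (rule eq_vecI)
    fix i assume "i < dim_vec (conjugate (?A *\<^sub>v v))"
    then have i: "i < n" using cA by simp
    then show "(?A *\<^sub>v conjugate v) $ i = conjugate (?A *\<^sub>v v) $ i"
      using A(1) v(1) by (simp add: scalar_prod_def)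
  qed (use cA in auto)
  have "(?A *\<^sub>v v) \<bullet> conjugate v = v \<bullet> (?A *\<^sub>v conjugate v)"
    by (rule scalar_prod_symmetric_mat[OF cA tA cv v(1)])
  then have "e * (v \<bullet>c v) = cnj e * (v \<bullet>c v)"
    using v cv by (simp add: conjA conjugate_smult_vec)
  moreover have "v \<bullet>c v \<noteq> 0" using v conjugate_square_eq_0_vec[of v n] by blast
  ultimately have "e = cnj e" by simp
  then show ?thesis by (metis Reals_cnj_iff)
qed

text \<open>\<open>sorted_eigenvalues\<close> sees only real roots, so all \<open>n\<close> roots
  have to be real. The polynomial splits over the complex numbers, each root is a real eigenvalue,
  and the embedding of the reals is injective on polynomials, so the factorisation descends.\<close>

lemma symmetric_char_poly_splits:
  fixes A :: "real mat"
  assumes A: "A \<in> carrier_mat n n" "transpose_mat A = A"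
  shows "\<exists>es. char_poly A = (\<Prod>e\<leftarrow>es. [:- e, 1:]) \<and> length es = n"
proof -
  let ?A = "map_mat of_real A :: complex mat"
  interpret map_poly_inj_idom_hom "of_real :: real \<Rightarrow> complex" ..
  have cA: "?A \<in> carrier_mat n n" using A by auto
  obtain as where as: "char_poly ?A = (\<Prod>a\<leftarrow>as. [:- a, 1:])" "length as = n"
    using char_poly_factorized[OF cA] by blast
  have re: "a \<in> \<real>" if "a \<in> set as" for a
  proof -
    have "poly (char_poly ?A) a = 0" using that unfolding as(1) poly_prod_list
      by (auto simp: prod_list_zero_iff)
    then show ?thesis
      using symmetric_eigenvalue_real[OF A] eigenvalue_root_char_poly[OF cA] by blast
  qed
  let ?es = "map Re as"
  have eq: "map_poly complex_of_real (\<Prod>e\<leftarrow>map Re bs. [:- e, 1:]) = (\<Prod>a\<leftarrow>bs. [:- a, 1:])"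
    if "set bs \<subseteq> \<real>" for bs
    using that
  proof (induction bs)
    case (Cons b bs)
    then show ?case
      by (simp add: hom_mult del: mult_pCons_left)
  qed simp
  have "map_poly complex_of_real (char_poly A) = char_poly ?A"
    by (rule of_real_hom.char_poly_hom[OF A(1), symmetric])
  also have "\<dots> = map_poly complex_of_real (\<Prod>e\<leftarrow>?es. [:- e, 1:])"
    using eq[of as] re unfolding as(1) by (metis subsetI)
  finally have "char_poly A = (\<Prod>e\<leftarrow>?es. [:- e, 1:])"
    by (simp only: eq_iff)
  then show ?thesis using as(2) by (metis length_map)
qed

text \<open>
  In a Schur form with diagonal \<open>0, 0, \<dots>\<close> the first two columns \<open>p\<close>, \<open>q\<close> of the transition matrix satisfy
  \<open>A p = 0\<close> and \<open>A q = b p\<close>, so \<open>A (A q) = 0\<close> and by symmetry \<open>A q = 0\<close>. Hence an algebraically double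
  eigenvalue 0 already has a two-dimensional kernel.
\<close>

lemma symmetric_double_kernel:
  fixes A :: "real mat"
  assumes A: "A \<in> carrier_mat n n" "transpose_mat A = A"
    and cp: "char_poly A = (\<Prod>e\<leftarrow>0 # 0 # es. [:- e, 1:])"
    and u: "u \<in> carrier_vec n"
  obtains v where "v \<in> carrier_vec n" "v \<noteq> 0\<^sub>v n" "A *\<^sub>v v = 0\<^sub>v n" "u \<bullet> v = 0"
proof -
  obtain B P Q where s: "schur_decomposition A (0 # 0 # es) = (B, P, Q)"
    by (rule prod_cases3)
  from schur_decomposition[OF A(1) cp s]
  have sim: "similar_mat_wit A B P Q" and ut: "upper_triangular B"
    and di: "diag_mat B = 0 # 0 # es" by auto
  note w = similar_mat_witD2[OF A(1) sim]
  have c: "B \<in> carrier_mat n n" "P \<in> carrier_mat n n" "Q \<in> carrier_mat n n" using w by auto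
  have "length (diag_mat B) = n" using c by (simp add: diag_mat_def)
  then have n: "1 < n" using di by simp
  have b0: "B $$ (0,0) = 0"
    using arg_cong[OF di, of "\<lambda>l. l ! 0"] n c by (simp add: diag_mat_def)
  have b1: "B $$ (1,1) = 0"
    using arg_cong[OF di, of "\<lambda>l. l ! 1"] n c by (simp add: diag_mat_def)
  have AP: "A * P = P * B"
  proof -
    have "A * P = P * B * Q * P" using w by simp
    also have "\<dots> = P * B * (Q * P)" using c by (simp add: assoc_mult_mat[of _ n n _ n _ n])
    also have "\<dots> = P * B" using w c by simp
    finally show ?thesis .
  qed
  have mv0: "M *\<^sub>v 0\<^sub>v n = 0\<^sub>v n" if "M \<in> carrier_mat n n" for M :: "real mat"
    using that by (intro eq_vecI) auto
  have s0: "c \<cdot>\<^sub>v 0\<^sub>v n = 0\<^sub>v n" for c :: real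
    by (intro eq_vecI) auto
  have z0: "0 \<cdot>\<^sub>v x = 0\<^sub>v n" if "x \<in> carrier_vec n" for x :: "real vec"
    using that by (intro eq_vecI) auto
  define p where "p i = col P i" for i
  have pc: "p i \<in> carrier_vec n" for i using c unfolding p_def by auto
  have colA: "A *\<^sub>v p i = P *\<^sub>v col B i" if "i < n" for i
    using that c A AP unfolding p_def by (metis col_mult2)
  have colB0: "col B 0 = 0\<^sub>v n"
  proof (rule eq_vecI)
    fix i assume "i < dim_vec (0\<^sub>v n :: real vec)"
    then show "col B 0 $ i = 0\<^sub>v n $ i"
      using n c ut b0 by (cases "i = 0") (auto simp: upper_triangular_def)
  qed (use c in auto)
  have colB1: "col B 1 = B $$ (0,1) \<cdot>\<^sub>v unit_vec n 0"
  proof (rule eq_vecI)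
    fix i assume "i < dim_vec (B $$ (0,1) \<cdot>\<^sub>v unit_vec n 0)"
    then have i: "i < n" by simp
    consider "i = 0" | "i = 1" | "1 < i" by linarith
    then show "col B 1 $ i = (B $$ (0,1) \<cdot>\<^sub>v unit_vec n 0) $ i"
      using i n c ut b1 by cases (auto simp: upper_triangular_def unit_vec_def)
  qed (use c in auto)
  have Ap0: "A *\<^sub>v p 0 = 0\<^sub>v n" using colA[of 0] n colB0 mv0 c by simp
  have Ap1: "A *\<^sub>v p 1 = B $$ (0,1) \<cdot>\<^sub>v p 0"
  proof -
    have "A *\<^sub>v p 1 = B $$ (0,1) \<cdot>\<^sub>v (P *\<^sub>v unit_vec n 0)"
      using colA[of 1] n colB1 c by (simp add: mult_mat_vec[of _ n n])
    also have "P *\<^sub>v unit_vec n 0 = p 0"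
      unfolding p_def using c n by (intro eq_vecI) auto
    finally show ?thesis .
  qed
  have AAp1: "A *\<^sub>v (A *\<^sub>v p 1) = 0\<^sub>v n"
    unfolding Ap1 using Ap0 pc A(1) s0 by (simp add: mult_mat_vec[of _ n n])
  have Ap1c: "A *\<^sub>v p 1 \<in> carrier_vec n" using A pc by simp
  have "(A *\<^sub>v p 1) \<bullet> (A *\<^sub>v p 1) = p 1 \<bullet> (A *\<^sub>v (A *\<^sub>v p 1))"
    by (rule scalar_prod_symmetric_mat[OF A Ap1c pc])
  also have "\<dots> = 0" unfolding AAp1 using pc by simp
  finally have Ap1z: "A *\<^sub>v p 1 = 0\<^sub>v n"
    using conjugate_square_eq_0_vec[OF Ap1c] by (simp add: conjugate_id)
  have indep: "a = 0 \<and> b = 0" if "a \<cdot>\<^sub>v p 0 + b \<cdot>\<^sub>v p 1 = 0\<^sub>v n" for a b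
  proof -
    have Qp: "Q *\<^sub>v p i = unit_vec n i" if "i < n" for i
    proof -
      have "Q *\<^sub>v p i = col (Q * P) i" unfolding p_def using that c by (metis col_mult2)
      then show ?thesis using w that by simp
    qed
    have "Q *\<^sub>v (a \<cdot>\<^sub>v p 0 + b \<cdot>\<^sub>v p 1) = a \<cdot>\<^sub>v unit_vec n 0 + b \<cdot>\<^sub>v unit_vec n 1"
      using pc c n Qp by (simp add: mult_add_distrib_mat_vec[of _ n n] mult_mat_vec[of _ n n])
    then have z: "a \<cdot>\<^sub>v unit_vec n 0 + b \<cdot>\<^sub>v unit_vec n 1 = 0\<^sub>v n" using that c mv0 by simp
    show ?thesis
      using arg_cong[OF z, of "\<lambda>x. vec_index x 0"] arg_cong[OF z, of "\<lambda>x. vec_index x 1"] n by auto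
  qed
  show ?thesis
  proof (cases "u \<bullet> p 0 = 0")
    case True
    have "p 0 \<noteq> 0\<^sub>v n"
    proof
      assume "p 0 = 0\<^sub>v n"
      then have "1 \<cdot>\<^sub>v p 0 + 0 \<cdot>\<^sub>v p 1 = 0\<^sub>v n" using pc[of 1] s0 z0 by simp
      from indep[OF this] show False by simp
    qed
    then show ?thesis using that pc Ap0 True by blast
  next
    case False
    let ?v = "(u \<bullet> p 1) \<cdot>\<^sub>v p 0 + (- (u \<bullet> p 0)) \<cdot>\<^sub>v p 1"
    have "?v \<noteq> 0\<^sub>v n" using indep[of "u \<bullet> p 1" "- (u \<bullet> p 0)"] False by (metis neg_equal_0_iff_equal)
    moreover have "A *\<^sub>v ?v = 0\<^sub>v n"
      using pc A(1) Ap0 Ap1z s0 by (simp add: mult_add_distrib_mat_vec[of _ n n] mult_mat_vec[of _ n n])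
    moreover have "u \<bullet> ?v = 0" using pc u
      by (simp add: scalar_prod_add_distrib[of _ n])
    ultimately show ?thesis using that[of ?v] pc by simp
  qed
qed

lemma proots_prod_list_linear:
  "proots (\<Prod>e\<leftarrow>es. [:- e, 1:]) = mset (es :: 'a :: idom list)"
proof (induction es)
  case (Cons e es)
  have "(\<Prod>e\<leftarrow>es. [:- e, 1:]) \<noteq> 0" by (auto simp: prod_list_zero_iff)
  then have "proots ([:- e, 1:] * (\<Prod>e\<leftarrow>es. [:- e, 1:])) = add_mset e (mset es)"
    using Cons by (subst proots_mult) auto
  then show ?case by simp
qed simp

text \<open>The bound \<open>B < 1\<close> does double duty. If 0 were a double root, a kernel
  vector orthogonal to \<open>u\<close> would satisfy
  \<open>v \<bullet> v \<le> B * (v \<bullet> v)\<close>, which is absurd; and every other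
  eigenvalue lies within \<open>B\<close> of 1, hence is positive. So index 0 of the sorted list is
  exactly the eigenvalue of \<open>u\<close>. Instead of an orthonormal eigenbasis, symmetry makes
  eigenvectors of nonzero eigenvalues orthogonal to \<open>u\<close>.\<close>

lemma sorted_eigenvalues_bound:
  fixes A :: "real mat"
  assumes A: "A \<in> carrier_mat n n" "transpose_mat A = A"
    and u: "u \<in> carrier_vec n" "u \<noteq> 0\<^sub>v n" "A *\<^sub>v u = 0\<^sub>v n"
    and B: "\<And>v. v \<in> carrier_vec n \<Longrightarrow> u \<bullet> v = 0 \<Longrightarrow> \<bar>v \<bullet> v - v \<bullet> (A *\<^sub>v v)\<bar> \<le> B * (v \<bullet> v)"
    and B1: "B < 1" and i: "i \<in> {1..<n}"
  shows "\<bar>1 - sorted_eigenvalues A ! i\<bar> \<le> B"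
proof -
  have pos: "v \<bullet> v > 0" if "v \<in> carrier_vec n" "v \<noteq> 0\<^sub>v n" for v :: "real vec"
    using conjugate_square_greater_0_vec[OF that(1)] that(2) by (simp add: conjugate_vec_def vec_eq_iff)
  obtain es where es: "char_poly A = (\<Prod>e\<leftarrow>es. [:- e, 1:])" "length es = n"
    using symmetric_char_poly_splits[OF A] by blast
  have ms: "proots (char_poly A) = mset es" unfolding es(1) by (rule proots_prod_list_linear)
  have ev: "eigenvalue A e \<longleftrightarrow> e \<in> set es" for e
    unfolding eigenvalue_root_char_poly[OF A(1)] es(1) poly_prod_list
    by (auto simp: prod_list_zero_iff)
  have "eigenvector A u 0" unfolding eigenvector_def using u A by auto
  then have "0 \<in> set es" using ev unfolding eigenvalue_def by blast
  then obtain fs where fs: "mset es = mset (0 # fs)"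
    using that[of "remove1 0 es"] by simp
  have nz: "0 \<notin> set fs"
  proof
    assume "0 \<in> set fs"
    then obtain gs where gs: "mset fs = mset (0 # gs)"
      using that[of "remove1 0 fs"] by simp
    have "mset es = mset (0 # 0 # gs)" using fs gs by simp
    then have "(\<Prod>e\<leftarrow>es. [:- e, 1:]) = (\<Prod>e\<leftarrow>0 # 0 # gs. [:- e, 1:])"
      by (simp only: prod_mset_prod_list[symmetric] mset_map)
    then obtain v where v: "v \<in> carrier_vec n" "v \<noteq> 0\<^sub>v n" "A *\<^sub>v v = 0\<^sub>v n" "u \<bullet> v = 0"
      using symmetric_double_kernel[OF A _ u(1)] es(1) by metis
    from B[OF v(1,4)] v(1,3) have "\<bar>v \<bullet> v\<bar> \<le> B * (v \<bullet> v)" by simp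
    with pos[OF v(1,2)] B1 show False
      by (metis abs_of_pos linorder_not_le mult_less_cancel_right2 not_less_iff_gr_or_eq)
  qed
  have bnd: "\<bar>1 - e\<bar> \<le> B" if e: "e \<in> set fs" for e
  proof -
    have "e \<in> set es" using e mset_eq_setD[OF fs] by simp
    then obtain v where v: "v \<in> carrier_vec n" "v \<noteq> 0\<^sub>v n" "A *\<^sub>v v = e \<cdot>\<^sub>v v"
      using ev A unfolding eigenvalue_def eigenvector_def by auto
    have "(A *\<^sub>v u) \<bullet> v = u \<bullet> (A *\<^sub>v v)" by (rule scalar_prod_symmetric_mat[OF A v(1) u(1)])
    then have "e * (u \<bullet> v) = 0" using u v by simp
    then have "u \<bullet> v = 0" using e nz by auto
    from B[OF v(1) this] have "\<bar>(1 - e) * (v \<bullet> v)\<bar> \<le> B * (v \<bullet> v)"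
      using v by (simp add: algebra_simps)
    then show ?thesis using pos[OF v(1,2)] by (simp add: abs_mult)
  qed
  have fspos: "0 < e" if "e \<in> set fs" for e using bnd[OF that] B1 by linarith
  have "sorted_eigenvalues A = sort (0 # fs)"
    unfolding sorted_eigenvalues_def ms fs sorted_list_of_multiset_mset ..
  also have "\<dots> = 0 # sort fs"
    using fspos by (intro properties_for_sort) (auto intro: less_imp_le)
  finally have "sorted_eigenvalues A ! i = sort fs ! (i - 1)" using i by (simp add: nth_Cons')
  moreover have "length fs = n - 1" using arg_cong[OF fs, of size] es(2) by simp
  then have "sort fs ! (i - 1) \<in> set (sort fs)" using i by (intro nth_mem) auto
  ultimately show ?thesis using bnd by simp
qed

section \<open>The adjacency form\<close>

text \<open>The sum runs over ordered pairs, so an edge contributes in both orientations, as in the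
  matrix form \<open>x^T A y\<close>.\<close>

definition edge_form :: "nat \<Rightarrow> nat set set \<Rightarrow> (nat \<Rightarrow> real) \<Rightarrow> (nat \<Rightarrow> real) \<Rightarrow> real" where
  "edge_form n E x y = (\<Sum>i<n. \<Sum>j<n. if {i, j} \<in> E then x i * y j else 0)"

lemma degree_of_eq_card_neighbours:
  assumes E: "E \<subseteq> all_edges n"
  shows "degree_of E v = card {w. w < n \<and> {v, w} \<in> E}"
proof -
  have "bij_betw (\<lambda>w. {v, w}) {w. w < n \<and> {v, w} \<in> E} {e \<in> E. v \<in> e}"
  proof (rule bij_betwI')
    fix x y assume "x \<in> {w. w < n \<and> {v, w} \<in> E}" "y \<in> {w. w < n \<and> {v, w} \<in> E}"
    then show "({v, x} = {v, y}) = (x = y)" by (auto simp: doubleton_eq_iff)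
  next
    fix e assume e: "e \<in> {e \<in> E. v \<in> e}"
    then have "card e = 2" "e \<subseteq> {..<n}" using E unfolding all_edges_def by auto
    then obtain a b where "e = {a, b}" by (meson card_2_iff)
    then show "\<exists>x\<in>{w. w < n \<and> {v, w} \<in> E}. e = {v, x}"
      using e \<open>e \<subseteq> {..<n}\<close> by (auto simp: insert_commute)
  qed auto
  then show ?thesis unfolding degree_of_def by (simp add: bij_betw_same_card)
qed

lemma degree_of_eq_sum:
  assumes "E \<subseteq> all_edges n"
  shows "real (degree_of E v) = (\<Sum>w<n. if {v, w} \<in> E then 1 else 0)"
proof -
  have "{w. w < n \<and> {v, w} \<in> E} = {w \<in> {..<n}. {v, w} \<in> E}" by auto
  then show ?thesis unfolding degree_of_eq_card_neighbours[OF assms]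
    by (simp add: sum.If_cases Int_def)
qed

lemma normalized_laplacian_entries:
  assumes deg: "\<And>v. v < n \<Longrightarrow> degree_of E v > 0"
  shows "normalized_laplacian n E = Matrix.mat n n (\<lambda>(i, j). (if i = j then 1 else 0) -
    (if {i, j} \<in> E then 1 / (sqrt (degree_of E i) * sqrt (degree_of E j)) else 0))"
proof -
  let ?f = "\<lambda>v. if degree_of E v = 0 then 0 else 1 / sqrt (real (degree_of E v))"
  have 1: "inv_sqrt_degree_mat n E * adjacency_mat n E = 
     Matrix.mat n n (\<lambda>(i, j). ?f i * adjacency_mat n E $$ (i, j))"
    unfolding inv_sqrt_degree_mat_def
    by (rule mat_diag_mult_left) (simp add: adjacency_mat_def)
  have 2: "inv_sqrt_degree_mat n E * adjacency_mat n E * inv_sqrt_degree_mat n E =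
     Matrix.mat n n (\<lambda>(i, j). (inv_sqrt_degree_mat n E * adjacency_mat n E) $$ (i, j) * ?f j)"
    unfolding inv_sqrt_degree_mat_def
    by (rule mat_diag_mult_right, rule mult_carrier_mat[of _ n n]) (auto simp: adjacency_mat_def)
  show ?thesis
    unfolding normalized_laplacian_def 2 unfolding 1
    by (rule eq_matI) (auto simp: pos_degree_proj_def adjacency_mat_def mat_diag_def dest: deg)
qed

lemma spectral_lambda_le:
  assumes E: "E \<subseteq> all_edges n" and n: "n \<ge> 2"
    and deg: "\<And>v. v < n \<Longrightarrow> degree_of E v > 0"
    and form: "\<And>y. (\<Sum>v<n. real (degree_of E v) * y v) = 0 \<Longrightarrow>
      \<bar>edge_form n E y y\<bar> \<le> B * (\<Sum>v<n. real (degree_of E v) * (y v)\<^sup>2)"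
    and B: "B < 1"
  shows "spectral_lambda n E \<le> B"
proof -
  let ?L = "normalized_laplacian n E"
  let ?s = "\<lambda>i. sqrt (real (degree_of E i))"
  note L = normalized_laplacian_entries[OF deg]
  have s: "?s i > 0" if "i < n" for i using deg[OF that] by simp
  have ss: "?s i * ?s i = real (degree_of E i)" for i by simp
  \<comment> \<open>The kernel vector \<open>T^(1/2) 1\<close>. Orthogonality to it becomes the side
    condition of \<open>form\<close> after dividing coordinates by \<open>?s\<close>.\<close>
  define u where "u = Matrix.vec n ?s"
  have Lc: "?L \<in> carrier_mat n n" by (simp add: L)
  have Lt: "transpose_mat ?L = ?L"
    by (rule eq_matI) (auto simp: L insert_commute mult.commute)
  have uc: "u \<in> carrier_vec n" by (simp add: u_def)
  have u0: "u \<noteq> 0\<^sub>v n"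
  proof
    assume "u = 0\<^sub>v n"
    then have "vec_index u 0 = 0" using n by simp
    then show False using s[of 0] n by (simp add: u_def)
  qed
  have row: "(\<Sum>j<n. ((if i = j then 1 else 0) - (if {i, j} \<in> E then 1 / (?s i * ?s j) else 0)) * w j)
     = w i - (\<Sum>j<n. if {i, j} \<in> E then w j / (?s i * ?s j) else 0)" if "i < n" for i and w :: "nat \<Rightarrow> real"
  proof -
    have "(\<Sum>j<n. ((if i = j then 1 else 0) - (if {i, j} \<in> E then 1 / (?s i * ?s j) else 0)) * w j)
      = (\<Sum>j<n. (if i = j then w j else 0) - (if {i, j} \<in> E then w j / (?s i * ?s j) else 0))"
      by (rule sum.cong) (auto simp: algebra_simps)
    then show ?thesis using that by (simp add: sum_subtractf)
  qed
  have Lv: "vec_index (?L *\<^sub>v v) i = vec_index v i - (\<Sum>j<n. if {i, j} \<in> E then vec_index v j / (?s i * ?s j) else 0)"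
    if "v \<in> carrier_vec n" "i < n" for v i
  proof -
    have "vec_index (?L *\<^sub>v v) i = (\<Sum>j<n. ((if i = j then 1 else 0) - 
        (if {i, j} \<in> E then 1 / (?s i * ?s j) else 0)) * vec_index v j)"
      using that by (simp add: L scalar_prod_def lessThan_atLeast0)
    then show ?thesis using row[OF that(2)] by simp
  qed
  have Lu: "?L *\<^sub>v u = 0\<^sub>v n"
  proof (rule eq_vecI)
    fix i assume "i < dim_vec (0\<^sub>v n :: real vec)"
    then have i: "i < n" by simp
    have "(\<Sum>j<n. if {i, j} \<in> E then vec_index u j / (?s i * ?s j) else 0)
      = (\<Sum>j<n. (if {i, j} \<in> E then 1 else 0) / ?s i)"
      using s by (intro sum.cong) (auto simp: u_def less_imp_neq[symmetric])
    also have "\<dots> = real (degree_of E i) / ?s i"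
      unfolding degree_of_eq_sum[OF E] sum_divide_distrib ..
    also have "\<dots> = ?s i" by (simp add: real_div_sqrt)
    finally show "vec_index (?L *\<^sub>v u) i = vec_index (0\<^sub>v n) i"
      using Lv[OF uc i] i by (simp add: u_def)
  qed (use Lc in auto)
  have key: "\<bar>scalar_prod v v - scalar_prod v (?L *\<^sub>v v)\<bar> \<le> B * scalar_prod v v"
    if v: "v \<in> carrier_vec n" and uv: "scalar_prod u v = 0" for v
  proof -
    define y where "y i = vec_index v i / ?s i" for i
    have sy: "real (degree_of E i) * y i = ?s i * vec_index v i" if "i < n" for i
      using s[OF that] ss[of i] by (simp add: y_def field_simps)
    have sy2: "real (degree_of E i) * (y i)\<^sup>2 = vec_index v i * vec_index v i" if "i < n" for i
      using s[OF that] by (simp add: y_def power_divide power2_eq_square)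
    have y0: "(\<Sum>i<n. real (degree_of E i) * y i) = 0"
      using uv v by (simp add: scalar_prod_def u_def sy lessThan_atLeast0)
    have yy: "(\<Sum>i<n. real (degree_of E i) * (y i)\<^sup>2) = scalar_prod v v"
      using v by (simp add: scalar_prod_def sy2 lessThan_atLeast0)
    have "scalar_prod v (?L *\<^sub>v v) = (\<Sum>i<n. vec_index v i * vec_index (?L *\<^sub>v v) i)"
      using Lc by (simp add: scalar_prod_def lessThan_atLeast0)
    also have "\<dots> = (\<Sum>i<n. vec_index v i * vec_index v i - 
       (\<Sum>j<n. if {i, j} \<in> E then y i * y j else 0))"
      by (intro sum.cong refl)
        (auto simp: Lv[OF v] right_diff_distrib sum_distrib_left y_def intro!: sum.cong)
    also have "\<dots> = scalar_prod v v - edge_form n E y y"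
      using v by (simp add: sum_subtractf edge_form_def scalar_prod_def lessThan_atLeast0)
    finally show ?thesis using form[OF y0] yy by simp
  qed
  have "\<forall>i\<in>{1..<n}. \<bar>1 - sorted_eigenvalues ?L ! i\<bar> \<le> B"
    using sorted_eigenvalues_bound[OF Lc Lt uc u0 Lu key B] by blast
  then show ?thesis unfolding spectral_lambda_def using n by (subst Max_le_iff) auto
qed

section \<open>The uniform random graph\<close>

lemma prob_exists_le:
  assumes "finite I" "\<And>i. i \<in> I \<Longrightarrow> measure_pmf.prob M {x. Q i x} \<le> b i"
  shows "measure_pmf.prob M {x. \<exists>i\<in>I. Q i x} \<le> (\<Sum>i\<in>I. b i)"
proof -
  have "{x. \<exists>i\<in>I. Q i x} = (\<Union>i\<in>I. {x. Q i x})" by auto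
  then have "measure_pmf.prob M {x. \<exists>i\<in>I. Q i x} \<le> (\<Sum>i\<in>I. measure_pmf.prob M {x. Q i x})"
    using assms(1) by (simp add: measure_pmf.finite_measure_subadditive_finite)
  also have "\<dots> \<le> (\<Sum>i\<in>I. b i)" using assms(2) by (rule sum_mono)
  finally show ?thesis .
qed

lemma prob_exists_le_const:
  assumes "finite I" "\<And>i. i \<in> I \<Longrightarrow> measure_pmf.prob M {x. Q i x} \<le> b"
  shows "measure_pmf.prob M {x. \<exists>i\<in>I. Q i x} \<le> real (card I) * b"
  using prob_exists_le[OF assms(1), of M Q "\<lambda>_. b"] assms(2) by simp

lemma prob_disj_le:
  assumes "measure_pmf.prob M {x. P x} \<le> a" "measure_pmf.prob M {x. Q x} \<le> b"
  shows "measure_pmf.prob M {x. P x \<or> Q x} \<le> a + b"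
proof -
  have "{x. P x \<or> Q x} = {x. P x} \<union> {x. Q x}" by auto
  then have "measure_pmf.prob M {x. P x \<or> Q x} \<le> measure_pmf.prob M {x. P x} + measure_pmf.prob M {x. Q x}"
    using measure_Un_le[of "{x. P x}" M "{x. Q x}"] by simp
  then show ?thesis using assms by linarith
qed

lemma prob_pmf_not: "measure_pmf.prob M {x. \<not> P x} = 1 - measure_pmf.prob M {x. P x}"
  using measure_pmf.prob_compl[of "{x. P x}" M] by (simp add: Compl_eq_Diff_UNIV[symmetric] Collect_neg_eq)

section \<open>Marginals of the graph process: uniform edge sets of given size\<close>

definition uniform_graph :: "nat \<Rightarrow> nat \<Rightarrow> nat set set pmf" where
  "uniform_graph n m = pmf_of_set {S. S \<subseteq> all_edges n \<and> card S = m}"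

lemma finite_all_edges [simp]: "finite (all_edges n)"
  unfolding all_edges_def by simp

lemma card_all_edges: "card (all_edges n) = n choose 2"
  unfolding all_edges_def by (simp add: n_subsets)

lemma subsets_of_card_nonempty:
  assumes "finite A" "m \<le> card A"
  shows "{S. S \<subseteq> A \<and> card S = m} \<noteq> {}"
  using obtain_subset_with_card_n[OF assms(2)] by blast

text \<open>A set \<open>T\<close> of size \<open>m + 1\<close> is reached from exactly its
  \<open>m + 1\<close> subsets of size \<open>m\<close>, each with transition probability
  \<open>1 / (N - m)\<close>. The result is uniform because
  \<open>(m + 1) * (N choose (m + 1)) = (N - m) * (N choose m)\<close>.\<close>

lemma bind_uniform_subset:
  fixes E :: "'a set"
  assumes E: "finite E" and m: "m < card E"
  shows "pmf_of_set {S. S \<subseteq> E \<and> card S = m} \<bind> (\<lambda>S. map_pmf (\<lambda>e. insert e S) (pmf_of_set (E - S)))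
    = pmf_of_set {S. S \<subseteq> E \<and> card S = Suc m}"
proof (rule pmf_eqI)
  fix T
  let ?N = "card E"
  let ?A = "{S. S \<subseteq> E \<and> card S = m}" and ?B = "{S. S \<subseteq> E \<and> card S = Suc m}"
  have ne: "?A \<noteq> {}" "?B \<noteq> {}" using subsets_of_card_nonempty[OF E] m by simp_all
  have fin: "finite ?A" "finite ?B" using E by auto
  have cA: "card ?A = ?N choose m" and cB: "card ?B = ?N choose Suc m" using E by (simp_all add: n_subsets)
  have step: "pmf (map_pmf (\<lambda>e. insert e S) (pmf_of_set (E - S))) T =
    (if S \<subseteq> T \<and> T \<in> ?B then 1 / real (?N - m) else 0)" if S: "S \<in> ?A" for S
  proof -
    have finS: "finite S" using S E finite_subset by auto
    have cES: "card (E - S) = ?N - m" using S E finS by (simp add: card_Diff_subset)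
    then have ne': "E - S \<noteq> {}" using m by force
    have set: "(E - S) \<inter> ((\<lambda>e. insert e S) -` {T}) = (if S \<subseteq> T \<and> T \<in> ?B then T - S else {})"
      (is "?l = _")
    proof (cases "S \<subseteq> T \<and> T \<in> ?B")
      case True
      then have "finite T" using E finite_subset by auto
      then have "card (T - S) = 1" using True S finS by (simp add: card_Diff_subset)
      then obtain e where e: "T - S = {e}" by (meson card_1_singletonE)
      then have "T = insert e S" using True by blast
      then show ?thesis using True e S by auto
    next
      case False
      have "?l = {}"
      proof (rule equals0I)
        fix e assume "e \<in> ?l"
        then have e: "e \<in> E" "e \<notin> S" "T = insert e S" by simp_all
        then have "card T = Suc m" "T \<subseteq> E" using S finS by simp_all
        then show False using False e(3) by blast
      qed
      then show ?thesis unfolding if_not_P[OF False] .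
    qed
    have "card (T - S) = 1" if "S \<subseteq> T" "T \<in> ?B"
      using that S finS by (simp add: card_Diff_subset)
    then show ?thesis
      using ne' E by (simp add: pmf_map measure_pmf_of_set set cES)
  qed
  have "pmf (pmf_of_set ?A \<bind> (\<lambda>S. map_pmf (\<lambda>e. insert e S) (pmf_of_set (E - S)))) T
     = (\<Sum>S\<in>?A. if S \<subseteq> T \<and> T \<in> ?B then 1 / real (?N - m) else 0) / real (card ?A)"
    unfolding pmf_bind integral_pmf_of_set[OF ne(1) fin(1)]
    by (intro arg_cong2[where f="(/)"] sum.cong refl) (rule step)
  also have "\<dots> = (if T \<in> ?B then 1 / real (card ?B) else 0)"
  proof (cases "T \<in> ?B")
    case True
    then have T: "T \<subseteq> E" "card T = Suc m" by auto
    have "{S \<in> ?A. S \<subseteq> T} = {S. S \<subseteq> T \<and> card S = m}" using T by auto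
    moreover have "finite T" using T E finite_subset by blast
    ultimately have c: "card {S \<in> ?A. S \<subseteq> T} = Suc m" using T by (simp add: n_subsets)
    have "(\<Sum>S\<in>?A. if S \<subseteq> T \<and> T \<in> ?B then 1 / real (?N - m) else 0)
      = (\<Sum>S\<in>{S \<in> ?A. S \<subseteq> T}. 1 / real (?N - m))"
      using True by (subst sum.inter_filter[OF fin(1)]) simp
    also have "\<dots> = real (Suc m) / real (?N - m)" using c by simp
    finally have e: "(\<Sum>S\<in>?A. if S \<subseteq> T \<and> T \<in> ?B then 1 / real (?N - m) else 0) = real (Suc m) / real (?N - m)" .
    have "Suc m * (?N choose Suc m) = (?N - m) * (?N choose m)"
      by (metis binomial_absorb_comp binomial_absorption mult.commute)
    then have "real (Suc m) * real (?N choose Suc m) = real (?N - m) * real (?N choose m)"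
      by (metis of_nat_mult)
    moreover have "real (?N - m) > 0" "real (?N choose m) > 0" "real (?N choose Suc m) > 0" using m by simp_all
    ultimately show ?thesis using True unfolding e cA cB by (simp add: field_simps del: of_nat_Suc)
  next
    case False
    then have "(\<Sum>S\<in>?A. if S \<subseteq> T \<and> T \<in> ?B then 1 / real (?N - m) else 0) = 0"
      by (intro sum.neutral) auto
    then show ?thesis unfolding if_not_P[OF False] by simp
  qed
  also have "\<dots> = pmf (pmf_of_set ?B) T" using ne(2) fin(2) by (simp add: indicator_def)
  finally show "pmf (pmf_of_set ?A \<bind> (\<lambda>S. map_pmf (\<lambda>e. insert e S) (pmf_of_set (E - S)))) T = 
    pmf (pmf_of_set ?B) T" .
qed

lemma edge_process_set:
  "m \<le> n choose 2 \<Longrightarrow> map_pmf set (edge_process n m) = uniform_graph n m"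
proof (induction m)
  case 0
  have "{S. S \<subseteq> all_edges n \<and> card S = 0} = {{}}"
    by (auto dest: finite_subset[OF _ finite_all_edges])
  then show ?case by (simp add: uniform_graph_def pmf_of_set_singleton)
next
  case (Suc m)
  have "map_pmf set (edge_process n (Suc m)) = 
    map_pmf set (edge_process n m) \<bind> (\<lambda>S. map_pmf (\<lambda>e. insert e S) (pmf_of_set (all_edges n - S)))"
    by (simp add: map_bind_pmf bind_map_pmf pmf.map_comp o_def)
  also have "\<dots> = uniform_graph n (Suc m)"
    using Suc bind_uniform_subset[OF finite_all_edges, of m n]
    by (simp add: uniform_graph_def card_all_edges)
  finally show ?case .
qed

lemma length_edge_process: "es \<in> set_pmf (edge_process n m) \<Longrightarrow> length es = m"
  by (induction m arbitrary: es) auto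

lemma edge_process_take:
  assumes "m \<le> M"
  shows "map_pmf (take m) (edge_process n M) = edge_process n m"
  using assms
proof (induction M)
  case (Suc M)
  show ?case
  proof (cases "m = Suc M")
    case True
    have "map_pmf (take m) (edge_process n m) = map_pmf (\<lambda>es. es) (edge_process n m)"
      by (rule map_pmf_cong) (auto dest: length_edge_process)
    then show ?thesis using True by simp
  next
    case False
    then have m: "m \<le> M" using Suc by simp
    have "map_pmf (take m) (edge_process n (Suc M)) = edge_process n M \<bind>
       (\<lambda>es. map_pmf (\<lambda>e. take m es) (pmf_of_set (all_edges n - set es)))"
      using m by (auto simp: map_bind_pmf pmf.map_comp o_def dest!: length_edge_process intro!: bind_pmf_cong map_pmf_cong)
    also have "\<dots> = map_pmf (take m) (edge_process n M)"
      by (simp add: map_pmf_const map_pmf_def[symmetric])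
    finally show ?thesis using Suc m by simp
  qed
qed simp

lemma graph_process_take:
  assumes "m \<le> n choose 2"
  shows "map_pmf (take m) (graph_process n) = edge_process n m"
  unfolding graph_process_def using assms by (rule edge_process_take)

lemma graph_process_graph_at:
  assumes "m \<le> n choose 2"
  shows "map_pmf (\<lambda>es. graph_at es m) (graph_process n) = uniform_graph n m"
proof -
  have "map_pmf (\<lambda>es. graph_at es m) (graph_process n) = map_pmf set (map_pmf (take m) (graph_process n))"
    by (simp add: pmf.map_comp o_def graph_at_def)
  then show ?thesis using assms by (simp add: graph_process_take edge_process_set)
qed

lemma prob_graph_at:
  assumes "m \<le> n choose 2"
  shows "measure_pmf.prob (graph_process n) {es. Q (graph_at es m)} = measure_pmf.prob (uniform_graph n m) {S. Q S}"
  unfolding graph_process_graph_at[OF assms, symmetric] by (simp add: vimage_def)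

abbreviation (input) gprob :: "nat \<Rightarrow> nat \<Rightarrow> nat set set set \<Rightarrow> real" where
  "gprob n m \<equiv> measure_pmf.prob (uniform_graph n m)"

lemma set_pmf_uniform_graph:
  assumes "m \<le> n choose 2"
  shows "set_pmf (uniform_graph n m) = {S. S \<subseteq> all_edges n \<and> card S = m}"
  unfolding uniform_graph_def
  by (rule set_pmf_of_set) (use assms in \<open>auto simp: card_all_edges intro!: subsets_of_card_nonempty[simplified]\<close>)

lemma uniform_graph_prob_mono:
  assumes m: "m \<le> n choose 2" and "\<And>S. S \<subseteq> all_edges n \<Longrightarrow> card S = m \<Longrightarrow> Q S \<Longrightarrow> R S"
  shows "gprob n m {S. Q S} \<le> gprob n m {S. R S}"
  by (rule measure_pmf.finite_measure_mono_AE)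
    (use assms in \<open>auto simp: AE_measure_pmf_iff set_pmf_uniform_graph[OF m]\<close>)

text \<open>Maclaurin's inequality for elementary symmetric sums. It replaces independence of the edges:
  under the uniform measure on \<open>m\<close>-subsets, the expectation of a product over the chosen elements is
  at most its value for \<open>m\<close> independent draws. The induction step, which splits off one element, is
  Bernoulli's inequality after normalising the mean of the others to 1.\<close>

lemma maclaurin_subsets:
  fixes a :: "'a \<Rightarrow> real"
  assumes "finite A" "\<And>x. x \<in> A \<Longrightarrow> a x \<ge> 0"
  shows "(\<Sum>S | S \<subseteq> A \<and> card S = m. \<Prod>x\<in>S. a x) \<le> (card A choose m) * ((\<Sum>x\<in>A. a x) / card A) ^ m"
  using assms
proof (induction A arbitrary: m rule: finite_induct)
  case empty
  have "{S :: 'a set. S \<subseteq> {} \<and> card S = m} = (if m = 0 then {{}} else {})" by auto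
  then show ?case by simp
next
  case (insert x A)
  show ?case
  proof (cases m)
    case 0
    have "{S. S \<subseteq> insert x A \<and> card S = 0} = {{}}" 
      using insert.hyps by (auto dest: finite_subset[OF _ finite.insertI])
    then show ?thesis using 0 by simp
  next
    case (Suc k)
    define N where "N = card A"
    have cN: "card (insert x A) = Suc N" using insert.hyps N_def by simp
    define \<mu> where "\<mu> = (\<Sum>x\<in>A. a x) / N"
    have \<mu>0: "\<mu> \<ge> 0" unfolding \<mu>_def using insert.prems by (intro divide_nonneg_nonneg sum_nonneg) auto
    have sumA: "(\<Sum>x\<in>A. a x) = N * \<mu>"
      using insert.hyps by (cases "N = 0") (auto simp: \<mu>_def N_def)
    have ax: "a x \<ge> 0" using insert.prems by simp
    have IH: "(\<Sum>S | S \<subseteq> A \<and> card S = j. \<Prod>x\<in>S. a x) \<le> (N choose j) * \<mu> ^ j" for j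
      using insert.IH[of j] insert.prems unfolding \<mu>_def N_def by simp
    have split: "{S. S \<subseteq> insert x A \<and> card S = Suc k} =
       {S. S \<subseteq> A \<and> card S = Suc k} \<union> Set.insert x ` {S. S \<subseteq> A \<and> card S = k}" (is "?l = ?r1 \<union> ?r2")
    proof (intro equalityI subsetI)
      fix S assume S: "S \<in> ?l"
      then have fS: "finite S" using insert.hyps finite_subset by blast
      show "S \<in> ?r1 \<union> ?r2"
      proof (cases "x \<in> S")
        case True
        then have "S = Set.insert x (S - {x})" "S - {x} \<subseteq> A" "card (S - {x}) = k" using S fS by auto
        then show ?thesis by blast
      next
        case False then show ?thesis using S by auto
      qed
    next
      fix S assume "S \<in> ?r1 \<union> ?r2"
      moreover have "card (Set.insert x T) = Suc (card T)" if "T \<subseteq> A" for T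
        using that insert.hyps by (metis card_insert_disjoint finite_subset subsetD)
      ultimately show "S \<in> ?l" by auto
    qed
    have inj: "inj_on (Set.insert x) {S. S \<subseteq> A \<and> card S = k}"
      using insert.hyps(2) by (intro inj_onI) (metis (mono_tags, lifting) insert_ident mem_Collect_eq subsetD)
    have "(\<Sum>S | S \<subseteq> insert x A \<and> card S = m. \<Prod>x\<in>S. a x) =
        (\<Sum>S | S \<subseteq> A \<and> card S = Suc k. \<Prod>x\<in>S. a x) + (\<Sum>S\<in>?r2. \<Prod>x\<in>S. a x)"
      unfolding Suc split using insert.hyps by (intro sum.union_disjoint) auto
    also have "(\<Sum>S\<in>?r2. \<Prod>x\<in>S. a x) = (\<Sum>S | S \<subseteq> A \<and> card S = k. a x * (\<Prod>x\<in>S. a x))"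
      unfolding sum.reindex[OF inj] o_def
    proof (rule sum.cong)
      fix S assume "S \<in> {S. S \<subseteq> A \<and> card S = k}"
      then have "finite S" "x \<notin> S" using insert.hyps finite_subset by auto
      then show "prod a (Set.insert x S) = a x * prod a S" by simp
    qed simp
    also have "\<dots> = a x * (\<Sum>S | S \<subseteq> A \<and> card S = k. \<Prod>x\<in>S. a x)" by (simp add: sum_distrib_left)
    also have "(\<Sum>S | S \<subseteq> A \<and> card S = Suc k. \<Prod>x\<in>S. a x) + \<dots> \<le>
       (N choose Suc k) * \<mu> ^ Suc k + a x * ((N choose k) * \<mu> ^ k)"
      using IH[of "Suc k"] IH[of k] ax by (intro add_mono mult_left_mono)
    also have "\<dots> \<le> (Suc N choose Suc k) * ((N * \<mu> + a x) / Suc N) ^ Suc k"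
    proof (cases "\<mu> = 0")
      case True
      show ?thesis
      proof (cases k)
        case 0
        then show ?thesis using True ax by (simp add: field_simps)
      next
        case (Suc j)
        then show ?thesis using True ax by simp
      qed
    next
      case False
      then have \<mu>: "\<mu> > 0" using \<mu>0 by simp
      define t where "t = a x / \<mu>"
      have t: "a x = t * \<mu>" "t \<ge> 0" using \<mu> ax by (simp_all add: t_def)
      have e1: "real (Suc N) * (N choose k) = Suc k * (Suc N choose Suc k)"
        using Suc_times_binomial_eq[of N k] by (metis mult.commute of_nat_mult)
      have e2: "real (Suc N choose Suc k) = (N choose Suc k) + (N choose k)" by simp
      have "(N choose Suc k) * \<mu> ^ Suc k + a x * ((N choose k) * \<mu> ^ k) = 
         \<mu> ^ Suc k * ((Suc N choose Suc k) + (t - 1) * (N choose k))"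
        unfolding e2 t by (simp add: algebra_simps)
      also have "\<dots> = \<mu> ^ Suc k * (Suc N choose Suc k) * (1 + Suc k * ((t - 1) / Suc N))"
      proof -
        define X where "X = real (Suc N choose Suc k)"
        have "real (N choose k) = Suc k * X / Suc N"
          using e1 unfolding X_def
          by (simp add: nonzero_eq_divide_eq algebra_simps del: binomial_Suc_Suc)
        then show ?thesis unfolding X_def[symmetric] by (simp add: algebra_simps del: of_nat_Suc)
      qed
      also have "\<dots> \<le> \<mu> ^ Suc k * (Suc N choose Suc k) * (1 + (t - 1) / Suc N) ^ Suc k"
        using \<mu> t by (intro mult_left_mono Bernoulli_inequality) (auto simp: field_simps)
      also have "\<dots> = (Suc N choose Suc k) * (\<mu> * (1 + (t - 1) / Suc N)) ^ Suc k"
        unfolding power_mult_distrib by simp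
      also have "\<mu> * (1 + (t - 1) / Suc N) = (N * \<mu> + a x) / Suc N"
        unfolding t by (simp add: field_simps)
      finally show ?thesis .
    qed
    finally show ?thesis unfolding Suc cN using insert.hyps sumA by (simp add: add.commute)
  qed
qed

text \<open>Markov's inequality for the product of the weights \<open>1 + w e\<close>. By
  \<open>maclaurin_subsets\<close> its mean is at most the \<open>m\<close>-th power of the average
  weight, and \<open>1 + x \<le> exp x\<close> gives the exponential. The tail bounds that follow
  are choices of \<open>w\<close>.\<close>

lemma uniform_graph_prob_le:
  assumes m: "m \<le> n choose 2" and c: "c > 0"
    and w: "\<And>e. e \<in> all_edges n \<Longrightarrow> w e \<ge> (-1 :: real)"
    and Q: "\<And>S. S \<subseteq> all_edges n \<Longrightarrow> card S = m \<Longrightarrow> Q S \<Longrightarrow> c \<le> (\<Prod>e\<in>S. 1 + w e)"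
  shows "gprob n m {S. Q S} \<le> exp (m / (n choose 2) * (\<Sum>e\<in>all_edges n. w e)) / c"
proof -
  let ?N = "n choose 2"
  let ?A = "{S. S \<subseteq> all_edges n \<and> card S = m}"
  have ne: "?A \<noteq> {}" using m by (intro subsets_of_card_nonempty) (auto simp: card_all_edges)
  have fin: "finite ?A" by simp
  have cA: "card ?A = ?N choose m" by (simp add: n_subsets card_all_edges)
  have Cpos: "real (?N choose m) > 0" using m by simp
  have nn: "0 \<le> (\<Prod>e\<in>S. 1 + w e)" if "S \<in> ?A" for S
    using that w by (intro prod_nonneg) force
  have "c * card (?A \<inter> {S. Q S}) = (\<Sum>S\<in>?A \<inter> {S. Q S}. c)" by simp
  also have "\<dots> \<le> (\<Sum>S\<in>?A \<inter> {S. Q S}. \<Prod>e\<in>S. 1 + w e)" using Q by (intro sum_mono) auto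
  also have "\<dots> \<le> (\<Sum>S\<in>?A. \<Prod>e\<in>S. 1 + w e)" using nn fin by (intro sum_mono2) auto
  also have "\<dots> \<le> (card (all_edges n) choose m) * ((\<Sum>e\<in>all_edges n. 1 + w e) / card (all_edges n)) ^ m"
    using w by (intro maclaurin_subsets) (auto simp: le_diff_eq add_nonneg_nonneg dest: w)
  also have "\<dots> \<le> (?N choose m) * exp (m / ?N * (\<Sum>e\<in>all_edges n. w e))"
  proof -
    have nnz: "(\<Sum>e\<in>all_edges n. 1 + w e) \<ge> 0" using w by (intro sum_nonneg) force
    have "((\<Sum>e\<in>all_edges n. 1 + w e) / ?N) ^ m \<le> exp ((\<Sum>e\<in>all_edges n. w e) / ?N) ^ m"
    proof (cases "?N = 0")
      case True
      then have "m = 0" using m by linarith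
      then show ?thesis by simp
    next
      case False
      then have "(\<Sum>e\<in>all_edges n. 1 + w e) / ?N = 1 + (\<Sum>e\<in>all_edges n. w e) / ?N"
        by (simp add: sum.distrib card_all_edges field_simps)
      also have "\<dots> \<le> exp ((\<Sum>e\<in>all_edges n. w e) / ?N)" by (rule exp_ge_add_one_self)
      finally show ?thesis using nnz by (intro power_mono) auto
    qed
    also have "\<dots> = exp (m / ?N * (\<Sum>e\<in>all_edges n. w e))"
      by (simp add: exp_of_nat_mult[symmetric])
    finally show ?thesis using Cpos by (simp add: card_all_edges)
  qed
  finally have "c * card (?A \<inter> {S. Q S}) \<le> (?N choose m) * exp (m / ?N * (\<Sum>e\<in>all_edges n. w e))" .
  then have "real (card (?A \<inter> {S. Q S})) / (?N choose m) \<le> exp (m / ?N * (\<Sum>e\<in>all_edges n. w e)) / c"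
    using c Cpos by (simp add: field_simps)
  then show ?thesis unfolding uniform_graph_def measure_pmf_of_set[OF ne fin] cA .
qed

text \<open>The weights are \<open>exp (l * g e)\<close>. Since
  \<open>exp x \<le> 1 + x + x\<^sup>2\<close> for all \<open>x \<le> 1\<close>, however negative,
  \<open>l * g e\<close> has to be bounded only from above.\<close>

lemma uniform_graph_bernstein:
  fixes g :: "nat set \<Rightarrow> real"
  assumes m: "m \<le> n choose 2" and l: "0 \<le> l" "\<And>e. e \<in> all_edges n \<Longrightarrow> l * g e \<le> 1"
  shows "gprob n m {S. t \<le> (\<Sum>e\<in>S. g e)}
    \<le> exp (m / (n choose 2) * (l * (\<Sum>e\<in>all_edges n. g e) + l\<^sup>2 * (\<Sum>e\<in>all_edges n. (g e)\<^sup>2)) - l * t)"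
proof -
  have "gprob n m {S. t \<le> (\<Sum>e\<in>S. g e)}
    \<le> exp (m / (n choose 2) * (\<Sum>e\<in>all_edges n. exp (l * g e) - 1)) / exp (l * t)"
  proof (rule uniform_graph_prob_le[OF m])
    fix S assume S: "S \<subseteq> all_edges n" "t \<le> (\<Sum>e\<in>S. g e)"
    have "exp (l * t) \<le> exp (\<Sum>e\<in>S. l * g e)"
      using l S by (simp add: sum_distrib_left[symmetric] mult_left_mono)
    also have "\<dots> = (\<Prod>e\<in>S. 1 + (exp (l * g e) - 1))"
      using S finite_subset[OF _ finite_all_edges] by (simp add: exp_sum)
    finally show "exp (l * t) \<le> (\<Prod>e\<in>S. 1 + (exp (l * g e) - 1))" .
  qed auto
  also have "\<dots> \<le> exp (m / (n choose 2) * (\<Sum>e\<in>all_edges n. l * g e + (l * g e)\<^sup>2)) / exp (l * t)"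
  proof -
    have "exp x - 1 \<le> x + x\<^sup>2" if "x \<le> 1" for x :: real
    proof (cases "x \<ge> 0")
      case True then show ?thesis using exp_bound[of x] that by simp
    next
      case False
      have "exp x = 1 / exp (-x)" by (simp add: exp_minus field_simps)
      also have "\<dots> \<le> 1 / (1 - x)" using False exp_ge_add_one_self[of "-x"]
        by (intro divide_left_mono) auto
      also have "\<dots> \<le> 1 + x + x\<^sup>2"
      proof -
        have "1 \<le> (1 + x + x\<^sup>2) * (1 - x)" using False
          by (simp add: power2_eq_square algebra_simps mult_nonneg_nonpos2 mult_nonneg_nonpos)
        then show ?thesis using False by (simp add: field_simps)
      qed
      finally show ?thesis by simp
    qed
    then have "(\<Sum>e\<in>all_edges n. exp (l * g e) - 1) \<le> (\<Sum>e\<in>all_edges n. l * g e + (l * g e)\<^sup>2)"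
      using l by (intro sum_mono) auto
    then show ?thesis by (simp add: mult_left_mono divide_right_mono)
  qed
  finally show ?thesis
    by (simp add: exp_diff sum.distrib sum_distrib_left power_mult_distrib)
qed

section \<open>Tail bounds for the number of edges in a fixed set\<close>

lemma prod_if_mem:
  assumes "finite S"
  shows "(\<Prod>e\<in>S. if e \<in> F then c else (1::real)) = c ^ card (S \<inter> F)"
  using assms by (simp add: prod.If_cases Int_def)

text \<open>The weight is \<open>1 / p\<close> on the prescribed edges \<open>P\<close> and
  \<open>exp (- k)\<close> on \<open>F\<close>. A weight \<open>1 / p\<close> adds
  \<open>p * (1 / p - 1) \<le> 1\<close> to the exponent, which is why each prescribed edge costs
  \<open>exp 1 * p\<close> instead of \<open>p\<close>.\<close>

lemma uniform_graph_edges_few: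
  assumes m: "m \<le> n choose 2" "0 < m" and P: "P \<subseteq> all_edges n" and F: "F \<subseteq> all_edges n"
    and PF: "P \<inter> F = {}" and k: "k \<ge> 0"
  shows "gprob n m {S. P \<subseteq> S \<and> real (card (S \<inter> F)) \<le> q}
    \<le> (exp 1 * (m / (n choose 2))) ^ card P * exp (k * q - (1 - exp (-k)) * (m / (n choose 2)) * card F)"
proof -
  define p where "p = m / (n choose 2)"
  have "0 < real m" "real m \<le> real (n choose 2)" using m by linarith+
  then have p: "0 < p" "p \<le> 1" unfolding p_def by (simp_all add: divide_le_eq_1 del: of_nat_0_less_iff)
    
  define w where "w e = (if e \<in> P then 1/p - 1 else if e \<in> F then exp (-k) - 1 else 0)" for e
  have pr: "(\<Prod>e\<in>S. 1 + w e) = (1/p) ^ card (S \<inter> P) * exp (-k) ^ card (S \<inter> F)" if "finite S" for S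
  proof -
    have "(\<Prod>e\<in>S. 1 + w e) = (\<Prod>e\<in>S. (if e \<in> P then 1/p else 1) * (if e \<in> F then exp (-k) else 1))"
      using PF by (intro prod.cong) (auto simp: w_def)
    then show ?thesis using that by (simp add: prod.distrib prod_if_mem)
  qed
  have fP: "finite P" "finite F" using P F finite_subset[OF _ finite_all_edges] by auto
  have sw: "(\<Sum>e\<in>all_edges n. w e) = (1/p - 1) * card P + (exp (-k) - 1) * card F"
  proof -
    have "(\<Sum>e\<in>all_edges n. w e) = (\<Sum>e\<in>all_edges n. (if e \<in> P then 1/p - 1 else 0) + (if e \<in> F then exp (-k) - 1 else 0))"
      using PF by (intro sum.cong) (auto simp: w_def)
    moreover have "all_edges n \<inter> P = P" "all_edges n \<inter> F = F" using P F by auto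
    ultimately show ?thesis by (simp add: sum.distrib sum.If_cases Int_def[symmetric] mult.commute)
  qed
  have "gprob n m {S. P \<subseteq> S \<and> real (card (S \<inter> F)) \<le> q}
    \<le> exp (m / (n choose 2) * (\<Sum>e\<in>all_edges n. w e)) / ((1/p) ^ card P * exp (- k * q))"
  proof (rule uniform_graph_prob_le[OF m(1)])
    show "w e \<ge> -1" for e using p unfolding w_def by (auto simp: field_simps)
    fix S assume S: "S \<subseteq> all_edges n" and Q: "P \<subseteq> S \<and> real (card (S \<inter> F)) \<le> q"
    have fS: "finite S" using S finite_subset[OF _ finite_all_edges] by auto
    have "S \<inter> P = P" using Q by auto
    moreover have "exp (- k * q) \<le> exp (-k) ^ card (S \<inter> F)"
      using Q k by (simp add: exp_of_nat_mult[symmetric] mult_left_mono mult.commute)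
    ultimately show "(1/p) ^ card P * exp (- k * q) \<le> (\<Prod>e\<in>S. 1 + w e)"
      unfolding pr[OF fS] using p by (simp add: mult_left_mono)
  qed (use p in auto)
  also have "\<dots> = p ^ card P * exp (p * ((1/p - 1) * card P + (exp (-k) - 1) * card F) + k * q)"
  proof -
    have "exp X / ((1/p) ^ card P * exp (- k * q)) = p ^ card P * (exp X * exp (k * q))" for X
      using p by (simp add: exp_minus power_one_over field_simps)
    then show ?thesis unfolding sw p_def[symmetric] exp_add .
  qed
  also have "\<dots> \<le> p ^ card P * exp (card P + (k * q - (1 - exp (-k)) * p * card F))"
  proof -
    have "p * ((1/p - 1) * card P) \<le> card P" using p by (simp add: algebra_simps)
    then show ?thesis using p by (intro mult_left_mono) (auto simp: algebra_simps)
  qed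
  also have "\<dots> = (exp 1 * p) ^ card P * exp (k * q - (1 - exp (-k)) * p * card F)"
    by (simp add: exp_add power_mult_distrib exp_of_nat_mult[symmetric])
  finally show ?thesis unfolding p_def .
qed

text \<open>The weight is \<open>r\<close> on \<open>F\<close>, and \<open>r - 1\<close> is rounded
  up to \<open>r\<close> in the exponent. Later \<open>r\<close> is \<open>exp 1\<close> for degrees
  and \<open>2 ^ (k + 2)\<close> for the discrepancy.\<close>

lemma uniform_graph_many:
  assumes m: "m \<le> n choose 2" and F: "F \<subseteq> all_edges n" and r: "r \<ge> 1"
  shows "gprob n m {S. q \<le> real (card (S \<inter> F))}
    \<le> exp (r * (m / (n choose 2)) * card F - ln r * q)"
proof -
  define p where "p = m / (n choose 2)"
  define w where "w e = (if e \<in> F then r - 1 else 0)" for e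
  have "gprob n m {S. q \<le> real (card (S \<inter> F))}
    \<le> exp (m / (n choose 2) * (\<Sum>e\<in>all_edges n. w e)) / exp (ln r * q)"
  proof (rule uniform_graph_prob_le[OF m])
    show "w e \<ge> -1" for e using r unfolding w_def by auto
    fix S assume S: "S \<subseteq> all_edges n" and Q: "q \<le> real (card (S \<inter> F))"
    have fS: "finite S" using S finite_subset[OF _ finite_all_edges] by auto
    have "(\<Prod>e\<in>S. 1 + w e) = (\<Prod>e\<in>S. if e \<in> F then r else 1)" by (intro prod.cong) (auto simp: w_def)
    also have "\<dots> = exp (ln r * card (S \<inter> F))"
      unfolding prod_if_mem[OF fS] using r by (simp add: exp_of_nat2_mult)
    also have "\<dots> \<ge> exp (ln r * q)" using Q r by (simp add: mult_left_mono)
    finally show "exp (ln r * q) \<le> (\<Prod>e\<in>S. 1 + w e)" .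
  qed auto
  also have "\<dots> = exp (p * ((r - 1) * card F) - ln r * q)"
  proof -
    have "all_edges n \<inter> F = F" using F by auto
    then have "(\<Sum>e\<in>all_edges n. w e) = (r - 1) * card F"
      unfolding w_def by (simp add: sum.If_cases Int_def[symmetric] mult.commute)
    then show ?thesis by (simp add: exp_diff p_def)
  qed
  also have "\<dots> \<le> exp (r * p * card F - ln r * q)"
    using r by (auto simp: p_def mult_right_mono intro!: mult_nonneg_nonneg divide_nonneg_nonneg divide_right_mono)
      (simp add: algebra_simps)
  finally show ?thesis unfolding p_def .
qed

lemma uniform_graph_none:
  assumes m: "m \<le> n choose 2" and F: "F \<subseteq> all_edges n"
  shows "gprob n m {S. S \<inter> F = {}} \<le> exp (- (m / (n choose 2)) * card F)"
proof -
  define w :: "nat set \<Rightarrow> real" where "w e = (if e \<in> F then -1 else 0)" for e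
  have "gprob n m {S. S \<inter> F = {}}
    \<le> exp (m / (n choose 2) * (\<Sum>e\<in>all_edges n. w e)) / 1"
  proof (rule uniform_graph_prob_le[OF m])
    show "w e \<ge> -1" for e unfolding w_def by auto
    fix S assume "S \<inter> F = {}"
    then have "(\<Prod>e\<in>S. 1 + w e) = (\<Prod>e\<in>S. 1)" by (intro prod.cong) (auto simp: w_def)
    then show "1 \<le> (\<Prod>e\<in>S. 1 + w e)" by simp
  qed auto
  moreover have "all_edges n \<inter> F = F" using F by auto
  then have "(\<Sum>e\<in>all_edges n. w e) = - real (card F)"
    unfolding w_def by (simp add: sum.If_cases Int_def[symmetric])
  ultimately show ?thesis by simp
qed

section \<open>From the centred adjacency form to the Laplacian\<close>

text \<open>The bilinear form of \<open>A - p * (J - I)\<close> with \<open>J\<close> the all-ones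
  matrix. The diagonal is spared because graphs have no loops.\<close>

definition centered_form :: "nat \<Rightarrow> nat set set \<Rightarrow> real \<Rightarrow> (nat \<Rightarrow> real) \<Rightarrow> (nat \<Rightarrow> real) \<Rightarrow> real" where
  "centered_form n E p x y = edge_form n E x y -
     p * ((\<Sum>i<n. x i) * (\<Sum>i<n. y i) - (\<Sum>i<n. x i * y i))"

lemma edge_form_add_left: "edge_form n E (\<lambda>i. x i + x' i) y = edge_form n E x y + edge_form n E x' y"
  unfolding edge_form_def sum.distrib[symmetric] by (intro sum.cong) (auto simp: algebra_simps)

lemma edge_form_add_right: "edge_form n E x (\<lambda>i. y i + y' i) = edge_form n E x y + edge_form n E x y'"
  unfolding edge_form_def sum.distrib[symmetric] by (intro sum.cong) (auto simp: algebra_simps)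

lemma edge_form_commute: "edge_form n E x y = edge_form n E y x"
proof -
  have "(if {i, j} \<in> E then x i * y j else 0) = (if {j, i} \<in> E then y j * x i else 0)" for i j
    by (simp add: insert_commute mult.commute)
  then show ?thesis unfolding edge_form_def by (subst sum.swap) simp
qed

lemma edge_form_one_right:
  assumes "E \<subseteq> all_edges n"
  shows "edge_form n E x (\<lambda>_. 1) = (\<Sum>i<n. real (degree_of E i) * x i)"
  unfolding edge_form_def degree_of_eq_sum[OF assms] sum_distrib_right
  by (intro sum.cong) auto

lemma edge_form_abs_le: "\<bar>edge_form n E x y\<bar> \<le> edge_form n E (\<lambda>i. \<bar>x i\<bar>) (\<lambda>i. \<bar>y i\<bar>)"
  unfolding edge_form_def
  by (rule order.trans[OF sum_abs], intro sum_mono, rule order.trans[OF sum_abs], intro sum_mono)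
    (auto simp: abs_mult)

text \<open>Split \<open>y\<close> into its part \<open>yS\<close> on the vertices of small degree
  and the rest \<open>yL\<close>. The form vanishes on \<open>yS\<close> because these vertices are
  independent. The mixed term is handled by
  \<open>a * b \<le> a\<^sup>2 / r + r * b\<^sup>2\<close>, where each vertex sees at most three
  small neighbours. On \<open>yL\<close> the centred form is of the right order, since
  \<open>yL\<close> has squared norm at most \<open>100 / d * Q\<close>. What remains is the
  rank-one term \<open>p * (\<Sum>i<n. yL i)\<^sup>2\<close>, which is bounded by testing the
  centred form against the constant vector and using the side condition on \<open>y\<close>. The
  constant 702 is \<open>2 * 301 + 100\<close>.\<close>

lemma laplacian_form_bound:
  fixes d p K :: real
  assumes E: "E \<subseteq> all_edges n" and n: "n \<ge> 2" and d: "d \<ge> 1" and p: "0 < p" "p \<le> 1"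
    and dp: "4 / 5 * d \<le> p * (n - 1)" and K: "K \<ge> 0"
    and M: "\<And>x y. \<bar>centered_form n E p x y\<bar> \<le> K * sqrt d * L2_set x {..<n} * L2_set y {..<n}"
    and indep: "\<And>u v. {u, v} \<in> E \<Longrightarrow> real (degree_of E u) < d / 100 \<Longrightarrow> real (degree_of E v) \<ge> d / 100"
    and few: "\<And>u. u < n \<Longrightarrow> card {v. v < n \<and> {u, v} \<in> E \<and> real (degree_of E v) < d / 100} \<le> 3"
    and y: "(\<Sum>v<n. real (degree_of E v) * y v) = 0"
  shows "\<bar>edge_form n E y y\<bar> \<le> (303 * K\<^sup>2 + 100 * K + 702) / sqrt d * (\<Sum>v<n. real (degree_of E v) * (y v)\<^sup>2)"
proof -
  let ?deg = "\<lambda>v. real (degree_of E v)"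
  define S where "S = {v. v < n \<and> ?deg v < d / 100}"
  define Q where "Q = (\<Sum>v<n. ?deg v * (y v)\<^sup>2)"
  define yS where "yS v = (if v \<in> S then y v else 0)" for v
  define yL where "yL v = (if v \<in> S then 0 else y v)" for v
  define r where "r = sqrt d"
  have r: "r \<ge> 1" "r * r = d" using d by (simp_all add: r_def)
  have Q0: "Q \<ge> 0" unfolding Q_def by (intro sum_nonneg) auto
  have ySL: "y = (\<lambda>v. yS v + yL v)" by (auto simp: yS_def yL_def)
  have form: "edge_form n E y y = edge_form n E yS yS + 2 * edge_form n E yS yL + edge_form n E yL yL"
    unfolding ySL edge_form_add_left edge_form_add_right using edge_form_commute[of n E yL yS] by simp
  have SS: "edge_form n E yS yS = 0"
    unfolding edge_form_def
  proof (intro sum.neutral ballI)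
    fix i j
    show "(if {i, j} \<in> E then yS i * yS j else 0) = 0"
      using indep[of i j] by (auto simp: yS_def S_def)
  qed
  have L2: "(\<Sum>v<n. (yL v)\<^sup>2) \<le> 100 / d * Q"
    unfolding Q_def sum_distrib_left
  proof (rule sum_mono)
    fix v assume "v \<in> {..<n}"
    show "(yL v)\<^sup>2 \<le> 100 / d * (?deg v * (y v)\<^sup>2)"
    proof (cases "v \<in> S")
      case False
      then have "1 \<le> 100 / d * ?deg v" using \<open>v \<in> {..<n}\<close> d by (simp add: S_def field_simps)
      then have "1 * (y v)\<^sup>2 \<le> (100 / d * ?deg v) * (y v)\<^sup>2" by (rule mult_right_mono) simp
      then show ?thesis using False by (simp add: yL_def mult.assoc)
    qed (use d in \<open>simp add: yL_def\<close>)
  qed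
  have SL: "\<bar>edge_form n E yS yL\<bar> \<le> 301 / r * Q"
  proof -
    have "\<bar>edge_form n E yS yL\<bar> \<le> edge_form n E (\<lambda>i. \<bar>yS i\<bar>) (\<lambda>i. \<bar>yL i\<bar>)" by (rule edge_form_abs_le)
    also have "\<dots> \<le> (\<Sum>i<n. \<Sum>j<n. (if {i, j} \<in> E then (y i)\<^sup>2 / r else 0) +
        (if {i, j} \<in> E \<and> i \<in> S then r * (yL j)\<^sup>2 else 0))"
      unfolding edge_form_def
    proof (intro sum_mono)
      fix i j
      have "\<bar>yS i\<bar> * \<bar>yL j\<bar> \<le> (y i)\<^sup>2 / r + (if i \<in> S then r * (yL j)\<^sup>2 else 0)"
      proof (cases "i \<in> S")
        case True
        have "(a - r * b)\<^sup>2 = a\<^sup>2 + r * (r * b\<^sup>2) - 2 * (r * (a * b))" for a b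
          by (simp add: power2_eq_square algebra_simps)
        from this[of "\<bar>y i\<bar>" "\<bar>yL j\<bar>"]
        have "2 * (r * (\<bar>y i\<bar> * \<bar>yL j\<bar>)) \<le> (y i)\<^sup>2 + r * (r * (yL j)\<^sup>2)"
          using zero_le_power2[of "\<bar>y i\<bar> - r * \<bar>yL j\<bar>"] by simp
        moreover have "0 \<le> r * (\<bar>y i\<bar> * \<bar>yL j\<bar>)" using r by simp
        ultimately have "r * (\<bar>y i\<bar> * \<bar>yL j\<bar>) \<le> (y i)\<^sup>2 + r * (r * (yL j)\<^sup>2)" by linarith
        then show ?thesis using True r by (simp add: yS_def field_simps)
      qed (use r in \<open>simp add: yS_def\<close>)
      then show "(if {i, j} \<in> E then \<bar>yS i\<bar> * \<bar>yL j\<bar> else 0) \<le> (if {i, j} \<in> E then (y i)\<^sup>2 / r else 0) +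
        (if {i, j} \<in> E \<and> i \<in> S then r * (yL j)\<^sup>2 else 0)" by auto
    qed
    also have "\<dots> = (\<Sum>i<n. \<Sum>j<n. (if {i, j} \<in> E then (y i)\<^sup>2 / r else 0)) +
        (\<Sum>i<n. \<Sum>j<n. (if {i, j} \<in> E \<and> i \<in> S then r * (yL j)\<^sup>2 else 0))"
      by (simp add: sum.distrib)
    also have "(\<Sum>i<n. \<Sum>j<n. (if {i, j} \<in> E then (y i)\<^sup>2 / r else 0)) = Q / r"
      unfolding Q_def sum_divide_distrib degree_of_eq_sum[OF E] sum_distrib_right
      by (intro sum.cong) auto
    also have "(\<Sum>i<n. \<Sum>j<n. (if {i, j} \<in> E \<and> i \<in> S then r * (yL j)\<^sup>2 else 0)) \<le>
        (\<Sum>j<n. 3 * (r * (yL j)\<^sup>2))"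
    proof (subst sum.swap, intro sum_mono)
      fix j assume j: "j \<in> {..<n}"
      have "(\<Sum>i<n. (if {i, j} \<in> E \<and> i \<in> S then r * (yL j)\<^sup>2 else 0)) =
         real (card {i. i < n \<and> {j, i} \<in> E \<and> ?deg i < d / 100}) * (r * (yL j)\<^sup>2)"
        by (simp add: sum.If_cases S_def) (intro disjI2 arg_cong[where f=card], auto simp: insert_commute)
      also have "\<dots> \<le> 3 * (r * (yL j)\<^sup>2)"
        using few[of j] j r by (intro mult_right_mono) auto
      finally show "(\<Sum>i<n. (if {i, j} \<in> E \<and> i \<in> S then r * (yL j)\<^sup>2 else 0)) \<le> 3 * (r * (yL j)\<^sup>2)" .
    qed
    also have "(\<Sum>j<n. 3 * (r * (yL j)\<^sup>2)) = 3 * r * (\<Sum>j<n. (yL j)\<^sup>2)"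
      by (simp add: sum_distrib_left mult.assoc)
    also have "\<dots> \<le> 3 * r * (100 / d * Q)" using L2 r by (intro mult_left_mono) auto
    also have "\<dots> = 300 / r * Q" using r by (simp add: r(2)[symmetric])
    finally have "\<bar>edge_form n E yS yL\<bar> \<le> Q / r + 300 / r * Q" by simp
    then show ?thesis by (simp add: field_simps)
  qed
  have LL2: "L2_set yL {..<n} \<le> 10 / r * sqrt Q"
  proof -
    have "L2_set yL {..<n} \<le> sqrt (100 / d * Q)" unfolding L2_set_def using L2 by simp
    also have "\<dots> = 10 / r * sqrt Q" using r d
      by (simp add: real_sqrt_mult real_sqrt_divide r_def)
    finally show ?thesis .
  qed
  have one: "L2_set (\<lambda>_. 1) {..<n} = sqrt n" by (simp add: L2_set_def)
  define D where "D = p * (real n - 1)"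
  have nD: "real (n - 1) = real n - 1" using n by (simp add: of_nat_diff)
  have D: "4 / 5 * d \<le> D" "D > 0" using dp d unfolding D_def nD by auto
  have c1: "centered_form n E p x (\<lambda>_. 1) = (\<Sum>i<n. ?deg i * x i) - D * (\<Sum>i<n. x i)" for x
    unfolding centered_form_def edge_form_one_right[OF E] D_def by (simp add: algebra_simps)
  \<comment> \<open>Each small vertex falls short of the mean degree \<open>D\<close> by at least
    \<open>d / 2\<close>. Testing the centred form on the indicator of \<open>S\<close> and the
    constant vector compares \<open>d / 2 * card S\<close> with \<open>sqrt (card S)\<close>, so
    \<open>S\<close> must be small.\<close>
  have cS: "real (card S) * d \<le> 4 * K\<^sup>2 * n"
  proof -
    let ?x = "\<lambda>v. if v \<in> S then 1 else (0::real)"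
    have fS: "finite S" unfolding S_def by simp
    have SI: "{..<n} \<inter> S = S" unfolding S_def by auto
    have sx: "(\<Sum>i<n. ?x i) = card S" by (simp add: sum.If_cases SI)
    have x2: "L2_set ?x {..<n} = sqrt (card S)"
    proof -
      have "(\<Sum>i<n. (?x i)\<^sup>2) = (\<Sum>i<n. ?x i)" by (intro sum.cong) auto
      then show ?thesis unfolding L2_set_def sx by simp
    qed
    have "(\<Sum>i<n. ?deg i * ?x i) \<le> (\<Sum>i<n. d / 100 * ?x i)"
      by (intro sum_mono) (auto simp: S_def)
    also have "\<dots> = d / 100 * card S" unfolding sum_distrib_left[symmetric] sx ..
    finally have "centered_form n E p ?x (\<lambda>_. 1) \<le> d / 100 * card S - D * card S" unfolding c1 sx by simp
    also have "\<dots> \<le> d / 100 * card S - (4 / 5 * d) * card S" using D by (intro diff_left_mono mult_right_mono) auto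
    also have "\<dots> \<le> - (d / 2 * card S)" using d by (simp add: field_simps)
    finally have "d / 2 * card S \<le> \<bar>centered_form n E p ?x (\<lambda>_. 1)\<bar>" by linarith
    also have "\<dots> \<le> K * r * sqrt (card S) * sqrt n" using M[of ?x "\<lambda>_. 1"] unfolding x2 one r_def .
    finally have h: "d * card S \<le> 2 * K * r * sqrt (card S) * sqrt n" by simp
    have "(d * card S)\<^sup>2 \<le> (2 * K * r * sqrt (card S) * sqrt n)\<^sup>2"
      using h d by (intro power_mono) auto
    also have "\<dots> = 4 * K\<^sup>2 * (r * r) * (sqrt (card S))\<^sup>2 * (sqrt n)\<^sup>2"
      by (simp add: power_mult_distrib power2_eq_square[of r])
    also have "\<dots> = 4 * K\<^sup>2 * d * card S * n" unfolding r(2) by simp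
    finally have h2: "(d * card S) * (d * card S) \<le> (d * card S) * (4 * K\<^sup>2 * n)"
      by (simp add: power2_eq_square mult_ac)
    show ?thesis
    proof (cases "card S = 0")
      case False
      then have "d * card S > 0" using d by simp
      then have "d * card S \<le> 4 * K\<^sup>2 * n" using mult_left_le_imp_le[OF h2] by blast
      then show ?thesis by (simp only: mult.commute)
    qed simp
  qed
  \<comment> \<open>Cauchy-Schwarz, with \<open>deg\<close> divided equally between both factors;
    \<open>K / 5\<close> is the square root of \<open>4 * K\<^sup>2 / 100\<close>, from
    \<open>cS\<close> and \<open>deg < d / 100\<close>.\<close>
  have SdegS: "\<bar>\<Sum>i<n. ?deg i * yS i\<bar> \<le> K / 5 * sqrt n * sqrt Q"
  proof -
    have "\<bar>\<Sum>i<n. ?deg i * yS i\<bar> \<le> (\<Sum>i<n. \<bar>(if i \<in> S then sqrt (?deg i) else 0)\<bar> * \<bar>sqrt (?deg i) * y i\<bar>)"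
      by (rule order.trans[OF sum_abs], intro sum_mono) (auto simp: yS_def abs_mult mult.assoc[symmetric])
    also have "\<dots> \<le> L2_set (\<lambda>i. if i \<in> S then sqrt (?deg i) else 0) {..<n} * L2_set (\<lambda>i. sqrt (?deg i) * y i) {..<n}"
      by (rule L2_set_mult_ineq)
    also have "L2_set (\<lambda>i. sqrt (?deg i) * y i) {..<n} = sqrt Q"
      by (simp add: L2_set_def Q_def power_mult_distrib)
    also have "L2_set (\<lambda>i. if i \<in> S then sqrt (?deg i) else 0) {..<n} \<le> K / 5 * sqrt n"
    proof -
      have "(\<Sum>i<n. (if i \<in> S then sqrt (?deg i) else 0)\<^sup>2) \<le> (\<Sum>i<n. if i \<in> S then d / 100 else 0)"
        by (intro sum_mono) (auto simp: S_def)
      also have "\<dots> = card S * d / 100"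
      proof -
        have "{..<n} \<inter> S = S" unfolding S_def by auto
        then show ?thesis by (simp add: sum.If_cases)
      qed
      also have "\<dots> \<le> (K / 5 * sqrt n)\<^sup>2" 
      proof -
        have "(K / 5 * sqrt n)\<^sup>2 = 4 * K\<^sup>2 * n / 100" by (simp add: power_mult_distrib power_divide)
        then show ?thesis using cS by linarith
      qed
      finally have "L2_set (\<lambda>i. if i \<in> S then sqrt (?deg i) else 0) {..<n} \<le> sqrt ((K / 5 * sqrt n)\<^sup>2)"
        unfolding L2_set_def by (rule real_sqrt_le_mono)
      then show ?thesis using K by simp
    qed
    finally show ?thesis using Q0 by (simp add: mult_right_mono)
  qed
  \<comment> \<open>The degree-weighted sums of \<open>yL\<close> and \<open>yS\<close> cancel, so
    the plain sum of \<open>yL\<close> is determined by that of \<open>yS\<close> and a value of the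
    centred form.\<close>
  have sumL: "D * \<bar>\<Sum>i<n. yL i\<bar> \<le> 11 * K * sqrt n * sqrt Q"
  proof -
    have "(\<Sum>i<n. ?deg i * yL i) = - (\<Sum>i<n. ?deg i * yS i)"
      using y unfolding ySL by (simp add: algebra_simps sum.distrib)
    then have "D * (\<Sum>i<n. yL i) = - (\<Sum>i<n. ?deg i * yS i) - centered_form n E p yL (\<lambda>_. 1)"
      unfolding c1 by simp
    then have "D * \<bar>\<Sum>i<n. yL i\<bar> \<le> \<bar>\<Sum>i<n. ?deg i * yS i\<bar> + \<bar>centered_form n E p yL (\<lambda>_. 1)\<bar>"
      using D(2) abs_mult[of D "\<Sum>i<n. yL i"] by simp
    also have "\<bar>centered_form n E p yL (\<lambda>_. 1)\<bar> \<le> K * r * L2_set yL {..<n} * sqrt n"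
      using M[of yL "\<lambda>_. 1"] unfolding one r_def .
    also have "\<dots> \<le> K * r * (10 / r * sqrt Q) * sqrt n"
      using LL2 K r by (intro mult_right_mono mult_left_mono) auto
    also have "\<dots> = 10 * K * sqrt n * sqrt Q" using r by simp
    finally have "D * \<bar>\<Sum>i<n. yL i\<bar> \<le> K / 5 * sqrt n * sqrt Q + 10 * K * sqrt n * sqrt Q"
      using SdegS by linarith
    moreover have "0 \<le> K * sqrt n * sqrt Q" using K Q0 by simp
    ultimately show ?thesis by (simp add: algebra_simps)
  qed
  have "r \<le> d" using r mult_mono[of 1 r r r] by simp
  then have dr: "1 / d \<le> 1 / r" using r by (intro divide_left_mono) auto
  have psum: "p * (\<Sum>i<n. yL i)\<^sup>2 \<le> 303 * K\<^sup>2 / r * Q"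
  proof -
    have "(D * \<bar>\<Sum>i<n. yL i\<bar>)\<^sup>2 \<le> (11 * K * sqrt n * sqrt Q)\<^sup>2"
      using sumL D by (intro power_mono) auto
    then have "D\<^sup>2 * (\<Sum>i<n. yL i)\<^sup>2 \<le> 121 * K\<^sup>2 * n * Q"
      using Q0 by (simp add: power_mult_distrib)
    \<comment> \<open>Passing from \<open>n\<close> to \<open>2 * (n - 1)\<close> lets the factor
      \<open>p\<close> produce a \<open>D\<close>, so that one power of \<open>D\<close>
      cancels.\<close>
    also have "\<dots> \<le> 121 * K\<^sup>2 * (2 * (real n - 1)) * Q"
      using n Q0 by (intro mult_right_mono mult_left_mono) auto
    finally have "p * (D\<^sup>2 * (\<Sum>i<n. yL i)\<^sup>2) \<le> p * (121 * K\<^sup>2 * (2 * (real n - 1)) * Q)"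
      using p by (intro mult_left_mono) auto
    also have "\<dots> = 242 * K\<^sup>2 * D * Q" by (simp add: D_def)
    finally have "D * (D * (p * (\<Sum>i<n. yL i)\<^sup>2)) \<le> D * (242 * K\<^sup>2 * Q)"
      by (simp add: power2_eq_square mult_ac)
    then have a: "D * (p * (\<Sum>i<n. yL i)\<^sup>2) \<le> 242 * K\<^sup>2 * Q" using D(2) by simp
    \<comment> \<open>From \<open>D \<ge> 4 / 5 * d\<close> one gets the factor
      \<open>242 * 5 / 4\<close>, rounded up to 303.\<close>
    have gen: "d * X \<le> 303 * W" if "4 / 5 * d * X \<le> D * X" "D * X \<le> 242 * W" "0 \<le> W" for X W
      using that by (simp add: mult.assoc)
    have "d * (p * (\<Sum>i<n. yL i)\<^sup>2) \<le> 303 * (K\<^sup>2 * Q)"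
    proof (rule gen)
      show "4 / 5 * d * (p * (\<Sum>i<n. yL i)\<^sup>2) \<le> D * (p * (\<Sum>i<n. yL i)\<^sup>2)"
        using D p by (intro mult_right_mono) auto
    qed (use a Q0 in \<open>simp_all add: mult.assoc\<close>)
    then have "p * (\<Sum>i<n. yL i)\<^sup>2 \<le> 1 / d * (303 * K\<^sup>2 * Q)" using d by (simp add: field_simps)
    also have "\<dots> \<le> 1 / r * (303 * K\<^sup>2 * Q)" using dr Q0 by (intro mult_right_mono) auto
    finally show ?thesis by simp
  qed
  have LL: "\<bar>edge_form n E yL yL\<bar> \<le> (100 * K + 303 * K\<^sup>2 + 100) / r * Q"
  proof -
    have "edge_form n E yL yL = centered_form n E p yL yL + p * (\<Sum>i<n. yL i)\<^sup>2 - p * (\<Sum>i<n. (yL i)\<^sup>2)"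
      unfolding centered_form_def by (simp add: algebra_simps power2_eq_square)
    then have "\<bar>edge_form n E yL yL\<bar> \<le> \<bar>centered_form n E p yL yL\<bar> + p * (\<Sum>i<n. yL i)\<^sup>2 + p * (\<Sum>i<n. (yL i)\<^sup>2)"
      using p by (simp add: abs_le_iff) (smt (verit) mult_nonneg_nonneg sum_nonneg zero_le_power2)
    also have "\<bar>centered_form n E p yL yL\<bar> \<le> 100 * K / r * Q"
    proof -
      have "\<bar>centered_form n E p yL yL\<bar> \<le> K * r * (L2_set yL {..<n} * L2_set yL {..<n})"
        using M[of yL yL] unfolding r_def by (simp add: mult.assoc)
      also have "L2_set yL {..<n} * L2_set yL {..<n} = (\<Sum>i<n. (yL i)\<^sup>2)"
        unfolding L2_set_def by (simp add: sum_nonneg)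
      also have "K * r * \<dots> \<le> K * r * (100 / d * Q)" using L2 K r by (intro mult_left_mono) auto
      also have "\<dots> = 100 * K / r * Q" by (simp add: r(2)[symmetric])
      finally show ?thesis .
    qed
    also have "p * (\<Sum>i<n. (yL i)\<^sup>2) \<le> 1 * (100 / d * Q)" using L2 p d Q0
      by (intro mult_mono) (auto simp: sum_nonneg)
    also have "\<dots> = 1 / d * (100 * Q)" by simp
    also have "\<dots> \<le> 1 / r * (100 * Q)" using dr Q0 by (intro mult_right_mono) auto
    finally show ?thesis using psum by (simp add: add_divide_distrib algebra_simps)
  qed
  have "\<bar>edge_form n E y y\<bar> \<le> 2 * (301 / r * Q) + (100 * K + 303 * K\<^sup>2 + 100) / r * Q"
    using SL LL unfolding form SS by linarith
  also have "\<dots> \<le> (303 * K\<^sup>2 + 100 * K + 702) / r * Q" using Q0 r by (simp add: field_simps)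
  finally show ?thesis unfolding Q_def r_def .
qed

section \<open>Heavy pairs\<close>

text \<open>Pairs are ordered, to match the double sum of \<open>edge_form\<close>: an edge with
  both ends in \<open>S \<inter> T\<close> counts twice.\<close>

definition edge_pairs :: "nat set set \<Rightarrow> nat set \<Rightarrow> nat set \<Rightarrow> nat" where
  "edge_pairs E S T = card {x \<in> S \<times> T. {fst x, snd x} \<in> E}"

text \<open>
  The parameter \<open>k\<close> stands for a threshold \<open>2 ^ (k + 2)\<close> for the ratio between the number of edges and
  its mean; allowing it to depend on the dyadic levels of \<open>S\<close> and \<open>T\<close> avoids the usual case
  distinction on that ratio.
\<close>

definition discrepancy :: "nat \<Rightarrow> nat set set \<Rightarrow> real \<Rightarrow> real \<Rightarrow> bool" where
  "discrepancy n E P C \<longleftrightarrow> (\<forall>S T t k. S \<subseteq> {..<n} \<longrightarrow> T \<subseteq> {..<n} \<longrightarrow> 1 \<le> t \<longrightarrow> t \<le> n \<longrightarrow>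
     card S \<le> t \<longrightarrow> card T \<le> t \<longrightarrow> k \<le> 2 * n + 2 \<longrightarrow>
     real (edge_pairs E S T) \<le> 2 ^ (k + 2) * P * real (card S) * real (card T) +
       C * real t * ln (exp 1 * real n / real t) / (real k + 1))"

lemma ex_power_of_two_floor:
  fixes x :: real
  assumes "x \<ge> 1"
  shows "\<exists>k::nat. 2 ^ k \<le> x \<and> x < 2 ^ (k + 1)"
proof -
  have "1 \<le> nat \<lfloor>x\<rfloor>" using assms by linarith
  then obtain k where k: "2 ^ k \<le> nat \<lfloor>x\<rfloor>" "nat \<lfloor>x\<rfloor> < 2 ^ (k + 1)"
    using ex_power_ivl1[of 2 "nat \<lfloor>x\<rfloor>"] by auto
  have fl: "real (nat \<lfloor>x\<rfloor>) \<le> x" "x < real (nat \<lfloor>x\<rfloor>) + 1" using assms by linarith+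
  have "real (2 ^ k) \<le> real (nat \<lfloor>x\<rfloor>)" using k(1) by (simp only: of_nat_le_iff)
  then have "2 ^ k \<le> x" using fl unfolding of_nat_power of_nat_numeral by linarith
  moreover have "real (nat \<lfloor>x\<rfloor> + 1) \<le> real (2 ^ (k + 1))" using k(2) by (simp only: of_nat_le_iff)
  then have "real (nat \<lfloor>x\<rfloor>) + 1 \<le> 2 ^ (k + 1)" by (simp only: of_nat_add of_nat_1 of_nat_power of_nat_numeral)
  then have "x < 2 ^ (k + 1)" using fl by linarith
  ultimately show ?thesis by blast
qed

lemma sum_Suc_over_power_two: "(\<Sum>j<m. real (j + 1) / 2 ^ j) = 4 - 2 * (real m + 2) / 2 ^ m"
proof (induction m)
  case (Suc m)
  have "(\<Sum>j<Suc m. real (j + 1) / 2 ^ j) = 4 - 2 * (real m + 2) / 2 ^ m + real (m + 1) / 2 ^ m"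
    using Suc by simp
  also have "\<dots> = 4 - 2 * (real (Suc m) + 2) / 2 ^ Suc m" by (simp add: field_simps)
  finally show ?case .
qed simp

lemma sum_reversed_Suc_over_power_two:
  "(\<Sum>a\<le>n. if a \<le> B then real (B - a + 1) / 2 ^ (B - a) else 0) \<le> 4"
proof -
  have "(\<Sum>a\<le>n. if a \<le> B then real (B - a + 1) / 2 ^ (B - a) else 0) = (\<Sum>a\<in>{..n} \<inter> {..B}. real (B - a + 1) / 2 ^ (B - a))"
    by (subst sum.inter_restrict) (auto intro!: sum.cong)
  also have "\<dots> \<le> (\<Sum>a\<in>{..B}. real (B - a + 1) / 2 ^ (B - a))" by (intro sum_mono2) auto
  also have "\<dots> = (\<Sum>j<Suc B. real (j + 1) / 2 ^ j)"
    by (rule sum.reindex_bij_witness[of _ "\<lambda>j. B - j" "\<lambda>j. B - j"]) auto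
  also have "\<dots> \<le> 4" unfolding sum_Suc_over_power_two by simp
  finally show ?thesis .
qed

text \<open>
  Pairs with \<open>w i / w j\<close> outside \<open>(1 / sqrt d, sqrt d)\<close> are controlled by the maximum degree. For the
  remaining ones both weights exceed 1. Levels \<open>2 ^ a\<close> and \<open>2 ^ b\<close> are compared with the discrepancy
  bound for \<open>2 ^ k = 2 ^ (a + b + 1) / 2 ^ D\<close>, where \<open>2 ^ D\<close> approximates \<open>sqrt d\<close>. With
  \<open>j = 2 * b + 2 - k\<close> one has \<open>(b + 1) / (k + 1) \<le> j + 1\<close>, so the sum over \<open>a\<close> is dominated by
  \<open>\<Sum>j. (j + 1) / 2 ^ j\<close>. The sizes \<open>t\<close> of the level sets are first enlarged to at least \<open>n / 8 ^ a\<close>,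
  which makes \<open>ln (exp 1 * n / t)\<close> linear in the level.
\<close>

lemma heavy_pairs_bound:
  fixes d P C c1 c2 :: real and w :: "nat \<Rightarrow> real"
  assumes E: "E \<subseteq> all_edges n" and n: "n \<ge> 1" and d: "d \<ge> 1"
    and deg: "\<And>v. v < n \<Longrightarrow> real (degree_of E v) \<le> c1 * d"
    and disc: "discrepancy n E P C" and P: "0 \<le> P" "P * n \<le> c2 * d" and C: "0 \<le> C"
    and w: "\<And>i. w i \<ge> 0" "(\<Sum>i<n. (w i)\<^sup>2) \<le> 2 * n"
  shows "(\<Sum>i<n. \<Sum>j<n. if {i, j} \<in> E \<and> sqrt d < w i * w j then w i * w j else 0)
     \<le> (4 * c1 + 256 * c2 + 1152 * C) * (sqrt d * n)"
proof -
  define r where "r = sqrt d"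
  have r: "r \<ge> 1" "r * r = d" using d by (simp_all add: r_def)
  have "0 \<le> c2 * d" using order_trans[OF _ P(2)] P(1) by simp
  then have c2: "c2 \<ge> 0" using d by (simp add: zero_le_mult_iff)
  obtain D where D: "2 ^ D \<le> r" "r < 2 ^ (D + 1)" using ex_power_of_two_floor[OF r(1)] by blast
  \<comment> \<open>The dyadic level of a weight; its value is arbitrary for weights below 1, which
    never enter a level set.\<close>
  define lev where "lev i = (SOME k::nat. 2 ^ k \<le> w i \<and> w i < 2 ^ (k + 1))" for i
  have lev: "2 ^ lev i \<le> w i" "w i < 2 ^ (lev i + 1)" if "w i \<ge> 1" for i
    using someI_ex[OF ex_power_of_two_floor[OF that]] unfolding lev_def by blast+
  define S where "S a = {i. i < n \<and> w i \<ge> 1 \<and> lev i = a}" for a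
  have S: "S a \<subseteq> {..<n}" "finite (S a)" for a unfolding S_def by auto
  have cS: "card (S a) \<le> n" for a using card_mono[OF _ S(1)[of a]] by simp
  define \<alpha> where "\<alpha> a = card (S a) * 4 ^ a / n" for a
  \<comment> \<open>A summable majorant of \<open>t a * 4 ^ a / n\<close> for nonempty levels. The
    term \<open>1 / 2 ^ a\<close> is the contribution of \<open>n / 8 ^ a\<close>; doubling
    \<open>\<alpha>\<close> pays for rounding up, since a nonempty level has at least one
    vertex.\<close>
  define \<tau> where "\<tau> a = 2 * \<alpha> a + 1 / 2 ^ a" for a
  have \<alpha>0: "\<alpha> a \<ge> 0" for a unfolding \<alpha>_def by simp
  have \<tau>0: "\<tau> a \<ge> 0" for a unfolding \<tau>_def using \<alpha>0 by simp
  have sum\<alpha>: "(\<Sum>a\<le>n. \<alpha> a) \<le> 2"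
  proof -
    have "(\<Sum>a\<le>n. \<alpha> a * n) \<le> (\<Sum>a\<le>n. \<Sum>i\<in>S a. (w i)\<^sup>2)"
    proof (intro sum_mono)
      fix a
      have "\<alpha> a * n = (\<Sum>i\<in>S a. 4 ^ a)" using n by (simp add: \<alpha>_def)
      also have "\<dots> \<le> (\<Sum>i\<in>S a. (w i)\<^sup>2)"
      proof (intro sum_mono)
        fix i assume "i \<in> S a"
        then have "2 ^ a \<le> w i" using lev(1) by (auto simp: S_def)
        then have "(2 ^ a)\<^sup>2 \<le> (w i)\<^sup>2" by (intro power_mono) auto
        then show "4 ^ a \<le> (w i)\<^sup>2" by (simp add: power2_eq_square power_mult_distrib[symmetric])
      qed
      finally show "\<alpha> a * n \<le> (\<Sum>i\<in>S a. (w i)\<^sup>2)" .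
    qed
    also have "\<dots> = (\<Sum>i\<in>(\<Union>a\<in>{..n}. S a). (w i)\<^sup>2)"
      by (rule sum.UNION_disjoint[symmetric]) (simp_all add: S(2), auto simp: S_def)
    also have "\<dots> \<le> (\<Sum>i<n. (w i)\<^sup>2)" using S by (intro sum_mono2) auto
    also have "\<dots> \<le> 2 * n" by (rule w)
    finally have "(\<Sum>a\<le>n. \<alpha> a) * n \<le> 2 * n" by (simp add: sum_distrib_right)
    then show ?thesis using n by simp
  qed
  have sum\<tau>: "(\<Sum>a\<le>n. \<tau> a) \<le> 6"
  proof -
    have "(\<Sum>a<m. 1 / 2 ^ a) = 2 - 2 / (2 ^ m :: real)" for m :: nat by (induction m) (auto simp: field_simps)
    from this[of "Suc n"] have "(\<Sum>a\<le>n. 1 / 2 ^ a) \<le> (2 :: real)" unfolding lessThan_Suc_atMost by simp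
    then show ?thesis unfolding \<tau>_def sum.distrib sum_distrib_left[symmetric] using sum\<alpha> by simp
  qed
  \<comment> \<open>A crude bound, which makes the sums over levels finite and keeps
    \<open>k\<close> in the range \<open>k \<le> 2 * n + 2\<close> granted by
    \<open>discrepancy\<close>.\<close>
  have levn: "lev i \<le> n" if "i < n" "w i \<ge> 1" for i
  proof (rule ccontr)
    assume "\<not> lev i \<le> n"
    have "(w i)\<^sup>2 \<le> (\<Sum>i<n. (w i)\<^sup>2)" using that by (intro member_le_sum) auto
    then have "(w i)\<^sup>2 \<le> 2 * n" using w(2) by linarith
    moreover have "(2 ^ n :: real) \<le> 2 ^ lev i" using \<open>\<not> lev i \<le> n\<close> by (intro power_increasing) auto
    then have "2 ^ n \<le> w i" using lev(1)[OF that(2)] by linarith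
    then have "(2 ^ n)\<^sup>2 \<le> (w i)\<^sup>2" by (intro power_mono) auto
    moreover have "real n < 2 ^ n" by simp
    then have "2 * real n < 2 ^ n * 2 ^ n" using n
      by (intro mult_le_less_imp_less) (auto intro: order_trans[OF _ power_increasing[of 1 n 2]])
    ultimately show False by (simp add: power2_eq_square)
  qed
  \<comment> \<open>The level pairs that pairs in \<open>Bad\<close> can have: the three
    inequalities are the dyadic forms of \<open>r < w i * w j\<close>, \<open>w i < r * w j\<close>
    and \<open>w j < r * w i\<close>.\<close>
  define Adm where "Adm = {(a, b). a \<le> n \<and> b \<le> n \<and> D \<le> a + b + 1 \<and> a \<le> D + b + 1 \<and> b \<le> D + a + 1}"
  define H where "H a b = (if a \<le> b + 1 + D then 24 * C * \<tau> b * (real (b + 1 + D - a + 1) / 2 ^ (b + 1 + D - a)) else 0)" for a b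
  have H0: "H a b \<ge> 0" for a b unfolding H_def using C \<tau>0 by simp
  define t where "t a = min n (card (S a) + nat \<lceil>n / 8 ^ a\<rceil>)" for a
  have t1: "card (S a) \<le> t a" "t a \<le> n" for a unfolding t_def using cS by auto
  have tlow: "n / 8 ^ a \<le> t a" for a
  proof -
    have "n / 8 ^ a \<le> real n" by (simp add: divide_le_eq mult_le_cancel_left1)
    moreover have "n / 8 ^ a \<le> real (card (S a) + nat \<lceil>n / 8 ^ a\<rceil>)" by linarith
    ultimately show ?thesis unfolding t_def min_def
      by (cases "n \<le> card (S a) + nat \<lceil>n / 8 ^ a\<rceil>") (simp_all only: if_True if_False)
  qed
  have tup: "real (t a) * 4 ^ a \<le> n * \<tau> a" if "S a \<noteq> {}" for a
  proof -
    have s1: "1 \<le> card (S a)" using that S(2)[of a] by (simp add: Suc_le_eq card_gt_0_iff)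
    have "real (t a) \<le> card (S a) + real (nat \<lceil>n / 8 ^ a\<rceil>)" unfolding t_def by linarith
    also have "real (nat \<lceil>n / 8 ^ a\<rceil>) \<le> n / 8 ^ a + 1" by (simp add: of_nat_nat)
    finally have "real (t a) \<le> 2 * card (S a) + n / 8 ^ a" using s1 by linarith
    then have "real (t a) * 4 ^ a \<le> (2 * card (S a) + n / 8 ^ a) * 4 ^ a" by (intro mult_right_mono) auto
    also have "\<dots> = n * \<tau> a"
    proof -
      have "(8::real) ^ a = 2 ^ a * 4 ^ a" by (simp add: power_mult_distrib[symmetric])
      then show ?thesis using n unfolding \<tau>_def \<alpha>_def by (simp add: field_simps)
    qed
    finally show ?thesis .
  qed
  \<comment> \<open>Here \<open>x\<close>, \<open>y\<close> are the two levels ordered by the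
    enlarged sizes. The discrepancy bound is applied with the larger size \<open>t y\<close>, and
    its logarithmic term is charged to \<open>H x y\<close>.\<close>
  have half: "4 * 2 ^ (a + b) * real (edge_pairs E (S a) (S b)) \<le> r * n * (64 * c2 * (\<alpha> a * \<alpha> b) + H x y)"
    if ab: "(a, b) \<in> Adm" and ne: "S a \<noteq> {}" "S b \<noteq> {}" and xy: "x = a \<and> y = b \<or> x = b \<and> y = a" and le: "t x \<le> t y"
    for a b x y
  proof -
    define k where "k = a + b + 1 - D"
    define j where "j = y + 1 + D - x"
    have k: "a + b + 1 = k + D" using ab unfolding Adm_def k_def by auto
    have j: "x + j = y + 1 + D" using ab xy unfolding Adm_def j_def by auto
    have kj: "k + j = 2 * y + 2" using k j xy by auto
    have yn: "y \<le> n" using ab xy unfolding Adm_def by auto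
    have t1': "1 \<le> t y" using t1(1)[of y] ne xy S(2)[of y] card_gt_0_iff[of "S y"] by fastforce
    have ca: "card (S a) \<le> t y" "card (S b) \<le> t y" using t1(1)[of a] t1(1)[of b] xy le by auto
    have "real (edge_pairs E (S a) (S b)) \<le> 2 ^ (k + 2) * P * card (S a) * card (S b) +
        C * t y * ln (exp 1 * n / t y) / (k + 1)"
      using disc[unfolded discrepancy_def, rule_format, OF S(1)[of a] S(1)[of b] t1' t1(2)[of y] ca, of k] kj yn
      by (simp add: add.commute)
    also have "\<dots> \<le> 2 ^ (k + 2) * P * card (S a) * card (S b) + C * t y * (3 * (real y + 1)) / (k + 1)"
    proof -
      have "exp 1 * n / t y \<le> exp 1 * 8 ^ y"
        using tlow[of y] t1' by (simp add: field_simps)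
      then have "ln (exp 1 * n / t y) \<le> ln (exp 1 * 8 ^ y)" using t1' n by (subst ln_le_cancel_iff) auto
      also have "\<dots> = 1 + y * ln 8" by (simp add: ln_mult ln_realpow)
      finally have "ln (exp 1 * n / t y) \<le> 1 + y * ln 8" .
      moreover have "ln (8::real) \<le> 3"
      proof -
        have "ln (8::real) = 3 * ln 2" using ln_realpow[of 2 3] by simp
        then show ?thesis using ln_2_less_1 by simp
      qed
      then have "y * ln 8 \<le> real y * 3" by (intro mult_left_mono) auto
      ultimately have "ln (exp 1 * n / t y) \<le> 3 * (real y + 1)" by simp
      then show ?thesis using C by (intro add_left_mono divide_right_mono mult_left_mono) auto
    qed
    finally have "4 * 2 ^ (a + b) * real (edge_pairs E (S a) (S b)) \<le>
       4 * 2 ^ (a + b) * (2 ^ (k + 2) * P * card (S a) * card (S b) + C * t y * (3 * (real y + 1)) / (k + 1))"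
      by (intro mult_left_mono) auto
    then have "4 * 2 ^ (a + b) * real (edge_pairs E (S a) (S b)) \<le>
       4 * 2 ^ (a + b) * (2 ^ (k + 2) * P * card (S a) * card (S b)) + 
       4 * 2 ^ (a + b) * (C * t y * (3 * (real y + 1)) / (k + 1))" by (simp only: distrib_left)
    moreover have "4 * 2 ^ (a + b) * (2 ^ (k + 2) * P * card (S a) * card (S b)) \<le> r * n * (64 * c2 * (\<alpha> a * \<alpha> b))"
    proof -
      have p: "(2::real) ^ (k + 2) * 2 ^ D = 8 * 2 ^ (a + b)"
      proof -
        have "(2::real) ^ (k + 2) * 2 ^ D = 2 ^ (k + D + 2)" by (simp add: power_add)
        also have "k + D + 2 = a + b + 3" using k by simp
        finally show ?thesis by (simp add: power_add)
      qed
      have four: "(2::real) ^ (a + b) * 2 ^ (a + b) = 4 ^ a * 4 ^ b"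
      proof -
        have "(4::real) ^ c = 2 ^ c * 2 ^ c" for c by (simp add: power_mult_distrib[symmetric])
        then show ?thesis by (simp add: power_add mult_ac)
      qed
      have "2 ^ D * (4 * 2 ^ (a + b) * (2 ^ (k + 2) * P * card (S a) * card (S b))) =
          32 * (2 ^ (a + b) * 2 ^ (a + b)) * P * card (S a) * card (S b)"
        using p by (simp add: mult_ac)
      also have "\<dots> = 32 * (P * n) * n * (\<alpha> a * \<alpha> b)" unfolding four using n by (simp add: \<alpha>_def)
      also have "\<dots> \<le> 32 * (c2 * d) * n * (\<alpha> a * \<alpha> b)" using P \<alpha>0 by (intro mult_right_mono mult_left_mono) auto
      also have "\<dots> = r * (r * (32 * c2 * n * (\<alpha> a * \<alpha> b)))" by (simp add: r(2)[symmetric])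
      also have "\<dots> \<le> (2 * 2 ^ D) * (r * (32 * c2 * n * (\<alpha> a * \<alpha> b)))"
        using D r \<alpha>0 c2 by (intro mult_right_mono) auto
      also have "\<dots> = 2 ^ D * (r * n * (64 * c2 * (\<alpha> a * \<alpha> b)))" by simp
      finally show ?thesis by simp
    qed
    moreover have "4 * 2 ^ (a + b) * (C * t y * (3 * (real y + 1)) / (k + 1)) \<le> r * n * H x y"
    proof -
      have xj: "(2::real) ^ x * 2 ^ j = 2 ^ y * 2 * 2 ^ D" using j by (metis power_add power_one_right)
      have ab': "(2::real) ^ (a + b) = 2 ^ x * 2 ^ y" using xy by (auto simp: power_add)
      have frac: "(real y + 1) / (k + 1) \<le> j + 1"
      proof -
        have "real y + 1 \<le> real (k + j + 1)" using kj by linarith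
        also have "\<dots> \<le> (real j + 1) * (real k + 1)" by (simp add: algebra_simps)
        finally show ?thesis by (simp add: field_simps)
      qed
      have xyt: "2 ^ x * 2 ^ y * real (t y) = 2 * 2 ^ D / 2 ^ j * (real (t y) * 4 ^ y)"
      proof -
        have "(4::real) ^ y = 2 ^ y * 2 ^ y" by (simp add: power_mult_distrib[symmetric])
        moreover have "(2::real) ^ x = 2 ^ y * 2 * 2 ^ D / 2 ^ j" using xj by (simp add: field_simps)
        ultimately show ?thesis by simp
      qed
      have "4 * 2 ^ (a + b) * (C * t y * (3 * (real y + 1)) / (k + 1)) =
          12 * C * (2 ^ x * 2 ^ y * real (t y)) * ((real y + 1) / (k + 1))" unfolding ab' by simp
      also have "\<dots> \<le> 12 * C * (2 ^ x * 2 ^ y * real (t y)) * real (j + 1)"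
        using frac C by (intro mult_left_mono) auto
      also have "12 * C * (2 ^ x * 2 ^ y * real (t y)) * real (j + 1) = 12 * C * (2 * 2 ^ D / 2 ^ j * (real (t y) * 4 ^ y)) * real (j + 1)"
        unfolding xyt ..
      also have "12 * C * (2 * 2 ^ D / 2 ^ j * (real (t y) * 4 ^ y)) * real (j + 1) \<le> 12 * C * (2 * r / 2 ^ j * (n * \<tau> y)) * real (j + 1)"
      proof -
        have ty: "real (t y) * 4 ^ y \<le> n * \<tau> y" using tup[of y] ne xy by blast
        have "2 * 2 ^ D / 2 ^ j * (real (t y) * 4 ^ y) \<le> 2 * r / 2 ^ j * (n * \<tau> y)"
          by (rule mult_mono[OF divide_right_mono ty]) (use D(1) r in auto)
        then show ?thesis using C by (intro mult_right_mono mult_left_mono) auto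
      qed
      also have "\<dots> = r * n * (24 * C * \<tau> y * (real (j + 1) / 2 ^ j))" by simp
      also have "\<dots> = r * n * H x y" unfolding H_def j_def using j by simp
      finally show ?thesis by (simp add: add.commute)
    qed
    ultimately show ?thesis unfolding distrib_left by linarith
  qed
  have both: "4 * 2 ^ (a + b) * real (edge_pairs E (S a) (S b)) \<le> r * n * (64 * c2 * (\<alpha> a * \<alpha> b) + H a b + H b a)"
    if ab: "(a, b) \<in> Adm" for a b
  proof (cases "S a = {} \<or> S b = {}")
    case True
    then have "edge_pairs E (S a) (S b) = 0" by (auto simp: edge_pairs_def)
    then show ?thesis using r H0 \<alpha>0 c2 by simp
  next
    case False
    have rn: "0 \<le> r * n" using r by simp
    show ?thesis
    proof (cases "t a \<le> t b")
      case True
      have "4 * 2 ^ (a + b) * real (edge_pairs E (S a) (S b)) \<le> r * n * (64 * c2 * (\<alpha> a * \<alpha> b) + H a b)"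
        using half[OF ab _ _ _ True] False by blast
      also have "\<dots> \<le> r * n * (64 * c2 * (\<alpha> a * \<alpha> b) + H a b + H b a)" using H0 rn by (intro mult_left_mono) auto
      finally show ?thesis .
    next
      case le: False
      then have "t b \<le> t a" by simp
      then have "4 * 2 ^ (a + b) * real (edge_pairs E (S a) (S b)) \<le> r * n * (64 * c2 * (\<alpha> a * \<alpha> b) + H b a)"
        using half[OF ab, of b a] False by blast
      also have "\<dots> \<le> r * n * (64 * c2 * (\<alpha> a * \<alpha> b) + H a b + H b a)" using H0 rn by (intro mult_left_mono) auto
      finally show ?thesis .
    qed
  qed
  define Bad where "Bad = {x \<in> {..<n} \<times> {..<n}. {fst x, snd x} \<in> E \<and> r < w (fst x) * w (snd x) \<and>
      w (fst x) < r * w (snd x) \<and> w (snd x) < r * w (fst x)}"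
  have finB: "finite Bad" unfolding Bad_def by simp
  have BadD: "w i \<ge> 1" "w j \<ge> 1" "(lev i, lev j) \<in> Adm" "w i * w j \<le> 4 * 2 ^ (lev i + lev j)"
    if "(i, j) \<in> Bad" for i j
  proof -
    have b: "i < n" "j < n" "r < w i * w j" "w i < r * w j" "w j < r * w i" using that by (auto simp: Bad_def)
    \<comment> \<open>If \<open>y < 1\<close> then \<open>x * y \<le> r * y\<^sup>2 \<le> r\<close>,
      a contradiction. So balanced heavy pairs consist of weights to which \<open>lev\<close>
      applies.\<close>
    have ge1: "y \<ge> 1" if "r < x * y" "x < r * y" "y \<ge> 0" for x y
    proof (rule ccontr)
      assume "\<not> 1 \<le> y"
      then have "x * y \<le> (r * y) * y" using that by (intro mult_right_mono) auto
      also have "\<dots> \<le> r * 1" using \<open>\<not> 1 \<le> y\<close> that r unfolding mult.assoc by (intro mult_left_mono mult_le_one) auto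
      finally show False using that by simp
    qed
    show wi: "w i \<ge> 1" using ge1[of "w j" "w i"] b w(1) by (simp add: mult.commute)
    show wj: "w j \<ge> 1" using ge1[of "w i" "w j"] b w(1) by simp
    note li = lev[OF wi] and lj = lev[OF wj]
    have up: "w i * w j \<le> 2 ^ (lev i + 1) * 2 ^ (lev j + 1)"
      using li lj w(1) by (intro mult_mono) auto
    then show "w i * w j \<le> 4 * 2 ^ (lev i + lev j)" by (simp add: power_add)
    have pw: "a < b" if "(2::real) ^ a < 2 ^ b" for a b :: nat using that by simp
    have "(2::real) ^ D < 2 ^ (lev i + 1) * 2 ^ (lev j + 1)" using up b(3) D(1) by linarith
    then have "(2::real) ^ D < 2 ^ (lev i + lev j + 2)" by (simp add: power_add)
    then have 1: "D < lev i + lev j + 2" by (rule pw)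
    have rel: "lev a < D + lev b + 2" if "2 ^ lev a \<le> w a" "w b < 2 ^ (lev b + 1)" "w a < r * w b" for a b
    proof -
      have "r * w b \<le> 2 ^ (D + 1) * 2 ^ (lev b + 1)" using that D r w(1) by (intro mult_mono) auto
      then have "(2::real) ^ lev a < 2 ^ (D + 1) * 2 ^ (lev b + 1)" using that by linarith
      then have "(2::real) ^ lev a < 2 ^ (D + lev b + 2)" by (simp add: power_add)
      then show ?thesis by (rule pw)
    qed
    show "(lev i, lev j) \<in> Adm"
      using 1 rel[of i j] rel[of j i] li lj b levn[OF b(1) wi] levn[OF b(2) wj] unfolding Adm_def by simp
  qed
  have finA: "finite Adm"
    by (rule finite_subset[of _ "{..n} \<times> {..n}"]) (auto simp: Adm_def)
  have sumB: "(\<Sum>x\<in>Bad. w (fst x) * w (snd x)) \<le> (256 * c2 + 1152 * C) * (r * n)"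
  proof -
    have "(\<Sum>x\<in>Bad. w (fst x) * w (snd x)) = (\<Sum>y\<in>Adm. \<Sum>x | x \<in> Bad \<and> (lev (fst x), lev (snd x)) = y. w (fst x) * w (snd x))"
      using BadD(3) by (intro sum.group[symmetric] finB finA) auto
    also have "\<dots> \<le> (\<Sum>y\<in>Adm. r * n * (64 * c2 * (\<alpha> (fst y) * \<alpha> (snd y)) + H (fst y) (snd y) + H (snd y) (fst y)))"
    proof (intro sum_mono)
      fix y assume y: "y \<in> Adm"
      obtain a b where ab: "y = (a, b)" by (cases y)
      let ?X = "{x \<in> Bad. (lev (fst x), lev (snd x)) = y}"
      have "?X \<subseteq> {x \<in> S a \<times> S b. {fst x, snd x} \<in> E}"
        using BadD(1,2) by (auto simp: ab S_def Bad_def)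
      then have "card ?X \<le> edge_pairs E (S a) (S b)"
        unfolding edge_pairs_def using S(2) by (intro card_mono) auto
      then have "real (card ?X) \<le> real (edge_pairs E (S a) (S b))" by simp
      then have "4 * 2 ^ (a + b) * real (card ?X) \<le> 4 * 2 ^ (a + b) * real (edge_pairs E (S a) (S b))"
        by (rule mult_left_mono) simp
      moreover have "(\<Sum>x\<in>?X. w (fst x) * w (snd x)) \<le> (\<Sum>x\<in>?X. 4 * 2 ^ (a + b))"
        using BadD(4) by (intro sum_mono) (auto simp: ab)
      moreover have "(\<Sum>x\<in>?X. 4 * 2 ^ (a + b)) = 4 * 2 ^ (a + b) * real (card ?X)"
        unfolding sum_constant by (rule mult.commute)
      ultimately have "(\<Sum>x\<in>?X. w (fst x) * w (snd x)) \<le> 4 * 2 ^ (a + b) * real (edge_pairs E (S a) (S b))"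
        by linarith
      then show "(\<Sum>x\<in>?X. w (fst x) * w (snd x)) \<le> r * n * (64 * c2 * (\<alpha> (fst y) * \<alpha> (snd y)) + H (fst y) (snd y) + H (snd y) (fst y))"
        using both[of a b] y ab by auto
    qed
    also have "\<dots> \<le> (\<Sum>y\<in>{..n} \<times> {..n}. r * n * (64 * c2 * (\<alpha> (fst y) * \<alpha> (snd y)) + H (fst y) (snd y) + H (snd y) (fst y)))"
    proof (intro sum_mono2)
      show "0 \<le> r * n * (64 * c2 * (\<alpha> (fst y) * \<alpha> (snd y)) + H (fst y) (snd y) + H (snd y) (fst y))" for y
        using r H0 \<alpha>0 c2 by simp
    qed (auto simp: Adm_def)
    also have "\<dots> = r * n * (64 * c2 * ((\<Sum>a\<le>n. \<alpha> a) * (\<Sum>a\<le>n. \<alpha> a)) + (\<Sum>a\<le>n. \<Sum>b\<le>n. H a b) + (\<Sum>a\<le>n. \<Sum>b\<le>n. H b a))"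
      by (simp add: sum_distrib_left[symmetric] sum.cartesian_product' sum.distrib sum_product)
    \<comment> \<open>The sum of \<open>\<alpha>\<close> is at most 2, and each sum of
      \<open>H\<close> is at most \<open>24 * C\<close> times 4, from the geometric sum, times 6,
      from the sum of \<open>\<tau>\<close>.\<close>
    also have "\<dots> \<le> r * n * (64 * c2 * (2 * 2) + 576 * C + 576 * C)"
    proof -
      have "(\<Sum>a\<le>n. \<Sum>b\<le>n. H a b) = (\<Sum>b\<le>n. 24 * C * \<tau> b * (\<Sum>a\<le>n. if a \<le> b + 1 + D then real (b + 1 + D - a + 1) / 2 ^ (b + 1 + D - a) else 0))"
        unfolding H_def sum_distrib_left by (subst sum.swap) (intro sum.cong, auto)
      also have "\<dots> \<le> (\<Sum>b\<le>n. 24 * C * \<tau> b * 4)"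
        using C \<tau>0 by (intro sum_mono mult_left_mono sum_reversed_Suc_over_power_two) auto
      also have "\<dots> = 96 * C * (\<Sum>b\<le>n. \<tau> b)" by (simp add: sum_distrib_left mult.assoc)
      also have "\<dots> \<le> 96 * C * 6" using sum\<tau> C by (intro mult_left_mono) auto
      finally have 1: "(\<Sum>a\<le>n. \<Sum>b\<le>n. H a b) \<le> 576 * C" by simp
      have "(\<Sum>a\<le>n. \<alpha> a) * (\<Sum>a\<le>n. \<alpha> a) \<le> 2 * 2"
        using sum\<alpha> by (intro mult_mono) (simp_all add: sum_nonneg \<alpha>0)
      then have "64 * c2 * ((\<Sum>a\<le>n. \<alpha> a) * (\<Sum>a\<le>n. \<alpha> a)) \<le> 64 * c2 * (2 * 2)"
        using c2 by (intro mult_left_mono) auto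
      moreover have "(\<Sum>a\<le>n. \<Sum>b\<le>n. H b a) = (\<Sum>a\<le>n. \<Sum>b\<le>n. H a b)" by (rule sum.swap)
      ultimately have "64 * c2 * ((\<Sum>a\<le>n. \<alpha> a) * (\<Sum>a\<le>n. \<alpha> a)) + (\<Sum>a\<le>n. \<Sum>b\<le>n. H a b) +
          (\<Sum>a\<le>n. \<Sum>b\<le>n. H b a) \<le> 64 * c2 * (2 * 2) + 576 * C + 576 * C" using 1 by linarith
      then show ?thesis by (rule mult_left_mono) (use r in simp)
    qed
    finally show ?thesis by (simp add: algebra_simps)
  qed
  let ?H = "(\<Sum>i<n. \<Sum>j<n. if {i, j} \<in> E \<and> sqrt d < w i * w j then w i * w j else 0)"
  let ?I = "(\<Sum>i<n. \<Sum>j<n. (if {i, j} \<in> E then (w i)\<^sup>2 / r else 0))"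
  let ?J = "(\<Sum>i<n. \<Sum>j<n. (if {i, j} \<in> E then (w j)\<^sup>2 / r else 0))"
  let ?B = "(\<Sum>i<n. \<Sum>j<n. if (i, j) \<in> Bad then w i * w j else 0)"
  have "?H \<le>
    (\<Sum>i<n. \<Sum>j<n. (if {i, j} \<in> E then (w i)\<^sup>2 / r else 0) + (if {i, j} \<in> E then (w j)\<^sup>2 / r else 0) +
        (if (i, j) \<in> Bad then w i * w j else 0))"
  proof (intro sum_mono)
    fix i j assume ij: "i \<in> {..<n}" "j \<in> {..<n}"
    \<comment> \<open>An unbalanced pair is charged to its larger weight. Summing over neighbours
      costs at most the degree \<open>c1 * d\<close>, and the division by \<open>r\<close> leaves
      \<open>c1 * r\<close> times the squared weight.\<close>
    have sq: "x * y \<le> x\<^sup>2 / r" if "r * y \<le> x" "x \<ge> 0" for x y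
    proof -
      have "x * (r * y) \<le> x * x" using that by (intro mult_left_mono) auto
      then show ?thesis using r by (simp add: field_simps power2_eq_square)
    qed
    have nn: "0 \<le> (w i)\<^sup>2 / r" "0 \<le> (w j)\<^sup>2 / r" "0 \<le> w i * w j" using r w by auto
    then have badnn: "0 \<le> (if (i, j) \<in> Bad then w i * w j else 0)" by simp
    show "(if {i, j} \<in> E \<and> sqrt d < w i * w j then w i * w j else 0) \<le>
      (if {i, j} \<in> E then (w i)\<^sup>2 / r else 0) + (if {i, j} \<in> E then (w j)\<^sup>2 / r else 0) +
        (if (i, j) \<in> Bad then w i * w j else 0)"
    proof (cases "{i, j} \<in> E \<and> sqrt d < w i * w j")
      case True
      consider "r * w j \<le> w i" | "r * w i \<le> w j" | "(i, j) \<in> Bad"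
        by (cases "r * w j \<le> w i"; cases "r * w i \<le> w j") (use True ij in \<open>auto simp: Bad_def r_def not_le\<close>)
      then have "w i * w j \<le> (w i)\<^sup>2 / r \<or> w i * w j \<le> (w j)\<^sup>2 / r \<or> w i * w j \<le> (if (i, j) \<in> Bad then w i * w j else 0)"
      proof cases
        case 1 then show ?thesis using sq[OF 1 w(1)] by blast
      next
        case 2 then show ?thesis using sq[OF 2 w(1)] by (simp only: mult.commute simp_thms)
      next
        case 3 then show ?thesis by simp
      qed
      then have "w i * w j \<le> (w i)\<^sup>2 / r + (w j)\<^sup>2 / r + (if (i, j) \<in> Bad then w i * w j else 0)"
        using nn badnn by linarith
      then show ?thesis using True by simp
    next
      case False
      have "0 \<le> (if {i, j} \<in> E then (w i)\<^sup>2 / r else 0)" "0 \<le> (if {i, j} \<in> E then (w j)\<^sup>2 / r else 0)"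
        using nn by simp_all
      then show ?thesis using badnn unfolding if_not_P[OF False] by linarith
    qed
  qed
  also have "\<dots> = ?I + 
      ?J + ?B"
    by (simp add: sum.distrib)
  finally have tot: "?H \<le>
     ?I + 
      ?J + ?B" .
  moreover have "?J = ?I"
  proof (subst sum.swap, intro sum.cong refl)
    fix i j
    show "(if {j, i} \<in> E then (w i)\<^sup>2 / r else 0) = (if {i, j} \<in> E then (w i)\<^sup>2 / r else 0)"
      by (simp only: insert_commute[of i j])
  qed
  moreover have "?B = (\<Sum>x\<in>Bad. w (fst x) * w (snd x))"
  proof -
    have IB: "({..<n} \<times> {..<n}) \<inter> Bad = Bad" by (rule Int_absorb1) (auto simp: Bad_def)
    have "?B = 
        (\<Sum>x\<in>{..<n} \<times> {..<n}. if x \<in> Bad then w (fst x) * w (snd x) else 0)"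
      unfolding sum.cartesian_product by (intro sum.cong) auto
    also have "\<dots> = (\<Sum>x\<in>({..<n} \<times> {..<n}) \<inter> Bad. w (fst x) * w (snd x))"
      by (rule sum.inter_restrict[symmetric]) simp
    finally show ?thesis unfolding IB .
  qed
  moreover have "?I \<le> 2 * c1 * (r * n)"
  proof -
    have "?I = (\<Sum>i<n. real (degree_of E i) * ((w i)\<^sup>2 / r))"
      unfolding degree_of_eq_sum[OF E] sum_distrib_right by (intro sum.cong) auto
    also have "\<dots> \<le> (\<Sum>i<n. c1 * d * ((w i)\<^sup>2 / r))" using deg r by (intro sum_mono mult_right_mono) auto
    also have "\<dots> = c1 * r * (\<Sum>i<n. (w i)\<^sup>2)" using r(1) by (simp add: sum_distrib_left mult.assoc r(2)[symmetric])
    also have "\<dots> \<le> c1 * r * (2 * n)"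
    proof -
      have "0 < n" using n by simp
      from order_trans[OF of_nat_0_le_iff deg[OF this]] have "0 \<le> c1 * d" .
      then have "c1 \<ge> 0" using d by (simp add: zero_le_mult_iff)
      then show ?thesis using w r by (intro mult_left_mono) auto
    qed
    finally show ?thesis by simp
  qed
  ultimately have "?H \<le>
     2 * c1 * (r * n) + 2 * c1 * (r * n) + (256 * c2 + 1152 * C) * (r * n)"
    using sumB by linarith
  then show ?thesis unfolding r_def by (simp add: algebra_simps)
qed

section \<open>Reduction to integer vectors\<close>

definition bil :: "nat \<Rightarrow> (nat \<Rightarrow> nat \<Rightarrow> real) \<Rightarrow> (nat \<Rightarrow> real) \<Rightarrow> (nat \<Rightarrow> real) \<Rightarrow> real" where
  "bil n M x y = (\<Sum>i<n. \<Sum>j<n. M i j * (x i * y j))"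

lemma bil_add_left: "bil n M (\<lambda>i. x i + x' i) y = bil n M x y + bil n M x' y"
  unfolding bil_def by (simp add: algebra_simps sum.distrib)

lemma bil_add_right: "bil n M x (\<lambda>i. y i + y' i) = bil n M x y + bil n M x y'"
  unfolding bil_def by (simp add: algebra_simps sum.distrib)

lemma bil_scale: "bil n M (\<lambda>i. a * x i) (\<lambda>i. b * y i) = a * b * bil n M x y"
  unfolding bil_def sum_distrib_left by (intro sum.cong) auto

text \<open>Rounding to multiples of 1/4 stays in the ball, and four times the rounding error has
  coordinates at most 1, so it lies in the ball of radius \<open>sqrt n\<close> again. Expanding
  both arguments bounds the supremum by \<open>c\<close> plus two quarters of itself. Boundedness of
  \<open>V\<close> is what makes this absorption legitimate.\<close>

lemma bil_net_bound_ball: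
  fixes M :: "nat \<Rightarrow> nat \<Rightarrow> real"
  assumes net: "\<And>z w :: nat \<Rightarrow> int. (\<Sum>i<n. (z i)\<^sup>2) \<le> 16 * int n \<Longrightarrow> (\<Sum>i<n. (w i)\<^sup>2) \<le> 16 * int n \<Longrightarrow>
      \<bar>bil n M (\<lambda>i. z i / 4) (\<lambda>i. w i / 4)\<bar> \<le> c"
    and x: "(\<Sum>i<n. (x i)\<^sup>2) \<le> real n" and y: "(\<Sum>i<n. (y i)\<^sup>2) \<le> real n"
  shows "\<bar>bil n M x y\<bar> \<le> 2 * c"
proof -
  define Ball where "Ball = {x :: nat \<Rightarrow> real. (\<Sum>i<n. (x i)\<^sup>2) \<le> real n}"
  define V where "V = (\<lambda>(x, y). \<bar>bil n M x y\<bar>) ` (Ball \<times> Ball)"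
  have zero: "(\<lambda>_. 0) \<in> Ball" unfolding Ball_def by simp
  have ne: "V \<noteq> {}" unfolding V_def using zero by blast
  have bdd: "bdd_above V"
  proof (rule bdd_aboveI)
    fix v assume "v \<in> V"
    then obtain x y where xy: "x \<in> Ball" "y \<in> Ball" "v = \<bar>bil n M x y\<bar>" unfolding V_def by auto
    have en: "\<bar>x i\<bar> \<le> sqrt n" if "x \<in> Ball" "i < n" for x i
    proof -
      have "(x i)\<^sup>2 \<le> (\<Sum>i<n. (x i)\<^sup>2)" using that by (intro member_le_sum) auto
      then show ?thesis using that unfolding Ball_def by (intro real_le_rsqrt) auto
    qed
    have "v \<le> (\<Sum>i<n. \<Sum>j<n. \<bar>M i j * (x i * y j)\<bar>)" unfolding xy bil_def
      by (rule order.trans[OF sum_abs], intro sum_mono, rule sum_abs)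
    also have "\<dots> \<le> (\<Sum>i<n. \<Sum>j<n. \<bar>M i j\<bar> * (sqrt n * sqrt n))"
      unfolding abs_mult using en xy by (intro sum_mono mult_left_mono mult_mono) auto
    finally show "v \<le> (\<Sum>i<n. \<Sum>j<n. \<bar>M i j\<bar> * (sqrt n * sqrt n))" .
  qed
  have up: "\<bar>bil n M x y\<bar> \<le> Sup V" if "x \<in> Ball" "y \<in> Ball" for x y
    using that unfolding V_def by (intro cSup_upper bdd[unfolded V_def]) auto
  have round: "\<exists>z :: nat \<Rightarrow> int. (\<Sum>i<n. (z i)\<^sup>2) \<le> 16 * int n \<and> (\<lambda>i. z i / 4) \<in> Ball \<and> 
      (\<lambda>i. 4 * (x i - z i / 4)) \<in> Ball" if x: "x \<in> Ball" for x
  proof -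
    \<comment> \<open>Rounding towards zero, so that no coordinate grows.\<close>
    define z :: "nat \<Rightarrow> int" where "z i = (if x i \<ge> 0 then \<lfloor>4 * x i\<rfloor> else \<lceil>4 * x i\<rceil>)" for i
    have a: "\<bar>real_of_int (z i)\<bar> \<le> 4 * \<bar>x i\<bar>" "\<bar>4 * x i - z i\<bar> \<le> 1" for i
      unfolding z_def by (cases "x i \<ge> 0"; simp; linarith)+
    have b: "(z i / 4)\<^sup>2 \<le> (x i)\<^sup>2" for i
    proof -
      have "\<bar>z i / 4\<bar> \<le> \<bar>x i\<bar>" using a(1)[of i] by simp
      then show ?thesis by (simp only: abs_le_square_iff)
    qed
    have c: "(\<Sum>i<n. (z i / 4)\<^sup>2) \<le> real n"
    proof -
      have "(\<Sum>i<n. (z i / 4)\<^sup>2) \<le> (\<Sum>i<n. (x i)\<^sup>2)" by (rule sum_mono) (rule b)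
      also have "\<dots> \<le> n" using x unfolding Ball_def by simp
      finally show ?thesis .
    qed
    have "real_of_int (\<Sum>i<n. (z i)\<^sup>2) = 16 * (\<Sum>i<n. (z i / 4)\<^sup>2)"
      by (simp add: sum_distrib_left power_divide)
    also have "\<dots> \<le> real_of_int (16 * int n)" using c by simp
    finally have "(\<Sum>i<n. (z i)\<^sup>2) \<le> 16 * int n" by (simp only: of_int_le_iff)
    moreover have "(\<Sum>i<n. (4 * (x i - z i / 4))\<^sup>2) \<le> (\<Sum>i<n. 1)"
      using a(2) by (intro sum_mono) (simp add: algebra_simps abs_square_le_1)
    ultimately show ?thesis using c unfolding Ball_def by (intro exI[of _ z]) auto
  qed
  have main: "\<bar>bil n M x y\<bar> \<le> c + Sup V / 2" if x: "x \<in> Ball" and y: "y \<in> Ball" for x y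
  proof -
    obtain z where z: "(\<Sum>i<n. (z i)\<^sup>2) \<le> 16 * int n" "(\<lambda>i. z i / 4) \<in> Ball" "(\<lambda>i. 4 * (x i - z i / 4)) \<in> Ball"
      using round[OF x] by blast
    obtain w where w: "(\<Sum>i<n. (w i)\<^sup>2) \<le> 16 * int n" "(\<lambda>i. w i / 4) \<in> Ball" "(\<lambda>i. 4 * (y i - w i / 4)) \<in> Ball"
      using round[OF y] by blast
    have xdec: "(\<lambda>i. z i / 4 + 1 / 4 * (4 * (x i - z i / 4))) = x"
      and ydec: "(\<lambda>i. w i / 4 + 1 / 4 * (4 * (y i - w i / 4))) = y" by (auto simp: field_simps)
    have "bil n M x y = bil n M (\<lambda>i. z i / 4 + 1 / 4 * (4 * (x i - z i / 4))) y" unfolding xdec ..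
    also have "\<dots> = bil n M (\<lambda>i. z i / 4) (\<lambda>i. w i / 4 + 1 / 4 * (4 * (y i - w i / 4))) + 
        bil n M (\<lambda>i. 1 / 4 * (4 * (x i - z i / 4))) (\<lambda>i. 1 * y i)"
      unfolding bil_add_left ydec by (simp only: mult_1)
    also have "bil n M (\<lambda>i. 1 / 4 * (4 * (x i - z i / 4))) (\<lambda>i. 1 * y i) = 1 / 4 * bil n M (\<lambda>i. 4 * (x i - z i / 4)) y"
      unfolding bil_scale by simp
    also have "bil n M (\<lambda>i. z i / 4) (\<lambda>i. w i / 4 + 1 / 4 * (4 * (y i - w i / 4))) = 
        bil n M (\<lambda>i. z i / 4) (\<lambda>i. w i / 4) + bil n M (\<lambda>i. 1 * (z i / 4)) (\<lambda>i. 1 / 4 * (4 * (y i - w i / 4)))"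
      unfolding bil_add_right by simp
    also have "bil n M (\<lambda>i. 1 * (z i / 4)) (\<lambda>i. 1 / 4 * (4 * (y i - w i / 4))) = 
        1 / 4 * bil n M (\<lambda>i. z i / 4) (\<lambda>i. 4 * (y i - w i / 4))"
      unfolding bil_scale by simp
    finally have "\<bar>bil n M x y\<bar> \<le> \<bar>bil n M (\<lambda>i. z i / 4) (\<lambda>i. w i / 4)\<bar> + 
        1 / 4 * \<bar>bil n M (\<lambda>i. z i / 4) (\<lambda>i. 4 * (y i - w i / 4))\<bar> + 1 / 4 * \<bar>bil n M (\<lambda>i. 4 * (x i - z i / 4)) y\<bar>"
      by linarith
    also have "\<dots> \<le> c + 1 / 4 * Sup V + 1 / 4 * Sup V"
      using net[OF z(1) w(1)] up[OF z(2) w(3)] up[OF z(3) y] by linarith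
    finally show ?thesis by simp
  qed
  have "Sup V \<le> c + Sup V / 2"
    using ne main by (intro cSup_least) (auto simp: V_def)
  then have "Sup V \<le> 2 * c" by simp
  then show ?thesis using up[of x y] x y unfolding Ball_def by fastforce
qed

lemma bil_net_bound:
  fixes M :: "nat \<Rightarrow> nat \<Rightarrow> real"
  assumes net: "\<And>z w :: nat \<Rightarrow> int. (\<Sum>i<n. (z i)\<^sup>2) \<le> 16 * int n \<Longrightarrow> (\<Sum>i<n. (w i)\<^sup>2) \<le> 16 * int n \<Longrightarrow>
      \<bar>bil n M (\<lambda>i. z i / 4) (\<lambda>i. w i / 4)\<bar> \<le> c * n"
    and n: "n \<ge> 1"
  shows "\<bar>bil n M x y\<bar> \<le> 2 * c * L2_set x {..<n} * L2_set y {..<n}"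
proof -
  define a where "a = L2_set x {..<n}"
  define b where "b = L2_set y {..<n}"
  have ab: "a \<ge> 0" "b \<ge> 0" unfolding a_def b_def by simp_all
  show ?thesis
  proof (cases "a = 0 \<or> b = 0")
    case True
    then have "(\<forall>i<n. x i = 0) \<or> (\<forall>i<n. y i = 0)"
      unfolding a_def b_def by (auto simp: L2_set_eq_0_iff)
    then have "bil n M x y = 0" unfolding bil_def by (intro sum.neutral ballI) auto
    then show ?thesis using True unfolding a_def b_def by auto
  next
    case False
    then have pos: "a > 0" "b > 0" using ab by auto
    have sc: "(\<Sum>i<n. (sqrt n / L2_set f {..<n} * f i)\<^sup>2) \<le> real n" if "L2_set f {..<n} > 0" for f
    proof -
      have "(\<Sum>i<n. (sqrt n / L2_set f {..<n} * f i)\<^sup>2) = n / (L2_set f {..<n})\<^sup>2 * (\<Sum>i<n. (f i)\<^sup>2)"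
        by (simp add: power_mult_distrib power_divide sum_distrib_left)
      also have "(\<Sum>i<n. (f i)\<^sup>2) = (L2_set f {..<n})\<^sup>2" by (simp add: L2_set_def sum_nonneg)
      finally show ?thesis using that by simp
    qed
    have "\<bar>bil n M (\<lambda>i. sqrt n / a * x i) (\<lambda>i. sqrt n / b * y i)\<bar> \<le> 2 * (c * n)"
      using sc[of x] sc[of y] pos unfolding a_def b_def by (intro bil_net_bound_ball net) auto
    then have "\<bar>(sqrt n / a) * (sqrt n / b) * bil n M x y\<bar> \<le> 2 * (c * n)" unfolding bil_scale .
    also have "(sqrt n / a) * (sqrt n / b) = n / (a * b)" by simp
    finally have "n / (a * b) * \<bar>bil n M x y\<bar> \<le> 2 * (c * n)" using pos by (simp add: abs_mult)
    then have "n * \<bar>bil n M x y\<bar> \<le> n * (2 * c * a * b)" using pos by (simp add: field_simps)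
    then show ?thesis using n unfolding a_def b_def by simp
  qed
qed

section \<open>Splitting the centred form into light and heavy pairs\<close>

definition centered_entry :: "nat set set \<Rightarrow> real \<Rightarrow> nat \<Rightarrow> nat \<Rightarrow> real" where
  "centered_entry E p i j = (if {i, j} \<in> E then 1 else 0) - (if i = j then 0 else p)"

definition light :: "real \<Rightarrow> (nat \<Rightarrow> real) \<Rightarrow> (nat \<Rightarrow> real) \<Rightarrow> nat \<Rightarrow> nat \<Rightarrow> real" where
  "light d x y i j = (if \<bar>x i * y j\<bar> \<le> sqrt d then x i * y j else 0)"

lemma centered_form_eq_bil: "centered_form n E p x y = bil n (centered_entry E p) x y"
proof -
  have "bil n (centered_entry E p) x y = (\<Sum>i<n. \<Sum>j<n. (if {i, j} \<in> E then x i * y j else 0) - 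
     (p * (x i * y j) - (if i = j then p * (x i * y j) else 0)))"
    unfolding bil_def centered_entry_def by (intro sum.cong) (auto simp: algebra_simps)
  also have "\<dots> = edge_form n E x y - (p * ((\<Sum>i<n. x i) * (\<Sum>j<n. y j)) - (\<Sum>i<n. p * (x i * y i)))"
  proof -
    have 1: "(\<Sum>i<n. \<Sum>j<n. p * (x i * y j)) = p * ((\<Sum>i<n. x i) * (\<Sum>j<n. y j))"
      unfolding sum_product by (simp only: sum_distrib_left)
    have 2: "(\<Sum>i<n. \<Sum>j<n. if i = j then p * (x i * y j) else 0) = (\<Sum>i<n. p * (x i * y i))"
      by simp
    show ?thesis unfolding sum_subtractf edge_form_def 1 2 ..
  qed
  finally show ?thesis unfolding centered_form_def by (simp add: right_diff_distrib sum_distrib_left)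
qed

text \<open>On heavy pairs the adjacency part and the mean part are bounded separately. The common
  weight \<open>W i = max \<bar>x i\<bar> \<bar>y i\<bar>\<close> reduces the former to
  \<open>heavy_pairs_bound\<close>. For the latter \<open>\<bar>x i * y j\<bar> \<le> (x i)\<^sup>2
  * (y j)\<^sup>2 / sqrt d\<close>, which adds one more \<open>c2\<close> and gives 257. The final
  factor 2 is that of the net. \<open>P\<close> and \<open>p\<close> differ because the discrepancy
  is taken at the end of the window.\<close>

lemma centered_form_bound:
  fixes d p C c1 c2 \<tau> :: real
  assumes E: "E \<subseteq> all_edges n" and n: "n \<ge> 1" and d: "d \<ge> 1"
    and deg: "\<And>v. v < n \<Longrightarrow> real (degree_of E v) \<le> c1 * d"
    and disc: "discrepancy n E P C" and P: "0 \<le> P" "P * n \<le> c2 * d" and C: "0 \<le> C"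
    and p: "0 \<le> p" "p * n \<le> c2 * d"
    and lt: "\<And>z w :: nat \<Rightarrow> int. (\<Sum>i<n. (z i)\<^sup>2) \<le> 16 * int n \<Longrightarrow> (\<Sum>i<n. (w i)\<^sup>2) \<le> 16 * int n \<Longrightarrow>
      \<bar>\<Sum>i<n. \<Sum>j<n. centered_entry E p i j * light d (\<lambda>i. z i / 4) (\<lambda>i. w i / 4) i j\<bar> \<le> \<tau> * sqrt d * n"
  shows "\<bar>centered_form n E p x y\<bar> \<le> 2 * (\<tau> + (4 * c1 + 257 * c2 + 1152 * C)) * sqrt d * L2_set x {..<n} * L2_set y {..<n}"
proof -
  have d0: "sqrt d > 0" using d by simp
  have net: "\<bar>bil n (centered_entry E p) (\<lambda>i. z i / 4) (\<lambda>i. w i / 4)\<bar> \<le> (\<tau> + (4 * c1 + 257 * c2 + 1152 * C)) * sqrt d * n"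
    if z: "(\<Sum>i<n. (z i)\<^sup>2) \<le> 16 * int n" and w: "(\<Sum>i<n. (w i)\<^sup>2) \<le> 16 * int n" for z w :: "nat \<Rightarrow> int"
  proof -
    define x where "x i = z i / 4" for i
    define y where "y i = w i / 4" for i
    have sq: "(\<Sum>i<n. (real_of_int (f i) / 4)\<^sup>2) \<le> real n" if "(\<Sum>i<n. (f i)\<^sup>2) \<le> 16 * int n" for f :: "nat \<Rightarrow> int"
    proof -
      have "(\<Sum>i<n. (real_of_int (f i) / 4)\<^sup>2) = real_of_int (\<Sum>i<n. (f i)\<^sup>2) / 16"
        by (simp add: power_divide sum_divide_distrib)
      also have "\<dots> \<le> real_of_int (16 * int n) / 16" using that by (intro divide_right_mono) (simp_all only: of_int_le_iff)
      finally show ?thesis by simp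
    qed
    have x: "(\<Sum>i<n. (x i)\<^sup>2) \<le> real n" and y: "(\<Sum>i<n. (y i)\<^sup>2) \<le> real n"
      unfolding x_def y_def using sq[OF z] sq[OF w] by simp_all
    define W where "W i = max \<bar>x i\<bar> \<bar>y i\<bar>" for i
    have W0: "W i \<ge> 0" for i unfolding W_def by simp
    have "(W i)\<^sup>2 \<le> (x i)\<^sup>2 + (y i)\<^sup>2" for i unfolding W_def max_def by simp
    then have "(\<Sum>i<n. (W i)\<^sup>2) \<le> (\<Sum>i<n. (x i)\<^sup>2 + (y i)\<^sup>2)" by (intro sum_mono)
    then have W2: "(\<Sum>i<n. (W i)\<^sup>2) \<le> 2 * n" using x y by (simp add: sum.distrib)
    have "\<bar>bil n (centered_entry E p) x y\<bar> \<le> \<bar>\<Sum>i<n. \<Sum>j<n. centered_entry E p i j * light d x y i j\<bar> + 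
        (\<Sum>i<n. \<Sum>j<n. if {i, j} \<in> E \<and> sqrt d < W i * W j then W i * W j else 0) + 
        (\<Sum>i<n. \<Sum>j<n. p * ((x i)\<^sup>2 * (y j)\<^sup>2 / sqrt d))"
    proof -
      have "bil n (centered_entry E p) x y = (\<Sum>i<n. \<Sum>j<n. centered_entry E p i j * light d x y i j) +
         (\<Sum>i<n. \<Sum>j<n. centered_entry E p i j * (x i * y j - light d x y i j))"
        unfolding bil_def by (simp add: sum.distrib[symmetric] algebra_simps)
      moreover have "\<bar>\<Sum>i<n. \<Sum>j<n. centered_entry E p i j * (x i * y j - light d x y i j)\<bar> \<le>
         (\<Sum>i<n. \<Sum>j<n. (if {i, j} \<in> E \<and> sqrt d < W i * W j then W i * W j else 0) + p * ((x i)\<^sup>2 * (y j)\<^sup>2 / sqrt d))"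
      proof (rule order.trans[OF sum_abs], rule sum_mono, rule order.trans[OF sum_abs], rule sum_mono)
        fix i j
        have W: "\<bar>x i * y j\<bar> \<le> W i * W j" unfolding abs_mult W_def by (intro mult_mono) auto
        have nn: "0 \<le> p * ((x i)\<^sup>2 * (y j)\<^sup>2 / sqrt d)" "0 \<le> W i * W j" using p d0 W0 by simp_all
        show "\<bar>centered_entry E p i j * (x i * y j - light d x y i j)\<bar> \<le>
          (if {i, j} \<in> E \<and> sqrt d < W i * W j then W i * W j else 0) + p * ((x i)\<^sup>2 * (y j)\<^sup>2 / sqrt d)"
        proof (cases "\<bar>x i * y j\<bar> \<le> sqrt d")
          case True
          then show ?thesis using nn by (simp add: light_def)
        next
          case False
          then have h: "light d x y i j = 0" "sqrt d < \<bar>x i * y j\<bar>" by (auto simp: light_def)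
          have "\<bar>x i * y j\<bar> * sqrt d \<le> \<bar>x i * y j\<bar> * \<bar>x i * y j\<bar>" using h by (intro mult_left_mono) auto
          also have "\<dots> = (x i)\<^sup>2 * (y j)\<^sup>2" by (simp add: power2_eq_square abs_mult_self_eq mult_ac)
          finally have q: "\<bar>x i * y j\<bar> \<le> (x i)\<^sup>2 * (y j)\<^sup>2 / sqrt d" using d0 by (simp add: field_simps)
          then have pq: "p * \<bar>x i * y j\<bar> \<le> p * ((x i)\<^sup>2 * (y j)\<^sup>2 / sqrt d)" using p by (intro mult_left_mono) auto
          have "\<bar>centered_entry E p i j\<bar> \<le> (if {i, j} \<in> E then 1 else 0) + p"
            unfolding centered_entry_def using p by auto
          then have "\<bar>centered_entry E p i j\<bar> * \<bar>x i * y j\<bar> \<le> ((if {i, j} \<in> E then 1 else 0) + p) * \<bar>x i * y j\<bar>"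
            by (intro mult_right_mono) auto
          also have "\<dots> = (if {i, j} \<in> E then \<bar>x i * y j\<bar> else 0) + p * \<bar>x i * y j\<bar>" by (simp add: algebra_simps)
          also have "(if {i, j} \<in> E then \<bar>x i * y j\<bar> else 0) \<le> (if {i, j} \<in> E \<and> sqrt d < W i * W j then W i * W j else 0)"
            using W h by auto
          finally have "\<bar>centered_entry E p i j\<bar> * \<bar>x i * y j\<bar> \<le>
            (if {i, j} \<in> E \<and> sqrt d < W i * W j then W i * W j else 0) + p * \<bar>x i * y j\<bar>" by simp
          then show ?thesis using pq unfolding h(1) diff_zero abs_mult[of "centered_entry E p i j"] by linarith
        qed
      qed
      ultimately show ?thesis by (simp add: sum.distrib)
    qed
    also have "(\<Sum>i<n. \<Sum>j<n. p * ((x i)\<^sup>2 * (y j)\<^sup>2 / sqrt d)) \<le> c2 * (sqrt d * n)"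
    proof -
      have "(\<Sum>i<n. \<Sum>j<n. p * ((x i)\<^sup>2 * (y j)\<^sup>2 / sqrt d)) = p / sqrt d * ((\<Sum>i<n. (x i)\<^sup>2) * (\<Sum>j<n. (y j)\<^sup>2))"
        unfolding sum_product by (simp add: sum_distrib_left)
      also have "\<dots> \<le> p / sqrt d * (real n * real n)"
        using x y p d0 by (intro mult_left_mono mult_mono) (auto intro: sum_nonneg)
      also have "\<dots> = (p * n) / sqrt d * n" by simp
      also have "\<dots> \<le> (c2 * d) / sqrt d * n" using p d0 by (intro mult_right_mono divide_right_mono) auto
      also have "\<dots> = c2 * (d / sqrt d) * n" by simp
      also have "d / sqrt d = sqrt d" using d by (simp add: real_div_sqrt)
      finally have "(\<Sum>i<n. \<Sum>j<n. p * ((x i)\<^sup>2 * (y j)\<^sup>2 / sqrt d)) \<le> c2 * sqrt d * n" .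
      then show ?thesis by (simp only: mult.assoc)
    qed
    also have "(\<Sum>i<n. \<Sum>j<n. if {i, j} \<in> E \<and> sqrt d < W i * W j then W i * W j else 0) \<le> (4 * c1 + 256 * c2 + 1152 * C) * (sqrt d * n)"
      by (rule heavy_pairs_bound[OF E n d deg disc P C W0 W2])
    also have "\<bar>\<Sum>i<n. \<Sum>j<n. centered_entry E p i j * light d x y i j\<bar> \<le> \<tau> * sqrt d * n"
      using lt[OF z w] unfolding x_def[abs_def] y_def[abs_def] .
    finally show ?thesis unfolding x_def[abs_def] y_def[abs_def] by (simp add: algebra_simps)
  qed
  have "\<bar>bil n (centered_entry E p) x y\<bar> \<le>
      2 * ((\<tau> + (4 * c1 + 257 * c2 + 1152 * C)) * sqrt d) * L2_set x {..<n} * L2_set y {..<n}"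
    by (rule bil_net_bound[OF net n])
  then show ?thesis unfolding centered_form_eq_bil by (simp only: mult.assoc)
qed

section \<open>Light pairs\<close>

lemma all_edges_doubleton: "{i, j} \<in> all_edges n \<longleftrightarrow> i < n \<and> j < n \<and> i \<noteq> j"
  unfolding all_edges_def by (cases "i = j") auto

lemma all_edgesE:
  assumes "e \<in> all_edges n"
  obtains i j where "e = {i, j}" "i < n" "j < n" "i \<noteq> j"
proof -
  obtain i j where "e = {i, j}" using assms unfolding all_edges_def by (auto simp: card_2_iff)
  then show ?thesis using that assms all_edges_doubleton by metis
qed

text \<open>Adds up the orientations of an edge, to turn double sums over vertices into the edge
  sums of the tail bounds.\<close>

definition edge_weight :: "nat \<Rightarrow> (nat \<Rightarrow> nat \<Rightarrow> real) \<Rightarrow> nat set \<Rightarrow> real" where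
  "edge_weight n g e = (\<Sum>x | x \<in> {..<n} \<times> {..<n} \<and> {fst x, snd x} = e. g (fst x) (snd x))"

lemma edge_weight_doubleton:
  assumes "i < n" "j < n" "i \<noteq> j"
  shows "edge_weight n g {i, j} = g i j + g j i"
proof -
  have "{x. x \<in> {..<n} \<times> {..<n} \<and> {fst x, snd x} = {i, j}} = {(i, j), (j, i)}"
    using assms by (auto simp: doubleton_eq_iff)
  then show ?thesis using assms by (simp add: edge_weight_def)
qed

lemma sum_pairs_eq_sum_edges:
  assumes "S \<subseteq> all_edges n"
  shows "(\<Sum>i<n. \<Sum>j<n. if {i, j} \<in> S then g i j else 0) = (\<Sum>e\<in>S. edge_weight n g e)"
proof -
  let ?X = "{x \<in> {..<n} \<times> {..<n}. {fst x, snd x} \<in> S}"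
  have fS: "finite S" using finite_subset[OF assms] by simp
  have "(\<Sum>i<n. \<Sum>j<n. if {i, j} \<in> S then g i j else 0) =
     (\<Sum>x\<in>{..<n} \<times> {..<n}. if {fst x, snd x} \<in> S then g (fst x) (snd x) else 0)"
    unfolding sum.cartesian_product by (intro sum.cong) auto
  also have "\<dots> = (\<Sum>x\<in>?X. g (fst x) (snd x))"
    by (rule sum.inter_filter[symmetric]) simp
  also have "\<dots> = (\<Sum>e\<in>S. \<Sum>x | x \<in> ?X \<and> {fst x, snd x} = e. g (fst x) (snd x))"
    by (rule sum.group[symmetric]) (use fS in auto)
  also have "\<dots> = (\<Sum>e\<in>S. edge_weight n g e)"
    unfolding edge_weight_def by (intro sum.cong) auto
  finally show ?thesis .
qed

lemma sum_centered_entry: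
  assumes "S \<subseteq> all_edges n"
  shows "(\<Sum>i<n. \<Sum>j<n. centered_entry S p i j * g i j) =
    (\<Sum>e\<in>S. edge_weight n g e) - p * (\<Sum>e\<in>all_edges n. edge_weight n g e)"
proof -
  have "(\<Sum>i<n. \<Sum>j<n. centered_entry S p i j * g i j) = (\<Sum>i<n. \<Sum>j<n. (if {i, j} \<in> S then g i j else 0)
     - p * (if {i, j} \<in> all_edges n then g i j else 0))"
    by (intro sum.cong) (auto simp: centered_entry_def all_edges_doubleton algebra_simps)
  also have "\<dots> = (\<Sum>i<n. \<Sum>j<n. if {i, j} \<in> S then g i j else 0) -
      p * (\<Sum>i<n. \<Sum>j<n. if {i, j} \<in> all_edges n then g i j else 0)"
    by (simp only: sum_subtractf sum_distrib_left)
  finally show ?thesis using assms by (simp only: sum_pairs_eq_sum_edges subset_refl)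
qed

text \<open>Lightness gives \<open>\<bar>w e\<bar> \<le> 2 * sqrt d\<close>, so
  \<open>l = 1 / (2 * sqrt d)\<close> is admissible in \<open>uniform_graph_bernstein\<close>. The
  sum of the squared edge weights is at most \<open>2 * n * n\<close>, so the quadratic term is at
  most \<open>c * n / 2\<close>, against a gain of \<open>\<tau> * n / 2\<close>. Both signs of
  \<open>w\<close> are needed for the absolute value.\<close>

lemma light_deviation_prob:
  fixes d c \<tau> :: real
  assumes m: "m \<le> n choose 2" and d: "d > 0" and pn: "m / (n choose 2) * n \<le> c * d"
    and x: "(\<Sum>i<n. (x i)\<^sup>2) \<le> real n" and y: "(\<Sum>i<n. (y i)\<^sup>2) \<le> real n"
  shows "gprob n m
     {S. \<tau> * sqrt d * n \<le> \<bar>\<Sum>i<n. \<Sum>j<n. centered_entry S (m / (n choose 2)) i j * light d x y i j\<bar>}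
     \<le> 2 * exp ((c - \<tau>) * n / 2)"
proof -
  define p where "p = m / (n choose 2)"
  define g where "g = light d x y"
  define w where "w = edge_weight n g"
  define l where "l = 1 / (2 * sqrt d)"
  have sd: "sqrt d > 0" using d by simp
  have p0: "p \<ge> 0" by (simp add: p_def)
  have l0: "l \<ge> 0" using sd by (simp add: l_def)
  have gb: "\<bar>g i j\<bar> \<le> sqrt d" "(g i j)\<^sup>2 \<le> (x i)\<^sup>2 * (y j)\<^sup>2" for i j
    using d unfolding g_def light_def by (auto simp: power_mult_distrib)
  have wb: "l * w e \<le> 1" "l * (- w e) \<le> 1" if mem: "e \<in> all_edges n" for e
  proof -
    obtain i j where e: "e = {i, j}" "i < n" "j < n" "i \<noteq> j" using mem by (rule all_edgesE)
    have "\<bar>w e\<bar> \<le> 2 * sqrt d" unfolding w_def e(1) edge_weight_doubleton[OF e(2-4)]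
      using gb(1)[of i j] gb(1)[of j i] by linarith
    then have "\<bar>l * w e\<bar> \<le> 1" unfolding l_def abs_mult using sd by (simp add: field_simps)
    then show "l * w e \<le> 1" "l * (- w e) \<le> 1" by simp_all
  qed
  have w2: "(\<Sum>e\<in>all_edges n. (w e)\<^sup>2) \<le> 2 * n * n"
  proof -
    have "(\<Sum>e\<in>all_edges n. (w e)\<^sup>2) \<le> (\<Sum>e\<in>all_edges n. edge_weight n (\<lambda>i j. 2 * (g i j)\<^sup>2) e)"
    proof (rule sum_mono)
      fix e assume "e \<in> all_edges n"
      then obtain i j where e: "e = {i, j}" "i < n" "j < n" "i \<noteq> j" using all_edgesE by metis
      have "(g i j + g j i)\<^sup>2 \<le> 2 * (g i j)\<^sup>2 + 2 * (g j i)\<^sup>2"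
        using zero_le_power2[of "g i j - g j i"] by (simp add: power2_eq_square algebra_simps)
      then show "(w e)\<^sup>2 \<le> edge_weight n (\<lambda>i j. 2 * (g i j)\<^sup>2) e"
        unfolding w_def e(1) edge_weight_doubleton[OF e(2-4)] .
    qed
    also have "\<dots> = (\<Sum>i<n. \<Sum>j<n. if {i, j} \<in> all_edges n then 2 * (g i j)\<^sup>2 else 0)"
      by (rule sum_pairs_eq_sum_edges[symmetric]) simp
    also have "\<dots> \<le> (\<Sum>i<n. \<Sum>j<n. 2 * ((x i)\<^sup>2 * (y j)\<^sup>2))"
      using gb(2) by (intro sum_mono) auto
    also have "\<dots> = 2 * ((\<Sum>i<n. (x i)\<^sup>2) * (\<Sum>j<n. (y j)\<^sup>2))" unfolding sum_product by (simp only: sum_distrib_left)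
    also have "\<dots> \<le> 2 * (real n * real n)"
      using x y by (intro mult_left_mono mult_mono) (auto intro: sum_nonneg)
    finally show ?thesis by simp
  qed
  have ex: "p * (l\<^sup>2 * (\<Sum>e\<in>all_edges n. (w e)\<^sup>2)) - l * (\<tau> * sqrt d * n) \<le> (c - \<tau>) * n / 2"
  proof -
    have "p * (l\<^sup>2 * (\<Sum>e\<in>all_edges n. (w e)\<^sup>2)) \<le> p * (l\<^sup>2 * (2 * n * n))"
      using w2 p0 by (intro mult_left_mono) auto
    also have "\<dots> = (p * n) * n / (2 * d)" using d by (simp add: l_def power_divide power_mult_distrib field_simps)
    also have "\<dots> \<le> (c * d) * n / (2 * d)" using pn d unfolding p_def by (intro divide_right_mono mult_right_mono) auto
    also have "\<dots> = c * n / 2" using d by simp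
    finally have "p * (l\<^sup>2 * (\<Sum>e\<in>all_edges n. (w e)\<^sup>2)) \<le> c * n / 2" .
    moreover have lt: "l * (\<tau> * sqrt d * n) = \<tau> * n / 2" using sd by (simp add: l_def)
    ultimately show ?thesis unfolding lt by (simp only: left_diff_distrib diff_divide_distrib)
  qed
  have one: "gprob n m {S. p * (\<Sum>e\<in>all_edges n. v e) + \<tau> * sqrt d * n \<le> (\<Sum>e\<in>S. v e)}
      \<le> exp ((c - \<tau>) * n / 2)"
    if v: "\<And>e. e \<in> all_edges n \<Longrightarrow> l * v e \<le> 1" "(\<Sum>e\<in>all_edges n. (v e)\<^sup>2) = (\<Sum>e\<in>all_edges n. (w e)\<^sup>2)" for v
  proof -
    have "gprob n m {S. p * (\<Sum>e\<in>all_edges n. v e) + \<tau> * sqrt d * n \<le> (\<Sum>e\<in>S. v e)} \<le>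
       exp (p * (l * (\<Sum>e\<in>all_edges n. v e) + l\<^sup>2 * (\<Sum>e\<in>all_edges n. (v e)\<^sup>2)) - l * (p * (\<Sum>e\<in>all_edges n. v e) + \<tau> * sqrt d * n))"
      unfolding p_def by (rule uniform_graph_bernstein[OF m l0 v(1)])
    also have "\<dots> = exp (p * (l\<^sup>2 * (\<Sum>e\<in>all_edges n. (w e)\<^sup>2)) - l * (\<tau> * sqrt d * n))"
      unfolding v(2) by (simp add: algebra_simps)
    also have "\<dots> \<le> exp ((c - \<tau>) * n / 2)" using ex by simp
    finally show ?thesis .
  qed
  have "gprob n m
     {S. \<tau> * sqrt d * n \<le> \<bar>\<Sum>i<n. \<Sum>j<n. centered_entry S p i j * g i j\<bar>} \<le>
     gprob n m {S. p * (\<Sum>e\<in>all_edges n. w e) + \<tau> * sqrt d * n \<le> (\<Sum>e\<in>S. w e) \<or>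
       p * (\<Sum>e\<in>all_edges n. - w e) + \<tau> * sqrt d * n \<le> (\<Sum>e\<in>S. - w e)}"
  proof (rule uniform_graph_prob_mono[OF m])
    fix S assume S: "S \<subseteq> all_edges n"
      and b: "\<tau> * sqrt d * n \<le> \<bar>\<Sum>i<n. \<Sum>j<n. centered_entry S p i j * g i j\<bar>"
    have "\<tau> * sqrt d * n \<le> \<bar>(\<Sum>e\<in>S. w e) - p * (\<Sum>e\<in>all_edges n. w e)\<bar>"
      using b S unfolding w_def by (simp add: sum_centered_entry)
    then show "p * (\<Sum>e\<in>all_edges n. w e) + \<tau> * sqrt d * n \<le> (\<Sum>e\<in>S. w e) \<or>
       p * (\<Sum>e\<in>all_edges n. - w e) + \<tau> * sqrt d * n \<le> (\<Sum>e\<in>S. - w e)"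
      unfolding sum_negf by (auto simp: abs_if split: if_splits)
  qed
  also have "\<dots> \<le> exp ((c - \<tau>) * n / 2) + exp ((c - \<tau>) * n / 2)"
    using wb by (intro prob_disj_le one) auto
  finally show ?thesis unfolding p_def g_def by simp
qed

text \<open>Integer vectors \<open>z\<close> such that \<open>z / 4\<close> lies in the ball of radius \<open>sqrt n\<close>.\<close>

definition int_net :: "nat \<Rightarrow> (nat \<Rightarrow> int) set" where
  "int_net n = {z \<in> {..<n} \<rightarrow>\<^sub>E UNIV. (\<Sum>i<n. (z i)\<^sup>2) \<le> 16 * int n}"

lemma sum_half_power_abs: "(\<Sum>k\<in>{- int K..int K}. (1 / 2 :: real) ^ nat \<bar>k\<bar>) = 3 - 2 / 2 ^ K"
proof (induction K)
  case (Suc K)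
  have "{- int (Suc K)..int (Suc K)} = insert (int (Suc K)) (insert (- int (Suc K)) {- int K..int K})" by auto
  then have "(\<Sum>k\<in>{- int (Suc K)..int (Suc K)}. (1 / 2 :: real) ^ nat \<bar>k\<bar>) =
     (1 / 2) ^ Suc K + (1 / 2) ^ Suc K + (\<Sum>k\<in>{- int K..int K}. (1 / 2 :: real) ^ nat \<bar>k\<bar>)"
    by (simp add: nat_add_distrib)
  then show ?case using Suc by (simp add: power_one_over field_simps)
qed simp

lemma abs_le_power2_int: "\<bar>a\<bar> \<le> (a :: int)\<^sup>2"
proof (cases "a = 0")
  case False
  then have "\<bar>a\<bar> * 1 \<le> \<bar>a\<bar> * \<bar>a\<bar>" by (intro mult_left_mono) auto
  then show ?thesis by (simp add: power2_eq_square)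
qed simp

text \<open>Give \<open>z\<close> the weight \<open>2 ^ (- \<Sum> \<bar>z i\<bar>)\<close>. Integers
  satisfy \<open>\<bar>z i\<bar> \<le> (z i)\<^sup>2\<close>, so every member of the net weighs at
  least \<open>2 ^ (- 16 * n)\<close>, while each coordinate contributes a factor below 4 to the
  total weight. This leaves at most \<open>2 ^ (18 * n)\<close> members.\<close>

lemma int_net_card: "finite (int_net n) \<and> real (card (int_net n)) \<le> exp (18 * n)"
proof -
  define R where "R = {- int (16 * n)..int (16 * n)}"
  let ?P = "{..<n} \<rightarrow>\<^sub>E R"
  have sub: "int_net n \<subseteq> ?P"
  proof
    fix z assume z: "z \<in> int_net n"
    have "z i \<in> R" if "i < n" for i
    proof -
      have "(z i)\<^sup>2 \<le> (\<Sum>i<n. (z i)\<^sup>2)" using that by (intro member_le_sum) auto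
      moreover have "\<bar>z i\<bar> \<le> (z i)\<^sup>2" by (rule abs_le_power2_int)
      moreover have "(\<Sum>i<n. (z i)\<^sup>2) \<le> 16 * int n" using z unfolding int_net_def by blast
      ultimately have "\<bar>z i\<bar> \<le> 16 * int n" by linarith
      then show ?thesis unfolding R_def by (simp add: abs_le_iff)
    qed
    then show "z \<in> ?P" using z unfolding int_net_def by (auto simp: PiE_iff)
  qed
  have finP: "finite ?P" unfolding R_def by (intro finite_PiE) auto
  then have fin: "finite (int_net n)" using sub finite_subset by blast
  have low: "1 \<le> 2 ^ (16 * n) * (\<Prod>i<n. (1 / 2 :: real) ^ nat \<bar>z i\<bar>)" if z: "z \<in> int_net n" for z
  proof -
    have "(\<Sum>i<n. nat \<bar>z i\<bar>) \<le> 16 * n"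
    proof -
      have "int (\<Sum>i<n. nat \<bar>z i\<bar>) \<le> (\<Sum>i<n. (z i)\<^sup>2)"
        unfolding of_nat_sum
      proof (rule sum_mono)
        fix i
        show "int (nat \<bar>z i\<bar>) \<le> (z i)\<^sup>2" using abs_le_power2_int[of "z i"] by simp
      qed
      also have "\<dots> \<le> int (16 * n)" using z unfolding int_net_def by simp
      finally show ?thesis by (simp only: of_nat_le_iff)
    qed
    then have "(2 :: real) ^ (\<Sum>i<n. nat \<bar>z i\<bar>) \<le> 2 ^ (16 * n)" by (intro power_increasing) auto
    then have "(2 :: real) ^ (\<Sum>i<n. nat \<bar>z i\<bar>) * (1 / 2 ^ (\<Sum>i<n. nat \<bar>z i\<bar>)) \<le>
        2 ^ (16 * n) * (1 / 2 ^ (\<Sum>i<n. nat \<bar>z i\<bar>))" by (rule mult_right_mono) simp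
    moreover have "(\<Prod>i<n. (1 / 2 :: real) ^ nat \<bar>z i\<bar>) = 1 / 2 ^ (\<Sum>i<n. nat \<bar>z i\<bar>)"
      by (simp add: power_sum power_one_over prod_dividef)
    ultimately show ?thesis by simp
  qed
  have "real (card (int_net n)) = (\<Sum>z\<in>int_net n. 1)" by simp
  also have "\<dots> \<le> (\<Sum>z\<in>int_net n. 2 ^ (16 * n) * (\<Prod>i<n. (1 / 2 :: real) ^ nat \<bar>z i\<bar>))"
    using low by (rule sum_mono)
  also have "\<dots> \<le> (\<Sum>z\<in>?P. 2 ^ (16 * n) * (\<Prod>i<n. (1 / 2 :: real) ^ nat \<bar>z i\<bar>))"
    using sub finP by (intro sum_mono2) (auto intro!: mult_nonneg_nonneg prod_nonneg)
  also have "\<dots> = 2 ^ (16 * n) * (\<Prod>i<n. \<Sum>k\<in>R. (1 / 2 :: real) ^ nat \<bar>k\<bar>)"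
    unfolding sum_distrib_left[symmetric] by (subst prod_sum_PiE) (auto simp: R_def)
  also have "\<dots> \<le> 2 ^ (16 * n) * (\<Prod>i<n. 4)"
  proof -
    have "(\<Sum>k\<in>R. (1 / 2 :: real) ^ nat \<bar>k\<bar>) \<le> 4" "0 \<le> (\<Sum>k\<in>R. (1 / 2 :: real) ^ nat \<bar>k\<bar>)"
      unfolding R_def sum_half_power_abs using one_le_power[of "2::real" "16 * n"]
      by (auto simp: field_simps intro: order_trans[of 2 3])
    then show ?thesis by (intro mult_left_mono prod_mono) auto
  qed
  also have "\<dots> = 2 ^ (18 * n)"
  proof -
    have "(4::real) ^ n = 2 ^ (2 * n)" by (simp add: power_mult)
    then show ?thesis by (simp add: power_add[symmetric])
  qed
  also have "\<dots> \<le> exp 1 ^ (18 * n)" using exp_ge_add_one_self[of 1] by (intro power_mono) auto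
  also have "\<dots> = exp (18 * n)" by (simp add: exp_of_nat_mult[symmetric])
  finally show ?thesis using fin by simp
qed

section \<open>Union bound over the net\<close>

definition light_bad :: "nat \<Rightarrow> nat set set \<Rightarrow> real \<Rightarrow> real \<Rightarrow> real \<Rightarrow> bool" where
  "light_bad n E p d \<tau> \<longleftrightarrow> (\<exists>zw\<in>int_net n \<times> int_net n.
    \<tau> * sqrt d * n \<le> \<bar>\<Sum>i<n. \<Sum>j<n. centered_entry E p i j * light d (\<lambda>i. real_of_int (fst zw i) / 4) (\<lambda>i. real_of_int (snd zw i) / 4) i j\<bar>)"

lemma not_light_bad:
  assumes nb: "\<not> light_bad n E p d \<tau>"
    and z: "(\<Sum>i<n. (z i)\<^sup>2) \<le> 16 * int n" and w: "(\<Sum>i<n. (w i)\<^sup>2) \<le> 16 * int n"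
  shows "\<bar>\<Sum>i<n. \<Sum>j<n. centered_entry E p i j * light d (\<lambda>i. z i / 4) (\<lambda>i. w i / 4) i j\<bar> \<le> \<tau> * sqrt d * n"
proof -
  \<comment> \<open>Members of \<open>int_net\<close> are extensional; restricting changes no
    coordinate below \<open>n\<close>.\<close>
  let ?z = "restrict z {..<n}" and ?w = "restrict w {..<n}"
  have "(?z, ?w) \<in> int_net n \<times> int_net n" using z w unfolding int_net_def by (auto intro!: sum.cong)
  then have "\<not> \<tau> * sqrt d * n \<le> \<bar>\<Sum>i<n. \<Sum>j<n. centered_entry E p i j * light d (\<lambda>i. ?z i / 4) (\<lambda>i. ?w i / 4) i j\<bar>"
    using nb unfolding light_bad_def by fastforce
  also have "(\<Sum>i<n. \<Sum>j<n. centered_entry E p i j * light d (\<lambda>i. ?z i / 4) (\<lambda>i. ?w i / 4) i j) =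
     (\<Sum>i<n. \<Sum>j<n. centered_entry E p i j * light d (\<lambda>i. z i / 4) (\<lambda>i. w i / 4) i j)"
    by (intro sum.cong refl) (simp add: light_def)
  finally show ?thesis by simp
qed

text \<open>Two copies of the net cost \<open>exp (36 * n)\<close>, and a deviation exceeding
  \<open>c\<close> by 74 gains \<open>exp (- 37 * n)\<close>. The remaining \<open>exp (- n)\<close>
  is small enough for a union over all times of the window.\<close>

lemma light_bad_prob:
  fixes d c :: real
  assumes m: "m \<le> n choose 2" and d: "d > 0" and pn: "m / (n choose 2) * n \<le> c * d"
  shows "gprob n m {S. light_bad n S (m / (n choose 2)) d (c + 74)} \<le> 2 * exp (- real n)"
proof -
  have fin: "finite (int_net n \<times> int_net n)" using int_net_card by blast
  have sq: "(\<Sum>i<n. (real_of_int (f i) / 4)\<^sup>2) \<le> real n" if "f \<in> int_net n" for f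
  proof -
    have "(\<Sum>i<n. (real_of_int (f i) / 4)\<^sup>2) = real_of_int (\<Sum>i<n. (f i)\<^sup>2) / 16"
      by (simp add: power_divide sum_divide_distrib)
    also have "\<dots> \<le> real_of_int (16 * int n) / 16"
      using that unfolding int_net_def by (intro divide_right_mono) (simp_all only: of_int_le_iff mem_Collect_eq)
    finally show ?thesis by simp
  qed
  define Q where "Q zw S \<longleftrightarrow> (c + 74) * sqrt d * n \<le>
      \<bar>\<Sum>i<n. \<Sum>j<n. centered_entry S (m / (n choose 2)) i j *
        light d (\<lambda>i. real_of_int (fst zw i) / 4) (\<lambda>i. real_of_int (snd zw i) / 4) i j\<bar>" for zw S
  have Q: "gprob n m {S. Q zw S} \<le> 2 * exp ((c - (c + 74)) * n / 2)"
    if "zw \<in> int_net n \<times> int_net n" for zw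
  proof -
    have zw: "fst zw \<in> int_net n" "snd zw \<in> int_net n" using that by auto
    show ?thesis unfolding Q_def by (rule light_deviation_prob[OF m d pn sq[OF zw(1)] sq[OF zw(2)]])
  qed
  have "gprob n m {S. light_bad n S (m / (n choose 2)) d (c + 74)}
     = gprob n m {S. \<exists>zw\<in>int_net n \<times> int_net n. Q zw S}"
    unfolding light_bad_def Q_def ..
  also have "\<dots> \<le> card (int_net n \<times> int_net n) * (2 * exp ((c - (c + 74)) * n / 2))"
    using prob_exists_le_const[OF fin Q] .
  also have "\<dots> \<le> (exp (18 * n) * exp (18 * n)) * (2 * exp ((c - (c + 74)) * n / 2))"
    unfolding card_cartesian_product of_nat_mult using int_net_card
    by (intro mult_right_mono mult_mono) auto
  also have "\<dots> = 2 * exp (- real n)" by (simp add: exp_add[symmetric] field_simps)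
  finally show ?thesis .
qed

section \<open>Discrepancy, maximum degree and connectivity\<close>

definition edges_between :: "nat \<Rightarrow> nat set \<Rightarrow> nat set \<Rightarrow> nat set set" where
  "edges_between n S T = {e \<in> all_edges n. \<exists>i\<in>S. \<exists>j\<in>T. e = {i, j}}"

lemma edges_between_subset: "edges_between n S T \<subseteq> all_edges n"
  unfolding edges_between_def by auto

lemma card_edges_between_le:
  assumes "finite S" "finite T"
  shows "card (edges_between n S T) \<le> card S * card T"
proof -
  have "edges_between n S T \<subseteq> (\<lambda>(i, j). {i, j}) ` (S \<times> T)" unfolding edges_between_def by auto
  then have "card (edges_between n S T) \<le> card ((\<lambda>(i, j). {i, j}) ` (S \<times> T))"
    using assms by (intro card_mono) auto
  also have "\<dots> \<le> card (S \<times> T)" using assms by (intro card_image_le) auto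
  finally show ?thesis by (simp add: card_cartesian_product)
qed

lemma edge_pairs_le:
  assumes E: "E \<subseteq> all_edges n" and fin: "finite S" "finite T"
  shows "edge_pairs E S T \<le> 2 * card (E \<inter> edges_between n S T)"
proof -
  let ?X = "{x \<in> S \<times> T. {fst x, snd x} \<in> E}" and ?F = "E \<inter> edges_between n S T"
  have finF: "finite ?F" using finite_subset[OF E] by simp
  have finX: "finite ?X" using fin by simp
  have "card ?X = (\<Sum>e\<in>?F. card {x \<in> ?X. {fst x, snd x} = e})"
  proof -
    have img: "(\<lambda>x. {fst x, snd x}) ` ?X \<subseteq> ?F"
    proof (rule image_subsetI)
      fix x assume "x \<in> ?X"
      then have "fst x \<in> S" "snd x \<in> T" "{fst x, snd x} \<in> E" by auto
      then show "{fst x, snd x} \<in> ?F" using E unfolding edges_between_def by blast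
    qed
    have "(\<Sum>x\<in>?X. 1) = (\<Sum>e\<in>?F. \<Sum>x | x \<in> ?X \<and> {fst x, snd x} = e. (1::nat))"
      by (rule sum.group[symmetric, OF finX finF img])
    then show ?thesis by simp
  qed
  also have "\<dots> \<le> (\<Sum>e\<in>?F. 2)"
  proof (rule sum_mono)
    fix e assume "e \<in> ?F"
    then have "e \<in> all_edges n" using E by blast
    then obtain i j where e: "e = {i, j}" by (rule all_edgesE)
    have "{x \<in> ?X. {fst x, snd x} = e} \<subseteq> set [(i, j), (j, i)]"
    proof
      fix x assume "x \<in> {x \<in> ?X. {fst x, snd x} = e}"
      then have "{fst x, snd x} = {i, j}" unfolding e by simp
      then show "x \<in> set [(i, j), (j, i)]" by (cases x) (simp add: doubleton_eq_iff)
    qed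
    then have "card {x \<in> ?X. {fst x, snd x} = e} \<le> card (set [(i, j), (j, i)])" by (rule card_mono[rotated]) simp
    also have "\<dots> \<le> length [(i, j), (j, i)]" by (rule card_length)
    finally show "card {x \<in> ?X. {fst x, snd x} = e} \<le> 2" by simp
  qed
  finally show ?thesis unfolding edge_pairs_def by simp
qed

lemma sum_Pow_power_card:
  assumes "finite A"
  shows "(\<Sum>S\<in>Pow A. (x::real) ^ card S) = (1 + x) ^ card A"
  using assms
proof (induction A rule: finite_induct)
  case (insert a A)
  have "(\<Sum>S\<in>Pow (insert a A). x ^ card S) = (\<Sum>S\<in>Pow A. x ^ card S) + (\<Sum>S\<in>insert a ` Pow A. x ^ card S)"
    unfolding Pow_insert using insert.hyps by (intro sum.union_disjoint) auto
  also have "(\<Sum>S\<in>insert a ` Pow A. x ^ card S) = (\<Sum>S\<in>Pow A. x * x ^ card S)"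
  proof (subst sum.reindex)
    show "inj_on (insert a) (Pow A)"
      using insert.hyps(2) by (intro inj_onI) (metis PowD insert_ident subsetD)
    show "sum ((\<lambda>S. x ^ card S) \<circ> insert a) (Pow A) = (\<Sum>S\<in>Pow A. x * x ^ card S)"
    proof (rule sum.cong)
      fix S assume "S \<in> Pow A"
      then have "finite S" "a \<notin> S" using insert.hyps finite_subset by auto
      then show "((\<lambda>S. x ^ card S) \<circ> insert a) S = x * x ^ card S" by simp
    qed simp
  qed
  also have "\<dots> = x * (\<Sum>S\<in>Pow A. x ^ card S)" by (simp add: sum_distrib_left)
  finally show ?case using insert by (simp add: algebra_simps)
qed simp

text \<open>Weigh each subset by \<open>x ^ card S\<close> with \<open>x = t / n\<close>. All
  subsets together weigh \<open>(1 + x) ^ n \<le> exp t\<close>, and those counted weigh at least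
  \<open>x ^ t\<close> each.\<close>

lemma card_small_subsets_le:
  fixes n t :: nat
  assumes t: "1 \<le> t" "t \<le> n"
  shows "real (card {S. S \<subseteq> {..<n} \<and> card S \<le> t}) \<le> exp (t * ln (exp 1 * n / t))"
proof -
  let ?x = "real t / real n"
  let ?A = "{S. S \<subseteq> {..<n} \<and> card S \<le> t}"
  have n: "n \<ge> 1" using t by simp
  have x: "0 < ?x" "?x \<le> 1" using t n by auto
  have "?x ^ t * card ?A = (\<Sum>S\<in>?A. ?x ^ t)" by (simp add: mult.commute)
  also have "\<dots> \<le> (\<Sum>S\<in>?A. ?x ^ card S)"
    using x by (intro sum_mono power_decreasing) auto
  also have "\<dots> \<le> (\<Sum>S\<in>Pow {..<n}. ?x ^ card S)" using x by (intro sum_mono2) auto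
  also have "\<dots> = (1 + ?x) ^ n" using sum_Pow_power_card[of "{..<n}" ?x] by simp
  also have "\<dots> \<le> exp ?x ^ n" using x by (intro power_mono exp_ge_add_one_self) auto
  also have "\<dots> = exp t" using n by (simp add: exp_of_nat_mult[symmetric])
  finally have "real (card ?A) * ?x ^ t \<le> exp t" by (simp only: mult.commute)
  then have "real (card ?A) \<le> exp t / ?x ^ t"
    by (rule mult_imp_le_div_pos[OF zero_less_power[OF x(1)]])
  also have "\<dots> = (exp 1 * n / t) ^ t"
    using t n exp_of_nat_mult[of t "1::real"] by (simp add: power_divide power_mult_distrib field_simps)
  also have "\<dots> = exp (t * ln (exp 1 * n / t))"
    using t n by (simp add: exp_of_nat_mult)
  finally show ?thesis .
qed

text \<open>The case \<open>t = 1\<close> is the worst: the difference of the two sides is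
  \<open>(t - 1) * (ln n - ln t) + (t - 1 - ln t)\<close>. This converts factors
  \<open>exp (- l)\<close> into powers of \<open>n\<close>.\<close>

lemma t_ln_ge:
  fixes n t :: nat
  assumes t: "1 \<le> t" "t \<le> n"
  shows "t * ln (exp 1 * n / t) \<ge> 1 + ln n"
proof -
  have n: "n \<ge> 1" using t by simp
  have e: "ln (exp 1 * n / t) = 1 + ln n - ln t" using t n by (simp add: ln_mult ln_div)
  have 1: "ln t \<le> real t - 1" using t by (intro ln_le_minus_one) simp
  have "ln t \<le> ln n" using t by simp
  then have "(real t - 1) * ln t \<le> (real t - 1) * ln n" using t by (intro mult_left_mono) auto
  then show ?thesis unfolding e using 1 by (simp add: algebra_simps)
qed

text \<open>\<open>uniform_graph_many\<close> with \<open>r = 2 ^ (k + 2)\<close>. The factors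
  \<open>2 * p\<close> and 24 are doubled because an edge yields at most two ordered pairs. Of the
  two summands of \<open>q\<close>, the first absorbs the mean because \<open>ln r \<ge> 1\<close>,
  and the second gains \<open>6 * l\<close> because \<open>ln r \<ge> (k + 1) / 2\<close>. In the
  union bound, \<open>2 * l\<close> of this pays for the choice of \<open>S\<close> and
  \<open>T\<close>.\<close>

lemma discrepancy_pair_prob:
  fixes n m t k :: nat and p :: real
  assumes m: "m \<le> n choose 2" and t: "1 \<le> t" "t \<le> n"
    and ST: "finite S" "finite T"
  defines "p \<equiv> m / (n choose 2)"
  shows "gprob n m {E. 2 ^ (k + 2) * (2 * p) * real (card S) * real (card T) +
      24 * real t * ln (exp 1 * real n / real t) / (real k + 1) < real (edge_pairs E S T)} \<le> exp (- (6 * (t * ln (exp 1 * n / t))))"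
proof -
  define l where "l = t * ln (exp 1 * n / t)"
  define r :: real where "r = 2 ^ (k + 2)"
  have "0 \<le> ln (real n)" using t by simp
  then have l0: "l \<ge> 0" using t_ln_ge[OF t] unfolding l_def by linarith
  have r1: "r \<ge> 1" unfolding r_def by (rule one_le_power) simp
  have p0: "p \<ge> 0" by (simp add: p_def)
  have l2: "ln (2::real) \<ge> 1 / 2" using ln2_ge_two_thirds by linarith
  have lnr: "ln r = real (k + 2) * ln 2" unfolding r_def by (subst ln_realpow) auto
  have lnr1: "ln r \<ge> 1" "ln r \<ge> (real k + 1) / 2"
  proof -
    have "real (k + 2) * (1 / 2) \<le> ln r" unfolding lnr by (rule mult_left_mono[OF l2]) simp
    then show "ln r \<ge> 1" "ln r \<ge> (real k + 1) / 2" by simp_all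
  qed
  define F where "F = edges_between n S T"
  define q where "q = r * p * (card S * card T) + 12 * l / (real k + 1)"
  have cF: "real (card F) \<le> card S * card T"
    unfolding F_def using card_edges_between_le[OF ST] by (simp only: of_nat_mult[symmetric] of_nat_le_iff)
  have "gprob n m {E. 2 ^ (k + 2) * (2 * p) * real (card S) * real (card T) +
      24 * real t * ln (exp 1 * real n / real t) / (real k + 1) < real (edge_pairs E S T)} \<le>
      gprob n m {E. q \<le> real (card (E \<inter> F))}"
  proof (rule uniform_graph_prob_mono[OF m])
    fix E assume E: "E \<subseteq> all_edges n" and b: "2 ^ (k + 2) * (2 * p) * real (card S) * real (card T) +
      24 * real t * ln (exp 1 * real n / real t) / (real k + 1) < edge_pairs E S T"
    have "real (edge_pairs E S T) \<le> real (2 * card (E \<inter> F))"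
      using edge_pairs_le[OF E ST] unfolding F_def by (simp only: of_nat_le_iff)
    moreover have "2 * q = 2 ^ (k + 2) * (2 * p) * real (card S) * real (card T) + 24 * real t * ln (exp 1 * real n / real t) / (real k + 1)"
      unfolding q_def r_def l_def by (simp add: algebra_simps)
    ultimately show "q \<le> real (card (E \<inter> F))" using b by simp
  qed
  also have "\<dots> \<le> exp (r * p * card F - ln r * q)"
    unfolding p_def by (rule uniform_graph_many[OF m _ r1]) (simp add: F_def edges_between_subset)
  also have "\<dots> \<le> exp (- (6 * l))"
  proof -
    have "r * p * card F \<le> r * p * (card S * card T)"
      using cF r1 p0 by (intro mult_left_mono) auto
    also have "\<dots> = 1 * (r * p * (card S * card T))" by simp
    also have "\<dots> \<le> ln r * (r * p * (card S * card T))"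
      using lnr1 r1 p0 by (intro mult_right_mono) auto
    finally have 1: "r * p * card F \<le> ln r * (r * p * (card S * card T))" .
    have "(real k + 1) / 2 * (12 * l / (real k + 1)) \<le> ln r * (12 * l / (real k + 1))"
      using lnr1 l0 by (intro mult_right_mono) auto
    moreover have "(real k + 1) / 2 * (12 * l / (real k + 1)) = 6 * l" by (simp add: field_simps)
    ultimately show ?thesis using 1 unfolding q_def distrib_left by simp
  qed
  finally show ?thesis unfolding l_def .
qed

text \<open>After the union over \<open>S\<close> and \<open>T\<close> there remains
  \<open>exp (- 4 * l) \<le> 1 / n ^ 4\<close>, which covers the \<open>n * (2 * n + 3)\<close>
  choices of \<open>t\<close> and \<open>k\<close>.\<close>

lemma not_discrepancy_prob:
  fixes n m :: nat and p :: real
  assumes m: "m \<le> n choose 2" and n: "n \<ge> 1"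
  defines "p \<equiv> m / (n choose 2)"
  shows "gprob n m {E. \<not> discrepancy n E (2 * p) 24}
    \<le> real n * (2 * real n + 3) / real n ^ 4"
proof -
  define U where "U t = {S. S \<subseteq> {..<n} \<and> card S \<le> t}" for t
  have fU: "finite (U t)" for t unfolding U_def by (rule finite_subset[of _ "Pow {..<n}"]) auto
  define Q where "Q t k x E \<longleftrightarrow> 2 ^ (k + 2) * (2 * p) * real (card (fst x)) * real (card (snd x)) +
      24 * real t * ln (exp 1 * real n / real t) / (real k + 1) < edge_pairs E (fst x) (snd x)" for t k x E
  have inner: "gprob n m {E. \<exists>x\<in>U t \<times> U t. Q t k x E} \<le> 1 / real n ^ 4"
    if t: "t \<in> {1..n}" for t k
  proof -
    define l where "l = t * ln (exp 1 * n / t)"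
    have l: "l \<ge> 1 + ln n" using t_ln_ge[of t n] t unfolding l_def by simp
    have "gprob n m {E. \<exists>x\<in>U t \<times> U t. Q t k x E} \<le> real (card (U t \<times> U t)) * exp (- (6 * l))"
    proof (rule prob_exists_le_const)
      show "finite (U t \<times> U t)" using fU by simp
      fix x assume x: "x \<in> U t \<times> U t"
      have fin: "finite (fst x)" "finite (snd x)"
      proof -
        have "fst x \<subseteq> {..<n}" "snd x \<subseteq> {..<n}" using x unfolding U_def by auto
        then show "finite (fst x)" "finite (snd x)" by (simp_all add: finite_subset[OF _ finite_lessThan[of n]])
      qed
      have t': "1 \<le> t" "t \<le> n" using t by auto
      show "gprob n m {E. Q t k x E} \<le> exp (- (6 * l))"
        unfolding Q_def l_def p_def by (rule discrepancy_pair_prob[OF m t' fin])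
    qed
    also have "\<dots> \<le> (exp l * exp l) * exp (- (6 * l))"
    proof -
      have "real (card (U t)) \<le> exp l" unfolding U_def l_def using t by (intro card_small_subsets_le) auto
      then show ?thesis unfolding card_cartesian_product of_nat_mult by (intro mult_right_mono mult_mono) auto
    qed
    also have "\<dots> = exp (- (4 * l))" by (simp add: exp_add[symmetric])
    also have "\<dots> \<le> exp (- (4 * ln n))" using l by simp
    also have "\<dots> = 1 / real n ^ 4" using n exp_of_nat_mult[of 4 "ln (real n)"] by (simp add: exp_minus field_simps)
    finally show ?thesis .
  qed
  have "gprob n m {E. \<not> discrepancy n E (2 * p) 24} \<le>
    gprob n m {E. \<exists>tk\<in>{1..n} \<times> {..2 * n + 2}. \<exists>x\<in>U (fst tk) \<times> U (fst tk). Q (fst tk) (snd tk) x E}"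
  proof (rule uniform_graph_prob_mono[OF m])
    fix E assume "\<not> discrepancy n E (2 * p) 24"
    then obtain S T t k where "S \<subseteq> {..<n}" "T \<subseteq> {..<n}" "1 \<le> t" "t \<le> n" "card S \<le> t" "card T \<le> t" "k \<le> 2 * n + 2"
      "\<not> real (edge_pairs E S T) \<le> 2 ^ (k + 2) * (2 * p) * real (card S) * real (card T) +
       24 * real t * ln (exp 1 * real n / real t) / (real k + 1)"
      unfolding discrepancy_def by blast
    then show "\<exists>tk\<in>{1..n} \<times> {..2 * n + 2}. \<exists>x\<in>U (fst tk) \<times> U (fst tk). Q (fst tk) (snd tk) x E"
      unfolding Q_def U_def by (intro bexI[of _ "(t, k)"] bexI[of _ "(S, T)"]) auto
  qed
  also have "\<dots> \<le> real (card ({1..n} \<times> {..2 * n + 2})) * (1 / real n ^ 4)"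
    by (rule prob_exists_le_const) (use inner in auto)
  also have "\<dots> = real n * (2 * real n + 3) / real n ^ 4" by (simp add: card_cartesian_product field_simps)
  finally show ?thesis .
qed

section \<open>Maximum degree\<close>

definition star :: "nat \<Rightarrow> nat \<Rightarrow> nat set set" where
  "star n v = {e \<in> all_edges n. v \<in> e}"

lemma star_subset: "star n v \<subseteq> all_edges n" unfolding star_def by auto

lemma card_star:
  assumes "v < n"
  shows "card (star n v) = n - 1"
proof -
  have "degree_of (all_edges n) v = card {w. w < n \<and> {v, w} \<in> all_edges n}"
    by (rule degree_of_eq_card_neighbours) simp
  also have "{w. w < n \<and> {v, w} \<in> all_edges n} = {..<n} - {v}"
    using assms by (auto simp: all_edges_doubleton)
  finally show ?thesis using assms unfolding degree_of_def star_def by simp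
qed

lemma degree_of_eq_star:
  assumes "E \<subseteq> all_edges n"
  shows "degree_of E v = card (E \<inter> star n v)"
proof -
  have "{e \<in> E. v \<in> e} = E \<inter> star n v" using assms unfolding star_def by auto
  then show ?thesis unfolding degree_of_def by simp
qed

text \<open>\<open>uniform_graph_many\<close> with \<open>r = exp 1 \<le> 3\<close>: the mean term
  is at most \<open>18 * ln n\<close>, so the threshold \<open>20 * ln n\<close> leaves
  \<open>1 / n ^ 2\<close> per vertex.\<close>

lemma max_degree_prob:
  assumes m: "m \<le> n choose 2" and n: "n \<ge> 1" and pn: "m / (n choose 2) * (real n - 1) \<le> 6 * ln n"
  shows "gprob n m {E. \<exists>v\<in>{..<n}. 20 * ln n \<le> real (degree_of E v)} \<le> n * (1 / real n ^ 2)"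
proof -
  have "gprob n m {E. \<exists>v\<in>{..<n}. 20 * ln n \<le> real (degree_of E v)} \<le>
     real (card {..<n}) * (1 / real n ^ 2)"
  proof (rule prob_exists_le_const)
    fix v assume v: "v \<in> {..<n}"
    have "gprob n m {E. 20 * ln n \<le> real (degree_of E v)} \<le>
       gprob n m {E. 20 * ln n \<le> real (card (E \<inter> star n v))}"
      by (rule uniform_graph_prob_mono[OF m]) (simp add: degree_of_eq_star)
    also have "\<dots> \<le> exp (exp 1 * (m / (n choose 2)) * card (star n v) - ln (exp 1) * (20 * ln n))"
      by (rule uniform_graph_many[OF m star_subset]) (use exp_ge_add_one_self[of "1::real"] in simp)
    also have "\<dots> \<le> exp (- (2 * ln n))"
    proof -
      have 1: "m / (n choose 2) * card (star n v) \<le> 6 * ln n"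
        using pn card_star[of v n] v n by (simp add: of_nat_diff)
      have "exp 1 * (m / (n choose 2) * card (star n v)) \<le> 3 * (6 * ln n)"
        by (rule mult_mono[OF exp_le 1]) auto
      then show ?thesis by (simp add: mult.assoc)
    qed
    also have "\<dots> = 1 / real n ^ 2" using n exp_of_nat_mult[of 2 "ln (real n)"] by (simp add: exp_minus field_simps)
    finally show "gprob n m {E. 20 * ln n \<le> real (degree_of E v)} \<le> 1 / real n ^ 2" .
  qed simp
  then show ?thesis by simp
qed

section \<open>Connectivity through empty cuts\<close>

lemma card_edges_between_disjoint:
  assumes "W \<subseteq> {..<n}" "T \<subseteq> {..<n}" "W \<inter> T = {}"
  shows "card (edges_between n W T) = card W * card T"
proof -
  have "edges_between n W T = (\<lambda>(i, j). {i, j}) ` (W \<times> T)"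
  proof (intro equalityI subsetI)
    fix e assume "e \<in> (\<lambda>(i, j). {i, j}) ` (W \<times> T)"
    then obtain i j where e: "e = {i, j}" "i \<in> W" "j \<in> T" by auto
    then have "i < n" "j < n" "i \<noteq> j" using assms by auto
    then show "e \<in> edges_between n W T" using e unfolding edges_between_def by (auto simp: all_edges_doubleton)
  qed (auto simp: edges_between_def)
  moreover have "inj_on (\<lambda>(i, j). {i, j}) (W \<times> T)"
    using assms(3) by (intro inj_onI) (auto simp: doubleton_eq_iff)
  ultimately show ?thesis by (simp add: card_image card_cartesian_product)
qed

lemma card_edges_between_compl:
  assumes "T \<subseteq> {..<n}"
  shows "card (edges_between n T ({..<n} - T)) = card T * (n - card T)"
proof -
  have "finite T" using assms finite_subset by blast
  then have "card ({..<n} - T) = n - card T" using assms by (simp add: card_Diff_subset)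
  moreover have "card (edges_between n T ({..<n} - T)) = card T * card ({..<n} - T)"
    using assms by (intro card_edges_between_disjoint) auto
  ultimately show ?thesis by simp
qed

text \<open>The set reachable from a vertex \<open>u\<close> and its complement both have an empty
  boundary; one of them has at most half of the vertices.\<close>

lemma not_connected_cut:
  assumes E: "E \<subseteq> all_edges n" and nc: "\<not> graph_connected n E"
  shows "\<exists>T\<subseteq>{..<n}. T \<noteq> {} \<and> 2 * card T \<le> n \<and> E \<inter> edges_between n T ({..<n} - T) = {}"
proof -
  define R where "R = {(x, y). {x, y} \<in> E}\<^sup>*"
  obtain u v where uv: "u < n" "v < n" "(u, v) \<notin> R" using nc unfolding graph_connected_def R_def by blast
  define T where "T = {w. w < n \<and> (u, w) \<in> R}"
  have T: "T \<subseteq> {..<n}" "u \<in> T" "v \<notin> T" using uv unfolding T_def R_def by auto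
  have closed: "j \<in> T" if "i \<in> T" "{i, j} \<in> E" for i j
  proof -
    have "j < n" using subsetD[OF E that(2)] by (simp add: all_edges_doubleton)
    have "(u, i) \<in> R" "(i, j) \<in> {(x, y). {x, y} \<in> E}" using that unfolding T_def by simp_all
    then have "(u, j) \<in> R" unfolding R_def by (rule rtrancl_into_rtrancl)
    with \<open>j < n\<close> show ?thesis unfolding T_def by simp
  qed
  have fT: "finite T" using T(1) finite_subset by blast
  have c1: "E \<inter> edges_between n T ({..<n} - T) = {}"
    using closed unfolding edges_between_def by blast
  have c2: "E \<inter> edges_between n ({..<n} - T) ({..<n} - ({..<n} - T)) = {}"
  proof (rule equals0I)
    fix e assume "e \<in> E \<inter> edges_between n ({..<n} - T) ({..<n} - ({..<n} - T))"
    then obtain i j where "e = {i, j}" "e \<in> E" "i \<notin> T" "j \<in> T" unfolding edges_between_def by blast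
    then show False using closed[of j i] by (simp add: insert_commute)
  qed
  show ?thesis
  proof (cases "2 * card T \<le> n")
    case True
    then show ?thesis using T c1 by blast
  next
    case False
    have "card ({..<n} - T) = n - card T" using T(1) fT by (simp add: card_Diff_subset)
    then have "2 * card ({..<n} - T) \<le> n" using False by linarith
    moreover have "{..<n} - T \<noteq> {}" using T uv by blast
    ultimately show ?thesis using c2 by (intro exI[of _ "{..<n} - T"]) blast
  qed
qed

text \<open>For \<open>card T \<le> n / 2\<close> the cut has at least \<open>card T * n / 2\<close>
  potential edges, so it is empty with probability at most \<open>(1 / n ^ 2) ^ card T\<close>. The
  binomial theorem sums this over all nonempty \<open>T\<close>.\<close>

lemma not_connected_prob:
  assumes m: "m \<le> n choose 2" and n: "n \<ge> 1" and pn: "4 * ln n \<le> m / (n choose 2) * n"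
  shows "gprob n m {E. \<not> graph_connected n E} \<le> (1 + 1 / real n ^ 2) ^ n - 1"
proof -
  let ?p = "m / (n choose 2)"
  let ?I = "{T. T \<subseteq> {..<n} \<and> T \<noteq> {} \<and> 2 * card T \<le> n}"
  have "gprob n m {E. \<not> graph_connected n E} \<le>
     gprob n m {E. \<exists>T\<in>?I. E \<inter> edges_between n T ({..<n} - T) = {}}"
  proof (rule uniform_graph_prob_mono[OF m])
    fix E assume "E \<subseteq> all_edges n" "\<not> graph_connected n E"
    from not_connected_cut[OF this] show "\<exists>T\<in>?I. E \<inter> edges_between n T ({..<n} - T) = {}" by blast
  qed
  also have "\<dots> \<le> (\<Sum>T\<in>?I. (1 / real n ^ 2) ^ card T)"
  proof (rule prob_exists_le)
    show "finite ?I" by simp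
    fix T assume T: "T \<in> ?I"
    then have c: "card (edges_between n T ({..<n} - T)) = card T * (n - card T)"
      by (intro card_edges_between_compl) auto
    have "gprob n m {E. E \<inter> edges_between n T ({..<n} - T) = {}} \<le>
       exp (- ?p * card (edges_between n T ({..<n} - T)))"
      by (rule uniform_graph_none[OF m edges_between_subset])
    also have "\<dots> \<le> exp (card T * (- (2 * ln n)))"
    proof -
      have "real n / 2 \<le> real (n - card T)" using T by (simp add: of_nat_diff)
      then have "?p * (real n / 2) \<le> ?p * real (n - card T)" by (intro mult_left_mono) auto
      then have "2 * ln n \<le> ?p * real (n - card T)" using pn by simp
      then have "card T * (2 * ln n) \<le> card T * (?p * real (n - card T))" by (intro mult_left_mono) auto
      then show ?thesis unfolding c by (simp add: mult_ac)
    qed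
    also have "\<dots> = exp (- (2 * ln n)) ^ card T" by (rule exp_of_nat_mult)
    also have "exp (- (2 * ln n)) = 1 / real n ^ 2" using n exp_of_nat_mult[of 2 "ln (real n)"] by (simp add: exp_minus field_simps)
    finally show "gprob n m {E. E \<inter> edges_between n T ({..<n} - T) = {}} \<le> (1 / real n ^ 2) ^ card T" .
  qed
  also have "\<dots> \<le> (\<Sum>T\<in>Pow {..<n} - {{}}. (1 / real n ^ 2) ^ card T)"
    by (rule sum_mono2) auto
  also have "\<dots> = (\<Sum>T\<in>Pow {..<n}. (1 / real n ^ 2) ^ card T) - 1"
    by (subst sum_diff1) auto
  also have "\<dots> = (1 + 1 / real n ^ 2) ^ n - 1" using sum_Pow_power_card[of "{..<n}" "1 / real n ^ 2"] by simp
  finally show ?thesis .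
qed

section \<open>Isolated vertices\<close>

lemma uniform_graph_prob_none_eq:
  assumes m: "m \<le> n choose 2" and F: "F \<subseteq> all_edges n"
  shows "gprob n m {S. S \<inter> F = {}} =
    real (((n choose 2) - card F) choose m) / real ((n choose 2) choose m)"
proof -
  let ?A = "{S. S \<subseteq> all_edges n \<and> card S = m}"
  have ne: "?A \<noteq> {}" using m by (intro subsets_of_card_nonempty) (auto simp: card_all_edges)
  have fin: "finite ?A" by simp
  have "?A \<inter> {S. S \<inter> F = {}} = {S. S \<subseteq> all_edges n - F \<and> card S = m}" using F by auto
  moreover have "card (all_edges n - F) = (n choose 2) - card F"
    using F finite_subset[OF F] by (simp add: card_Diff_subset card_all_edges)
  ultimately show ?thesis
    unfolding uniform_graph_def measure_pmf_of_set[OF ne fin] by (simp add: n_subsets card_all_edges)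
qed

lemma binomial_quotient_eq_prod:
  fixes a b m :: nat
  assumes "m \<le> a" "m \<le> b"
  shows "real (a choose m) / real (b choose m) = (\<Prod>i<m. (real a - real i) / (real b - real i))"
proof -
  have "real (c choose m) = (\<Prod>i<m. (real c - real i)) / (\<Prod>i<m. real (m - i))" if "m \<le> c" for c
  proof -
    have "real (c choose m) = (\<Prod>i<m. real (c - i) / real (m - i))"
      using binomial_altdef_of_nat[OF that, where 'a = real] by (simp add: lessThan_atLeast0)
    also have "\<dots> = (\<Prod>i<m. (real c - real i) / real (m - i))"
      using that by (intro prod.cong) (auto simp: of_nat_diff)
    finally show ?thesis by (simp add: prod_dividef)
  qed
  note c = this[OF assms(1)] this[OF assms(2)]
  have "(\<Prod>i<m. real (m - i)) \<noteq> 0" by simp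
  then show ?thesis unfolding c prod_dividef by (simp only: divide_divide_eq_left divide_divide_eq_right nonzero_mult_div_cancel_right times_divide_eq_left simp_thms)
qed

lemma isolated_prob_ge:
  fixes n m :: nat
  defines "N \<equiv> n choose 2"
  assumes n: "n \<ge> 2" and m: "m + n \<le> N"
  shows "(1 - (real n - 1) / (real N - m)) ^ m \<le> real ((N - (n - 1)) choose m) / real (N choose m)"
proof -
  have "(1 - (real n - 1) / (real N - m)) ^ m = (\<Prod>i<m. 1 - (real n - 1) / (real N - m))" by simp
  also have "\<dots> \<le> (\<Prod>i<m. (real (N - (n - 1)) - i) / (real N - i))"
  proof (rule prod_mono)
    fix i assume i: "i \<in> {..<m}"
    have Nm: "real N - m \<ge> n" using m by linarith
    have Ni: "real N - i \<ge> real N - m" using i by simp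
    have a1: "(real n - 1) / (real N - m) \<le> 1" using Nm n by (simp add: field_simps)
    have a2: "(real n - 1) / (real N - i) \<le> (real n - 1) / (real N - m)"
      using Nm Ni n by (intro divide_left_mono mult_pos_pos) auto
    have a3: "real (N - (n - 1)) = real N - (real n - 1)" using m n by (simp add: of_nat_diff)
    have a4: "(real N - (real n - 1) - i) / (real N - i) = 1 - (real n - 1) / (real N - i)"
      using Nm Ni n by (simp add: field_simps)
    show "0 \<le> 1 - (real n - 1) / (real N - m) \<and>
        1 - (real n - 1) / (real N - m) \<le> (real (N - (n - 1)) - i) / (real N - i)"
      unfolding a3 a4 using a1 a2 by linarith
  qed
  also have "\<dots> = real ((N - (n - 1)) choose m) / real (N choose m)"
    by (rule binomial_quotient_eq_prod[symmetric]) (use m n in auto)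
  finally show ?thesis .
qed

text \<open>Two stars share one edge, so the two isolation events are almost independent. Factor by
  factor, \<open>(K - (n - 2)) * (K + (n - 1)) \<le> K\<^sup>2 + K \<le> (1 + 1 / M) *
  K\<^sup>2\<close>, where \<open>K \<ge> M\<close> counts the edges outside one star that remain;
  \<open>m\<close> such factors give the exponential.\<close>

lemma isolated_pair_prob_le:
  fixes n m :: nat
  defines "N \<equiv> n choose 2"
  assumes n: "n \<ge> 2" and m: "m + 2 * n \<le> N"
  shows "real ((N - (2 * n - 3)) choose m) / real (N choose m) \<le>
    exp (m / (real N - m - n)) * (real ((N - (n - 1)) choose m) / real (N choose m))\<^sup>2"
proof -
  define M where "M = real N - m - n"
  have M: "M > 0" using m n unfolding M_def by linarith
  have "real ((N - (2 * n - 3)) choose m) / real (N choose m) = (\<Prod>i<m. (real (N - (2 * n - 3)) - i) / (real N - i))"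
    by (rule binomial_quotient_eq_prod) (use m n in auto)
  also have "\<dots> \<le> (\<Prod>i<m. (1 + 1 / M) * ((real (N - (n - 1)) - i) / (real N - i))\<^sup>2)"
  proof (rule prod_mono)
    fix i assume i: "i \<in> {..<m}"
    define K where "K = real N - (real n - 1) - i"
    have K: "K \<ge> M" "K > 0" using i M n unfolding K_def M_def by auto
    have Ni: "real N - i = K + (real n - 1)" unfolding K_def by simp
    have Nipos: "real N - i > 0" using K n unfolding Ni by simp
    have e1: "real (N - (n - 1)) - i = K" using m n unfolding K_def by (simp add: of_nat_diff)
    have e2: "real (N - (2 * n - 3)) - i = K - (real n - 2)"
      using m n unfolding K_def by (cases "n = 2") (auto simp: of_nat_diff)
    have pos: "0 \<le> real (N - (2 * n - 3)) - i" using m i n by auto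
    have "(K - (real n - 2)) * (K + (real n - 1)) = K\<^sup>2 + K - (real n - 1) * (real n - 2)"
      by (simp add: power2_eq_square algebra_simps)
    also have "\<dots> \<le> K\<^sup>2 + K" using n by simp
    also have "\<dots> \<le> (1 + 1 / M) * K\<^sup>2"
    proof -
      have "K * M \<le> K * K" using K by (intro mult_left_mono) auto
      then have "K \<le> K\<^sup>2 / M" using M by (simp add: field_simps power2_eq_square)
      then show ?thesis by (simp add: algebra_simps)
    qed
    finally have "(K - (real n - 2)) * (real N - i) \<le> (1 + 1 / M) * K\<^sup>2" unfolding Ni .
    then have "(K - (real n - 2)) * (real N - i) / (real N - i)\<^sup>2 \<le> (1 + 1 / M) * K\<^sup>2 / (real N - i)\<^sup>2"
      by (rule divide_right_mono) simp
    then have "(K - (real n - 2)) / (real N - i) \<le> (1 + 1 / M) * (K / (real N - i))\<^sup>2"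
      using Nipos by (simp add: power2_eq_square power_divide)
    then show "0 \<le> (real (N - (2 * n - 3)) - i) / (real N - i) \<and>
      (real (N - (2 * n - 3)) - i) / (real N - i) \<le> (1 + 1 / M) * ((real (N - (n - 1)) - i) / (real N - i))\<^sup>2"
      using pos Nipos unfolding e1 e2 by simp
  qed
  also have "\<dots> = (1 + 1 / M) ^ m * (\<Prod>i<m. (real (N - (n - 1)) - i) / (real N - i))\<^sup>2"
    by (simp add: prod.distrib prod_power_distrib)
  also have "(\<Prod>i<m. (real (N - (n - 1)) - i) / (real N - i)) = real ((N - (n - 1)) choose m) / real (N choose m)"
    by (rule binomial_quotient_eq_prod[symmetric]) (use m n in auto)
  also have "(1 + 1 / M) ^ m * (real ((N - (n - 1)) choose m) / real (N choose m))\<^sup>2 \<le>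
      exp (m / M) * (real ((N - (n - 1)) choose m) / real (N choose m))\<^sup>2"
  proof -
    have "(1 + 1 / M) ^ m \<le> exp (1 / M) ^ m" using M by (intro power_mono exp_ge_add_one_self) auto
    then show ?thesis by (intro mult_right_mono) (simp_all add: exp_of_nat_mult[symmetric])
  qed
  finally show ?thesis unfolding M_def .
qed

lemma card_star_Un:
  assumes "u < n" "v < n" "u \<noteq> v"
  shows "card (star n u \<union> star n v) = 2 * n - 3"
proof -
  have "star n u \<inter> star n v = {{u, v}}"
  proof
    show "star n u \<inter> star n v \<subseteq> {{u, v}}"
    proof
      fix e assume e: "e \<in> star n u \<inter> star n v"
      then have "e \<in> all_edges n" unfolding star_def by simp
      then obtain i j where "e = {i, j}" by (rule all_edgesE)
      then show "e \<in> {{u, v}}" using e assms(3) unfolding star_def by auto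
    qed
    show "{{u, v}} \<subseteq> star n u \<inter> star n v" using assms by (simp add: star_def all_edges_doubleton)
  qed
  moreover have "finite (star n u)" "finite (star n v)" by (simp_all add: star_def)
  ultimately show ?thesis
    using card_Un_Int[of "star n u" "star n v"] card_star[OF assms(1)] card_star[OF assms(2)] by simp
qed

text \<open>Chebyshev's inequality for the number of isolated vertices.\<close>

lemma no_isolated_prob:
  fixes n m :: nat
  defines "N \<equiv> n choose 2"
  assumes n: "n \<ge> 2" and m: "m + 2 * n \<le> N"
  shows "gprob n m {S. \<forall>v<n. S \<inter> star n v \<noteq> {}} \<le>
    1 / (n * (1 - (real n - 1) / (real N - m)) ^ m) + (exp (m / (real N - m - n)) - 1)"
proof -
  let ?M = "measure_pmf (uniform_graph n m)"
  have mN: "m \<le> n choose 2" using m unfolding N_def by simp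
  have fin: "finite (set_pmf (uniform_graph n m))" by (simp add: set_pmf_uniform_graph[OF mN])
  note int = integrable_measure_pmf_finite[OF fin]
  define q1 where "q1 = real ((N - (n - 1)) choose m) / real (N choose m)"
  define q2 where "q2 = real ((N - (2 * n - 3)) choose m) / real (N choose m)"
  define I where "I v S = (if S \<inter> star n v = {} then 1 else 0 :: real)" for v S
  define X where "X S = (\<Sum>v<n. I v S)" for S
  define \<mu> where "\<mu> = n * q1"
  have EI: "measure_pmf.expectation (uniform_graph n m) (I v) = q1" if "v < n" for v
  proof -
    have "I v = indicator {S. S \<inter> star n v = {}}" by (auto simp: I_def indicator_def fun_eq_iff)
    then have "measure_pmf.expectation (uniform_graph n m) (I v) = gprob n m {S. S \<inter> star n v = {}}"
      by simp
    also have "\<dots> = q1" unfolding uniform_graph_prob_none_eq[OF mN star_subset] card_star[OF that] q1_def N_def ..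
    finally show ?thesis .
  qed
  have EII: "measure_pmf.expectation (uniform_graph n m) (\<lambda>S. I u S * I v S) = q2" if "u < n" "v < n" "u \<noteq> v" for u v
  proof -
    have "(\<lambda>S. I u S * I v S) = indicator {S. S \<inter> (star n u \<union> star n v) = {}}"
      by (auto simp: I_def indicator_def fun_eq_iff)
    then have "measure_pmf.expectation (uniform_graph n m) (\<lambda>S. I u S * I v S) =
       gprob n m {S. S \<inter> (star n u \<union> star n v) = {}}"
      by simp
    also have "\<dots> = q2"
      using uniform_graph_prob_none_eq[OF mN, of "star n u \<union> star n v"] star_subset
      unfolding card_star_Un[OF that] q2_def N_def by simp
    finally show ?thesis .
  qed
  have EX: "measure_pmf.expectation (uniform_graph n m) X = \<mu>"
    unfolding X_def[abs_def] \<mu>_def by (subst Bochner_Integration.integral_sum) (use int EI in auto)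
  have EX2: "measure_pmf.expectation (uniform_graph n m) (\<lambda>S. (X S)\<^sup>2) \<le> \<mu> + real n * real n * q2"
  proof -
    have "measure_pmf.expectation (uniform_graph n m) (\<lambda>S. (X S)\<^sup>2) =
        (\<Sum>u<n. \<Sum>v<n. measure_pmf.expectation (uniform_graph n m) (\<lambda>S. I u S * I v S))"
      unfolding X_def power2_eq_square sum_product
      by (simp add: Bochner_Integration.integral_sum int)
    also have "\<dots> \<le> (\<Sum>u<n. \<Sum>v<n. (if u = v then q1 else 0) + q2)"
    proof (intro sum_mono)
      fix u v assume uv: "u \<in> {..<n}" "v \<in> {..<n}"
      have sq: "(\<lambda>S. I v S * I v S) = I v" by (auto simp: I_def fun_eq_iff)
      have "q2 \<ge> 0" unfolding q2_def by simp
      then show "measure_pmf.expectation (uniform_graph n m) (\<lambda>S. I u S * I v S) \<le> (if u = v then q1 else 0) + q2"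
        using uv EI[of v] EII[of u v] sq by (cases "u = v") auto
    qed
    also have "\<dots> = \<mu> + real n * real n * q2" by (simp add: sum.distrib \<mu>_def algebra_simps)
    finally show ?thesis .
  qed
  have q1p: "0 < q1" unfolding q1_def using m n unfolding N_def by (intro divide_pos_pos) auto
  have \<mu>p: "\<mu> > 0" unfolding \<mu>_def using q1p n by simp
  have "\<mu>\<^sup>2 * gprob n m {S. \<forall>v<n. S \<inter> star n v \<noteq> {}} =
     measure_pmf.expectation (uniform_graph n m) (\<lambda>S. \<mu>\<^sup>2 * indicator {S. \<forall>v<n. S \<inter> star n v \<noteq> {}} S)"
    by simp
  \<comment> \<open>The right-hand integrand is \<open>(X S - \<mu>)\<^sup>2\<close>, which equals
    \<open>\<mu>\<^sup>2\<close> when no vertex is isolated, as then \<open>X S = 0\<close>.\<close>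
  also have "\<dots> \<le> measure_pmf.expectation (uniform_graph n m) (\<lambda>S. (X S)\<^sup>2 - 2 * \<mu> * X S + \<mu>\<^sup>2)"
  proof (rule integral_mono[OF int int])
    fix S
    show "\<mu>\<^sup>2 * indicator {S. \<forall>v<n. S \<inter> star n v \<noteq> {}} S \<le> (X S)\<^sup>2 - 2 * \<mu> * X S + \<mu>\<^sup>2"
    proof (cases "\<forall>v<n. S \<inter> star n v \<noteq> {}")
      case True
      then have "X S = 0" unfolding X_def I_def by (intro sum.neutral) auto
      then show ?thesis by (simp add: indicator_def)
    next
      case False
      have "0 \<le> (X S - \<mu>)\<^sup>2" by simp
      then show ?thesis using False by (auto simp: indicator_def power2_diff algebra_simps)
    qed
  qed
  also have "\<dots> = measure_pmf.expectation (uniform_graph n m) (\<lambda>S. (X S)\<^sup>2) - 2 * \<mu> * \<mu> + \<mu>\<^sup>2"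
    by (simp add: int EX)
  also have "\<dots> \<le> \<mu> + real n * real n * q2 - \<mu>\<^sup>2" using EX2 by (simp add: power2_eq_square)
  also have "\<dots> \<le> \<mu> + real n * real n * (exp (m / (real N - m - n)) * q1\<^sup>2) - \<mu>\<^sup>2"
    using isolated_pair_prob_le[OF n, of m] m unfolding q1_def q2_def N_def
    by (intro diff_right_mono add_left_mono mult_left_mono) auto
  also have "\<dots> = \<mu>\<^sup>2 * (1 / \<mu> + (exp (m / (real N - m - n)) - 1))"
  proof -
    have "\<mu>\<^sup>2 * (1 / \<mu>) = \<mu>" using \<mu>p by (simp add: power2_eq_square)
    moreover have "real n * real n * (x * q1\<^sup>2) = \<mu>\<^sup>2 * x" for x
      unfolding \<mu>_def by (simp add: power2_eq_square)
    ultimately show ?thesis by (simp only: distrib_left right_diff_distrib mult_1_right)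
  qed
  finally have "gprob n m {S. \<forall>v<n. S \<inter> star n v \<noteq> {}} \<le> 1 / \<mu> + (exp (m / (real N - m - n)) - 1)"
    using \<mu>p by (simp add: mult_le_cancel_left_pos)
  also have "1 / \<mu> \<le> 1 / (n * (1 - (real n - 1) / (real N - m)) ^ m)"
  proof -
    have m2: "m + n \<le> n choose 2" using m unfolding N_def by simp
    have "(1 - (real n - 1) / (real N - m)) ^ m \<le> q1"
      unfolding q1_def N_def by (rule isolated_prob_ge[OF n m2])
    then have 1: "n * (1 - (real n - 1) / (real N - m)) ^ m \<le> \<mu>" unfolding \<mu>_def by (intro mult_left_mono) auto
    have "real N - m \<ge> n" using m by linarith
    then have "(real n - 1) / (real N - m) < 1" using n by (simp add: field_simps)
    then have "0 < n * (1 - (real n - 1) / (real N - m)) ^ m" using n by simp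
    then show ?thesis by (intro frac_le[OF _ _ _ 1]) auto
  qed
  finally show ?thesis by simp
qed

lemma connected_imp_star:
  assumes E: "E \<subseteq> all_edges n" and n: "n \<ge> 2" and c: "graph_connected n E" and v: "v < n"
  shows "E \<inter> star n v \<noteq> {}"
proof -
  obtain u where u: "u < n" "u \<noteq> v" using n v by (metis One_nat_def Suc_1 less_le_trans lessI zero_less_Suc less_numeral_extra(1) neq0_conv)
  have "(v, u) \<in> {(x, y). {x, y} \<in> E}\<^sup>*" using c u v unfolding graph_connected_def by blast
  then obtain y where "{v, y} \<in> E" using u(2) by (auto elim: converse_rtranclE)
  then show ?thesis using E unfolding star_def by blast
qed

section \<open>Vertices of small degree\<close>

text \<open>If all vertices of \<open>W\<close> have degree below \<open>s\<close>, at most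
  \<open>card W * s\<close> of the \<open>card W * card T\<close> pairs between \<open>W\<close> and
  \<open>T\<close> are edges. Treating the vertices of \<open>W\<close> jointly lets their rare
  events multiply, and keeping \<open>P\<close> outside these pairs adds the cost of its edges. This
  is \<open>uniform_graph_edges_few\<close> with \<open>k = 2\<close>.\<close>

lemma small_degree_set_prob:
  fixes s :: real
  assumes m: "m \<le> n choose 2" "0 < m" and W: "W \<subseteq> {..<n}" and T: "T \<subseteq> {..<n}" "W \<inter> T = {}"
    and P: "P \<subseteq> all_edges n" "P \<inter> edges_between n W T = {}"
  shows "gprob n m {S. P \<subseteq> S \<and> (\<forall>w\<in>W. real (degree_of S w) < s)} \<le>
    (exp 1 * (m / (n choose 2))) ^ card P *
    exp (2 * (card W * s) - (1 - exp (-2)) * (m / (n choose 2)) * (card W * card T))"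
proof -
  let ?F = "edges_between n W T"
  have fW: "finite W" using W finite_subset by blast
  have "gprob n m {S. P \<subseteq> S \<and> (\<forall>w\<in>W. real (degree_of S w) < s)} \<le>
     gprob n m {S. P \<subseteq> S \<and> real (card (S \<inter> ?F)) \<le> card W * s}"
  proof (rule uniform_graph_prob_mono[OF m(1)])
    fix S assume S: "S \<subseteq> all_edges n" and b: "P \<subseteq> S \<and> (\<forall>w\<in>W. real (degree_of S w) < s)"
    have fS: "finite S" using finite_subset[OF S] by simp
    have "S \<inter> ?F \<subseteq> (\<Union>w\<in>W. S \<inter> star n w)" unfolding edges_between_def star_def by auto
    then have "card (S \<inter> ?F) \<le> card (\<Union>w\<in>W. S \<inter> star n w)" using fW fS by (intro card_mono) auto
    also have "\<dots> \<le> (\<Sum>w\<in>W. card (S \<inter> star n w))" using fW by (rule card_UN_le)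
    finally have "real (card (S \<inter> ?F)) \<le> (\<Sum>w\<in>W. real (degree_of S w))"
      unfolding degree_of_eq_star[OF S] of_nat_sum[symmetric] by (simp only: of_nat_le_iff)
    also have "\<dots> \<le> (\<Sum>w\<in>W. s)" using b by (intro sum_mono) auto
    finally show "P \<subseteq> S \<and> real (card (S \<inter> ?F)) \<le> card W * s" using b by simp
  qed
  also have "\<dots> \<le> (exp 1 * (m / (n choose 2))) ^ card P *
     exp (2 * (card W * s) - (1 - exp (-2)) * (m / (n choose 2)) * card ?F)"
    by (rule uniform_graph_edges_few[OF m P(1) edges_between_subset P(2)]) simp
  finally show ?thesis unfolding card_edges_between_disjoint[OF W T] by simp
qed

lemma one_minus_exp_minus_2: "1 - exp (-2) \<ge> (4 / 5 :: real)"
proof -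
  have "(1 + 2 + 2\<^sup>2 / 2 :: real) \<le> exp 2" using exp_lower_Taylor_quadratic[of "2::real"] by simp
  then have "exp (-2) \<le> (1 / 5 :: real)" by (simp add: exp_minus field_simps)
  then show ?thesis by simp
qed

text \<open>Per vertex, the threshold \<open>L / 100\<close> loses \<open>1 / 50 * L\<close> and the
  missing edges gain \<open>4 / 5 * (7 / 10) * L = 28 / 50 * L\<close>. The net rate 27/50 exceeds
  1/2, as the later sums require.\<close>

lemma small_degree_set_prob':
  fixes s L :: real
  assumes m: "m \<le> n choose 2" "0 < m" and W: "W \<subseteq> {..<n}" and T: "T \<subseteq> {..<n}" "W \<inter> T = {}"
    and P: "P \<subseteq> all_edges n" "P \<inter> edges_between n W T = {}"
    and pT: "7 / 10 * L \<le> m / (n choose 2) * card T"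
  shows "gprob n m {S. P \<subseteq> S \<and> (\<forall>w\<in>W. real (degree_of S w) < L / 100)} \<le>
    (exp 1 * (m / (n choose 2))) ^ card P * exp (- (27 / 50 * card W * L))"
proof -
  let ?p = "m / (n choose 2)"
  have "4 / 5 * (7 / 10 * L) \<le> 4 / 5 * (?p * card T)" using pT by (intro mult_left_mono) auto
  also have "\<dots> \<le> (1 - exp (-2)) * (?p * card T)"
    using one_minus_exp_minus_2 by (intro mult_right_mono) auto
  finally have "card W * (4 / 5 * (7 / 10 * L)) \<le> card W * ((1 - exp (-2)) * (?p * card T))"
    by (intro mult_left_mono) auto
  then have 1: "28 / 50 * (card W * L) \<le> (1 - exp (-2)) * ?p * (card W * card T)" by (simp add: mult_ac)
  have gen: "x - y \<le> - z" if "28 / 50 * w \<le> y" "x = 1 / 50 * w" "z = 27 / 50 * w" for x y z w :: real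
    using that by linarith
  have "2 * (card W * (L / 100)) - (1 - exp (-2)) * ?p * (card W * card T) \<le> - (27 / 50 * card W * L)"
    by (rule gen[OF 1]) simp_all
  then have "exp (2 * (card W * (L / 100)) - (1 - exp (-2)) * ?p * (card W * card T)) \<le> exp (- (27 / 50 * card W * L))"
    by simp
  then have "(exp 1 * ?p) ^ card P * exp (2 * (card W * (L / 100)) - (1 - exp (-2)) * ?p * (card W * card T))
     \<le> (exp 1 * ?p) ^ card P * exp (- (27 / 50 * card W * L))"
    by (intro mult_left_mono) auto
  then show ?thesis using small_degree_set_prob[OF m W T P, of "L / 100"] by linarith
qed

section \<open>Vertices with several neighbours of small degree\<close>

definition many_small :: "nat \<Rightarrow> nat set set \<Rightarrow> real \<Rightarrow> bool" where
  "many_small n E s \<longleftrightarrow> (\<exists>u<n. \<exists>W\<subseteq>{..<n}. card W = 4 \<and> (\<forall>w\<in>W. {u, w} \<in> E \<and> real (degree_of E w) < s))"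

lemma not_many_small:
  assumes "\<not> many_small n E s" "u < n"
  shows "card {v. v < n \<and> {u, v} \<in> E \<and> real (degree_of E v) < s} \<le> 3"
proof (rule ccontr)
  assume "\<not> ?thesis"
  then have "4 \<le> card {v. v < n \<and> {u, v} \<in> E \<and> real (degree_of E v) < s}" by simp
  then obtain W where W: "W \<subseteq> {v. v < n \<and> {u, v} \<in> E \<and> real (degree_of E v) < s}" "card W = 4"
    by (rule obtain_subset_with_card_n)
  then have "W \<subseteq> {..<n}" "\<forall>w\<in>W. {u, w} \<in> E \<and> real (degree_of E w) < s" by auto
  then have "many_small n E s" using assms(2) W(2) unfolding many_small_def by blast
  then show False using assms(1) by simp
qed

text \<open>\<open>P\<close> consists of the four edges from \<open>u\<close> to \<open>W\<close>,
  and \<open>T\<close> avoids \<open>u\<close> so that these edges are not counted again. For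
  \<open>L = ln n\<close> and \<open>m\<close> of order \<open>n * ln n\<close> the bound is
  \<open>n powr (5 - 4 - 54 / 25)\<close> up to logarithms, which stays small after summing over the
  window.\<close>

lemma many_small_prob:
  fixes L :: real
  assumes m: "m \<le> n choose 2" "0 < m" and pT: "7 / 10 * L \<le> m / (n choose 2) * (real n - 5)" and n: "n \<ge> 5"
  shows "gprob n m {E. many_small n E (L / 100)} \<le>
    real n ^ 5 * ((exp 1 * (m / (n choose 2))) ^ 4 * exp (- (54 / 25 * L)))"
proof -
  let ?b = "(exp 1 * (m / (n choose 2))) ^ 4 * exp (- (54 / 25 * L))"
  let ?J = "{W. W \<subseteq> {..<n} \<and> card W = 4}"
  define Q where "Q uW E \<longleftrightarrow> (\<forall>w\<in>snd uW. {fst uW, w} \<in> E \<and> real (degree_of E w) < L / 100)" for uW :: "nat \<times> nat set" and E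
  have fin: "finite ({..<n} \<times> ?J)" by simp
  have one: "gprob n m {E. Q uW E} \<le> ?b" if uW: "uW \<in> {..<n} \<times> ?J" for uW
  proof -
    obtain u W where e: "uW = (u, W)" by (cases uW)
    have u: "u < n" and W: "W \<subseteq> {..<n}" "card W = 4" using uW e by auto
    have fW: "finite W" using W finite_subset by blast
    show ?thesis
    proof (cases "u \<in> W")
      \<comment> \<open>A loop \<open>{u, u}\<close> would have to be an edge, so the event is
        empty.\<close>
      case True
      have "gprob n m {E. Q uW E} \<le> gprob n m {E. False}"
      proof (rule uniform_graph_prob_mono[OF m(1)])
        fix E assume "E \<subseteq> all_edges n" "Q uW E"
        then have "{u, u} \<in> all_edges n" using True unfolding Q_def e by auto
        then show False using all_edges_doubleton by blast
      qed
      then have "gprob n m {E. Q uW E} \<le> 0" by simp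
      moreover have "0 \<le> ?b" by (intro mult_nonneg_nonneg zero_le_power) auto
      ultimately show ?thesis by linarith
    next
      case False
      let ?T = "{..<n} - insert u W"
      let ?P = "(\<lambda>w. {u, w}) ` W"
      have "card (insert u W) = 5" using W fW False by simp
      then have cT: "card ?T = n - 5" using W u fW by (subst card_Diff_subset) auto
      have cP: "card ?P = 4"
      proof -
        have "inj_on (\<lambda>w. {u, w}) W" by (rule inj_onI) (auto simp: doubleton_eq_iff)
        then show ?thesis using W by (simp add: card_image)
      qed
      have P: "?P \<subseteq> all_edges n" using W u False by (auto simp: all_edges_doubleton)
      have PF: "?P \<inter> edges_between n W ?T = {}"
      proof (rule equals0I)
        fix x assume "x \<in> ?P \<inter> edges_between n W ?T"
        then obtain w i j where "x = {u, w}" "w \<in> W" "x = {i, j}" "i \<in> W" "j \<notin> insert u W"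
          unfolding edges_between_def by blast
        then show False by (auto simp: doubleton_eq_iff)
      qed
      have "gprob n m {E. Q uW E} \<le>
        gprob n m {S. ?P \<subseteq> S \<and> (\<forall>w\<in>W. real (degree_of S w) < L / 100)}"
        by (rule uniform_graph_prob_mono[OF m(1)]) (auto simp: Q_def e)
      also have "\<dots> \<le> (exp 1 * (m / (n choose 2))) ^ card ?P * exp (- (27 / 50 * card W * L))"
      proof (rule small_degree_set_prob'[OF m W(1) _ _ P PF])
        show "7 / 10 * L \<le> m / (n choose 2) * card ?T" using pT n unfolding cT by (simp add: of_nat_diff)
      qed auto
      also have "\<dots> = ?b" unfolding cP W(2) by simp
      finally show ?thesis .
    qed
  qed
  have "gprob n m {E. many_small n E (L / 100)} =
      gprob n m {E. \<exists>uW\<in>{..<n} \<times> ?J. Q uW E}"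
    unfolding many_small_def Q_def by (intro arg_cong[where f = "gprob n m"]) auto
  also have "\<dots> \<le> real (card ({..<n} \<times> ?J)) * ?b"
    by (rule prob_exists_le_const[OF fin one])
  also have "\<dots> \<le> real n ^ 5 * ?b"
  proof (rule mult_right_mono)
    have "n choose 4 \<le> n ^ 4" by (cases "4 \<le> n") (auto simp: binomial_le_pow binomial_eq_0)
    then have "n * (n choose 4) \<le> n * n ^ 4" by simp
    then have "real (n * (n choose 4)) \<le> real (n * n ^ 4)" by (simp only: of_nat_le_iff)
    then show "real (card ({..<n} \<times> ?J)) \<le> real n ^ 5"
      by (simp add: card_cartesian_product n_subsets power_numeral_reduce)
  qed auto
  finally show ?thesis .
qed

section \<open>Adjacent vertices of small degree\<close>

definition small_edge :: "nat set set \<Rightarrow> real \<Rightarrow> bool" where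
  "small_edge E s \<longleftrightarrow> (\<exists>u v. {u, v} \<in> E \<and> real (degree_of E u) < s \<and> real (degree_of E v) < s)"

text \<open>Used with \<open>P = {{u, v}}\<close> for an edge that is already present, and with
  \<open>P = {}\<close> for the degrees just before the edge is added.\<close>

lemma small_pair_prob:
  fixes L :: real
  assumes m: "m \<le> n choose 2" "0 < m" and pT: "7 / 10 * L \<le> m / (n choose 2) * (real n - 5)" and n: "n \<ge> 5"
    and uv: "u < n" "v < n" "u \<noteq> v" and P: "P \<subseteq> {{u, v}}"
  shows "gprob n m {S. P \<subseteq> S \<and> real (degree_of S u) < L / 100 \<and> real (degree_of S v) < L / 100} \<le>
    (exp 1 * (m / (n choose 2))) ^ card P * exp (- (27 / 25 * L))"
proof -
  let ?T = "{..<n} - {u, v}"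
  have cT: "card ?T = n - 2" using uv by (subst card_Diff_subset) auto
  have "gprob n m {S. P \<subseteq> S \<and> (\<forall>w\<in>{u, v}. real (degree_of S w) < L / 100)} \<le>
    (exp 1 * (m / (n choose 2))) ^ card P * exp (- (27 / 50 * card {u, v} * L))"
  proof (rule small_degree_set_prob'[OF m])
    show "P \<subseteq> all_edges n" using P uv by (auto simp: all_edges_doubleton subset_singleton_iff)
    show "P \<inter> edges_between n {u, v} ?T = {}"
    proof (rule equals0I)
      fix x assume "x \<in> P \<inter> edges_between n {u, v} ?T"
      then obtain i j where "x = {u, v}" "x = {i, j}" "j \<notin> {u, v}" using P unfolding edges_between_def by blast
      then show False by blast
    qed
    have "m / (n choose 2) * (real n - 5) \<le> m / (n choose 2) * card ?T"
      unfolding cT using n by (intro mult_left_mono) (auto simp: of_nat_diff)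
    then show "7 / 10 * L \<le> m / (n choose 2) * card ?T" using pT by linarith
  qed (use uv in auto)
  then show ?thesis using uv by simp
qed

text \<open>For \<open>L = ln n\<close> and \<open>m\<close> of order \<open>n * ln n\<close> this
  is \<open>n powr - (2 / 25)\<close> up to logarithms: enough for the beginning of the window, too
  weak for a union over its times.\<close>

lemma small_edge_prob:
  fixes L :: real
  assumes m: "m \<le> n choose 2" "0 < m" and pT: "7 / 10 * L \<le> m / (n choose 2) * (real n - 5)" and n: "n \<ge> 5"
  shows "gprob n m {E. small_edge E (L / 100)} \<le>
    real n ^ 2 * ((exp 1 * (m / (n choose 2))) * exp (- (27 / 25 * L)))"
proof -
  let ?I = "{x \<in> {..<n} \<times> {..<n}. fst x \<noteq> snd x}"
  define Q where "Q x E \<longleftrightarrow> {{fst x, snd x}} \<subseteq> E \<and> real (degree_of E (fst x)) < L / 100 \<and> real (degree_of E (snd x)) < L / 100"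
    for x :: "nat \<times> nat" and E
  have "gprob n m {E. small_edge E (L / 100)} \<le>
     gprob n m {E. \<exists>x\<in>?I. Q x E}"
  proof (rule uniform_graph_prob_mono[OF m(1)])
    fix E assume E: "E \<subseteq> all_edges n" "small_edge E (L / 100)"
    then obtain u v where uv: "{u, v} \<in> E" "real (degree_of E u) < L / 100" "real (degree_of E v) < L / 100"
      unfolding small_edge_def by blast
    then have "{u, v} \<in> all_edges n" using E by blast
    then have "(u, v) \<in> ?I" by (simp add: all_edges_doubleton)
    then show "\<exists>x\<in>?I. Q x E" unfolding Q_def using uv by (intro bexI[of _ "(u, v)"]) auto
  qed
  also have "\<dots> \<le> real (card ?I) * ((exp 1 * (m / (n choose 2))) * exp (- (27 / 25 * L)))"
  proof (rule prob_exists_le_const)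
    fix x assume "x \<in> ?I"
    then have x: "fst x < n" "snd x < n" "fst x \<noteq> snd x" by auto
    show "gprob n m {E. Q x E} \<le> (exp 1 * (m / (n choose 2))) * exp (- (27 / 25 * L))"
      unfolding Q_def using small_pair_prob[OF m pT n x, of "{{fst x, snd x}}"] by simp
  qed simp
  also have "\<dots> \<le> real n ^ 2 * ((exp 1 * (m / (n choose 2))) * exp (- (27 / 25 * L)))"
  proof (rule mult_right_mono)
    have "card ?I \<le> card ({..<n} \<times> {..<n})" by (intro card_mono) auto
    also have "\<dots> = n ^ 2" by (simp add: card_cartesian_product power2_eq_square)
    finally show "real (card ?I) \<le> real n ^ 2" by (simp only: of_nat_power[symmetric] of_nat_le_iff)
  qed auto
  finally show ?thesis .
qed

text \<open>
  Edges joining two vertices of small degree are excluded for a whole window of times at once: such an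
  edge is either present at the beginning of the window or is added when both ends already have
  small degree, and the sum over all steps of the probability of the latter is still small.
\<close>

definition small_step :: "nat set list \<Rightarrow> nat \<Rightarrow> real \<Rightarrow> bool" where
  "small_step es m s \<longleftrightarrow> (\<exists>u v. es ! m = {u, v} \<and> real (degree_of (set (take m es)) u) < s \<and>
     real (degree_of (set (take m es)) v) < s)"

text \<open>Given the first \<open>m\<close> edges, a particular pair comes next with probability at
  most \<open>1 / (N - m)\<close>. Hence a step costs about \<open>n powr - (27 / 25)\<close> for
  \<open>L = ln n\<close>, and about \<open>n * ln n\<close> steps still sum to something
  small.\<close>

lemma small_step_prob:
  fixes L :: real
  assumes m: "m < n choose 2" "0 < m" and pT: "7 / 10 * L \<le> m / (n choose 2) * (real n - 5)" and n: "n \<ge> 5"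
  shows "measure_pmf.prob (graph_process n) {es. small_step es m (L / 100)} \<le>
    real n ^ 2 * exp (- (27 / 25 * L)) / (real (n choose 2) - m)"
proof -
  let ?I = "{x \<in> {..<n} \<times> {..<n}. fst x \<noteq> snd x}"
  let ?N = "n choose 2"
  define R where "R x E \<longleftrightarrow> real (degree_of E (fst x)) < L / 100 \<and> real (degree_of E (snd x)) < L / 100"
    for x :: "nat \<times> nat" and E
  define Q where "Q x es \<longleftrightarrow> es ! m = {fst x, snd x} \<and> R x (set (take m es))" for x es
  have mN: "m \<le> ?N" using m by simp
  have single: "measure_pmf.prob (edge_process n (Suc m)) {es. Q x es} \<le> exp (- (27 / 25 * L)) / (real ?N - m)"
    if x: "x \<in> ?I" for x
  proof -
    have xs: "fst x < n" "snd x < n" "fst x \<noteq> snd x" using x by auto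
    have "emeasure (edge_process n (Suc m)) {es. Q x es} =
       (\<integral>\<^sup>+ es. emeasure (map_pmf (\<lambda>e. es @ [e]) (pmf_of_set (all_edges n - set es))) {es. Q x es} \<partial>edge_process n m)"
      by simp
    also have "\<dots> \<le> (\<integral>\<^sup>+ es. ennreal (1 / (real ?N - m)) * indicator {es. R x (set es)} es \<partial>edge_process n m)"
    proof (rule nn_integral_mono_AE)
      show "AE es in edge_process n m. emeasure (map_pmf (\<lambda>e. es @ [e]) (pmf_of_set (all_edges n - set es))) {es. Q x es}
         \<le> ennreal (1 / (real ?N - m)) * indicator {es. R x (set es)} es"
        unfolding AE_measure_pmf_iff
      proof
        fix es assume es: "es \<in> set_pmf (edge_process n m)"
        have len: "length es = m" using es by (rule length_edge_process)
        have "set es \<in> set_pmf (map_pmf set (edge_process n m))" using es by simp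
        then have S: "set es \<subseteq> all_edges n" "card (set es) = m"
          unfolding edge_process_set[OF mN] set_pmf_uniform_graph[OF mN] by auto
        have cA: "card (all_edges n - set es) = ?N - m"
          using S by (simp add: card_Diff_subset card_all_edges)
        have ne: "all_edges n - set es \<noteq> {}" using cA m by force
        have vim: "(\<lambda>e. es @ [e]) -` {es. Q x es} = (if R x (set es) then {{fst x, snd x}} else {})"
          using len by (auto simp: Q_def nth_append)
        show "emeasure (map_pmf (\<lambda>e. es @ [e]) (pmf_of_set (all_edges n - set es))) {es. Q x es}
         \<le> ennreal (1 / (real ?N - m)) * indicator {es. R x (set es)} es"
        proof (cases "R x (set es)")
          case True
          have "measure_pmf.prob (pmf_of_set (all_edges n - set es)) {{fst x, snd x}} \<le> 1 / (real ?N - m)"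
          proof -
            have "card ((all_edges n - set es) \<inter> {{fst x, snd x}}) \<le> card {{fst x, snd x}}"
              by (rule card_mono) auto
            then have "real (card ((all_edges n - set es) \<inter> {{fst x, snd x}})) \<le> 1" by simp
            moreover have "real (card (all_edges n - set es)) = real ?N - m" using cA m by (simp add: of_nat_diff)
            ultimately show ?thesis using ne m by (subst measure_pmf_of_set) (auto intro!: divide_right_mono)
          qed
          then show ?thesis using True unfolding emeasure_map_pmf vim by (simp add: measure_pmf.emeasure_eq_measure ennreal_leI)
        next
          case False
          then show ?thesis unfolding emeasure_map_pmf vim by simp
        qed
      qed
    qed
    also have "\<dots> = ennreal (1 / (real ?N - m)) * emeasure (edge_process n m) {es. R x (set es)}"
      by (simp add: nn_integral_cmult)
    also have "\<dots> = ennreal (1 / (real ?N - m) * measure_pmf.prob (edge_process n m) {es. R x (set es)})"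
      unfolding measure_pmf.emeasure_eq_measure by (rule ennreal_mult[symmetric]) (use m in auto)
    finally have "measure_pmf.prob (edge_process n (Suc m)) {es. Q x es} \<le>
        1 / (real ?N - m) * measure_pmf.prob (edge_process n m) {es. R x (set es)}"
      using m by (simp add: measure_pmf.emeasure_eq_measure del: edge_process.simps)
    also have "measure_pmf.prob (edge_process n m) {es. R x (set es)} = gprob n m {S. R x S}"
      unfolding edge_process_set[OF mN, symmetric] by (simp add: vimage_def)
    also have "\<dots> \<le> exp (- (27 / 25 * L))"
      using small_pair_prob[OF mN m(2) pT n xs, of "{}"] unfolding R_def by simp
    finally show ?thesis using m by (simp add: divide_right_mono mult_left_mono)
  qed
  \<comment> \<open>The event concerns only the first \<open>m + 1\<close> edges, so it can be moved
    to \<open>edge_process n (Suc m)\<close>.\<close>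
  have "measure_pmf.prob (graph_process n) {es. small_step es m (L / 100)} \<le>
     measure_pmf.prob (graph_process n) {es. \<exists>x\<in>?I. Q x (take (Suc m) es)}"
  proof (rule measure_pmf.finite_measure_mono_AE)
    show "AE es in graph_process n. es \<in> {es. small_step es m (L / 100)} \<longrightarrow> es \<in> {es. \<exists>x\<in>?I. Q x (take (Suc m) es)}"
      unfolding AE_measure_pmf_iff
    proof (intro ballI impI)
      fix es assume es: "es \<in> set_pmf (graph_process n)" and b: "es \<in> {es. small_step es m (L / 100)}"
      have len: "length es = ?N" using es unfolding graph_process_def by (rule length_edge_process)
      obtain u v where uv: "es ! m = {u, v}" "real (degree_of (set (take m es)) u) < L / 100"
        "real (degree_of (set (take m es)) v) < L / 100" using b unfolding small_step_def by blast
      have "set es \<in> set_pmf (map_pmf set (edge_process n ?N))" using es unfolding graph_process_def by simp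
      then have "set es \<subseteq> all_edges n" using edge_process_set[of ?N n] set_pmf_uniform_graph[of ?N n] by auto
      then have "{u, v} \<in> all_edges n" using uv(1) len m by (metis nth_mem subsetD)
      then have "(u, v) \<in> ?I" by (simp add: all_edges_doubleton)
      moreover have "Q (u, v) (take (Suc m) es)" unfolding Q_def R_def using uv len m by simp
      ultimately show "es \<in> {es. \<exists>x\<in>?I. Q x (take (Suc m) es)}" by blast
    qed
  qed simp
  also have "\<dots> = measure_pmf.prob (edge_process n (Suc m)) {es. \<exists>x\<in>?I. Q x es}"
    using m by (subst graph_process_take[symmetric]) (auto simp: vimage_def simp del: edge_process.simps)
  also have "\<dots> \<le> real (card ?I) * (exp (- (27 / 25 * L)) / (real ?N - m))"
    by (rule prob_exists_le_const) (use single in auto)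
  also have "\<dots> \<le> real n ^ 2 * (exp (- (27 / 25 * L)) / (real ?N - m))"
  proof (rule mult_right_mono)
    have "card ?I \<le> card ({..<n} \<times> {..<n})" by (intro card_mono) auto
    also have "\<dots> = n ^ 2" by (simp add: card_cartesian_product power2_eq_square)
    finally show "real (card ?I) \<le> real n ^ 2" by (simp only: of_nat_power[symmetric] of_nat_le_iff)
  qed (use m in auto)
  finally show ?thesis by simp
qed

section \<open>The graph at the connection time\<close>

lemma graph_at_mono: "m \<le> m' \<Longrightarrow> graph_at es m \<subseteq> graph_at es m'"
  unfolding graph_at_def by (rule set_take_subset_set_take)

lemma graph_process_subset:
  assumes "es \<in> set_pmf (graph_process n)"
  shows "graph_at es m \<subseteq> all_edges n"
proof -
  have "set es \<in> set_pmf (map_pmf set (edge_process n (n choose 2)))"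
    using assms unfolding graph_process_def by simp
  then have "set es \<subseteq> all_edges n"
    using edge_process_set[of "n choose 2" n] set_pmf_uniform_graph[of "n choose 2" n] by auto
  then show ?thesis unfolding graph_at_def using set_take_subset[of m es] by blast
qed

lemma graph_connected_mono:
  assumes "graph_connected n E" "E \<subseteq> E'"
  shows "graph_connected n E'"
proof -
  have "{(x, y). {x, y} \<in> E}\<^sup>* \<subseteq> {(x, y). {x, y} \<in> E'}\<^sup>*"
    using assms(2) by (intro rtrancl_mono) auto
  then show ?thesis using assms(1) unfolding graph_connected_def by blast
qed

lemma degree_of_mono:
  assumes "E \<subseteq> E'" "finite E'"
  shows "degree_of E v \<le> degree_of E' v"
  unfolding degree_of_def using assms by (intro card_mono) auto

lemma discrepancy_mono:
  assumes "discrepancy n E' P C" "E \<subseteq> E'"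
  shows "discrepancy n E P C"
  unfolding discrepancy_def
proof (intro allI impI)
  fix S T t k
  assume h: "S \<subseteq> {..<n}" "T \<subseteq> {..<n}" "1 \<le> t" "t \<le> n" "card S \<le> t" "card T \<le> t" "k \<le> 2 * n + 2"
  have fin: "finite (S \<times> T)" using h(1,2) finite_subset by blast
  have "edge_pairs E S T \<le> edge_pairs E' S T"
    unfolding edge_pairs_def by (rule card_mono) (use fin assms(2) in auto)
  also have "real (edge_pairs E' S T) \<le> 2 ^ (k + 2) * P * real (card S) * real (card T) +
       C * real t * ln (exp 1 * real n / real t) / (real k + 1)"
    using assms(1)[unfolded discrepancy_def, rule_format, OF h] .
  finally show "real (edge_pairs E S T) \<le> 2 ^ (k + 2) * P * real (card S) * real (card T) +
       C * real t * ln (exp 1 * real n / real t) / (real k + 1)" by simp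
qed

text \<open>Degrees only grow, so the ends of a small edge at time \<open>m + 1\<close> were small
  at time \<open>m\<close> already. The edge was then either present, against the induction
  hypothesis, or it is the edge added in a small step.\<close>

lemma no_small_edge_persists:
  assumes fin: "\<And>m. finite (graph_at es m)" and len: "m1 \<le> length es"
    and base: "\<not> small_edge (graph_at es m0) s"
    and step: "\<And>m. m0 \<le> m \<Longrightarrow> m < m1 \<Longrightarrow> \<not> small_step es m s"
    and m: "m0 \<le> m" "m \<le> m1"
  shows "\<not> small_edge (graph_at es m) s"
  using m
proof (induction m rule: dec_induct)
  case base
  then show ?case using assms(3) by simp
next
  case (step m)
  show ?case
  proof
    assume "small_edge (graph_at es (Suc m)) s"
    then obtain u v where uv: "{u, v} \<in> graph_at es (Suc m)" "real (degree_of (graph_at es (Suc m)) u) < s"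
      "real (degree_of (graph_at es (Suc m)) v) < s" unfolding small_edge_def by blast
    have dm: "real (degree_of (graph_at es m) w) \<le> real (degree_of (graph_at es (Suc m)) w)" for w
      unfolding of_nat_le_iff by (rule degree_of_mono[OF graph_at_mono fin]) simp
    have sm: "real (degree_of (graph_at es m) u) < s" "real (degree_of (graph_at es m) v) < s"
      using uv(2,3) dm[of u] dm[of v] by linarith+
    have ins: "graph_at es (Suc m) = insert (es ! m) (graph_at es m)"
      unfolding graph_at_def using step.prems len step.hyps by (simp add: take_Suc_conv_app_nth)
    from uv(1) have "{u, v} = es ! m \<or> {u, v} \<in> graph_at es m" unfolding ins by (simp only: insert_iff)
    then show False
    proof
      assume "{u, v} = es ! m"
      then have "small_step es m s" using sm unfolding small_step_def graph_at_def by (intro exI[of _ u] exI[of _ v]) simp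
      then show False using assms(4)[of m] step.hyps step.prems by simp
    next
      assume "{u, v} \<in> graph_at es m"
      then have "small_edge (graph_at es m) s" using sm unfolding small_edge_def by blast
      then show False using step by simp
    qed
  qed
qed

lemma real_choose_two: "real (n choose 2) = real n * (real n - 1) / 2"
proof (cases "n = 0")
  case False
  have "2 dvd n * (n - 1)" using False by (cases "even n") auto
  then have "2 * (n choose 2) = n * (n - 1)" unfolding choose_two by (rule dvd_mult_div_cancel)
  then have "real (2 * (n choose 2)) = real (n * (n - 1))" by simp
  then show ?thesis using False by (simp add: of_nat_diff)
qed simp

lemma edge_density:
  assumes "n \<ge> 2"
  shows "real m / real (n choose 2) * (real n - 1) = 2 * real m / real n"
proof -
  have "real n - 1 \<noteq> 0" using assms by simp
  then show ?thesis unfolding real_choose_two by simp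
qed

lemma edge_density_le:
  assumes n: "n \<ge> 2" and m: "real m \<le> 3 * real n * L"
  shows "real m / real (n choose 2) * (real n - 1) \<le> 6 * L" "real m / real (n choose 2) * real n \<le> 12 * L"
proof -
  have "2 * real m / real n \<le> 2 * (3 * real n * L) / real n"
    by (rule divide_right_mono[OF mult_left_mono[OF m]]) auto
  then show 1: "real m / real (n choose 2) * (real n - 1) \<le> 6 * L"
    unfolding edge_density[OF n] using n by simp
  have "real n \<le> 2 * (real n - 1)" using n by simp
  then have "real m / real (n choose 2) * real n \<le> real m / real (n choose 2) * (2 * (real n - 1))"
    by (intro mult_left_mono) auto
  also have "\<dots> = 2 * (real m / real (n choose 2) * (real n - 1))" by simp
  also have "\<dots> \<le> 2 * (6 * L)" using 1 by (rule mult_left_mono) simp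
  finally show "real m / real (n choose 2) * real n \<le> 12 * L" by simp
qed

lemma edge_density_ge:
  assumes n: "n \<ge> 2" and m: "2 / 5 * real n * L \<le> real m"
  shows "4 / 5 * L \<le> real m / real (n choose 2) * (real n - 1)"
proof -
  have "2 * (2 / 5 * real n * L) / real n \<le> 2 * real m / real n"
    by (rule divide_right_mono[OF mult_left_mono[OF m]]) auto
  then show ?thesis unfolding edge_density[OF n] using n by simp
qed

text \<open>
  The number 67988 is \<open>2 * (\<tau> + (4 * c1 + 257 * c2 + 1152 * C))\<close> from \<open>centered_form_bound\<close> for
  \<open>\<tau> = 98\<close>, \<open>c1 = 20\<close>, \<open>c2 = 24\<close> and \<open>C = 24\<close>.
\<close>

definition gap_const :: real where
  "gap_const = 303 * 67988\<^sup>2 + 100 * 67988 + 702"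

text \<open>The deterministic core: \<open>G1\<close> and \<open>G2\<close> put the connection time
  into the window. \<open>G3\<close> and \<open>G4\<close> are inherited by subgraphs.
  \<open>G5\<close> and \<open>G6\<close> are demanded at every time, because the centred form
  changes both ways as edges arrive, and because vertices may lose the status of small degree while
  gaining neighbours. In \<open>centered_form_bound\<close>, 24 is twice 12, from the doubled
  density in \<open>G4\<close>.\<close>

lemma spectral_lambda_connection_time_le:
  fixes n m0 m1 :: nat and L :: real
  defines "N \<equiv> n choose 2" and "L \<equiv> ln (real n)"
  assumes n: "n \<ge> 5" and L: "L \<ge> 1" and gap: "gap_const / sqrt L < 1"
    and m01: "0 < m0" "m0 \<le> m1" "m1 \<le> N"
    and low: "2 / 5 * real n * L \<le> m0" and up: "m1 \<le> 3 * real n * L"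
    and sub: "\<And>m. graph_at es m \<subseteq> all_edges n" and len: "length es = N"
    and G1: "\<not> graph_connected n (graph_at es m0)"
    and G2: "graph_connected n (graph_at es m1)"
    and G3: "\<And>v. v < n \<Longrightarrow> real (degree_of (graph_at es m1) v) \<le> 20 * L"
    and G4: "discrepancy n (graph_at es m1) (2 * (m1 / N)) 24"
    and G5: "\<And>m. m0 \<le> m \<Longrightarrow> m \<le> m1 \<Longrightarrow> \<not> light_bad n (graph_at es m) (m / N) L (24 + 74)"
    and G6: "\<And>m. m0 \<le> m \<Longrightarrow> m \<le> m1 \<Longrightarrow> \<not> many_small n (graph_at es m) (L / 100)"
    and G7: "\<not> small_edge (graph_at es m0) (L / 100)"
    and G8: "\<And>m. m0 \<le> m \<Longrightarrow> m < m1 \<Longrightarrow> \<not> small_step es m (L / 100)"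
  shows "spectral_lambda n (graph_at es (connection_time n es)) \<le> gap_const / sqrt L"
proof -
  define t where "t = connection_time n es"
  have fin: "finite (graph_at es m)" for m by (simp add: graph_at_def)
  have tc: "graph_connected n (graph_at es t)"
    unfolding t_def connection_time_def using G2 by (rule LeastI)
  have t1: "t \<le> m1" unfolding t_def connection_time_def using G2 by (rule Least_le)
  have t0: "m0 \<le> t"
  proof (rule ccontr)
    assume "\<not> m0 \<le> t"
    then have "graph_connected n (graph_at es m0)"
      by (intro graph_connected_mono[OF tc] graph_at_mono) simp
    then show False using G1 by simp
  qed
  let ?E = "graph_at es t"
  have Npos: "real N > 0" using m01 by simp
  have n2: "n \<ge> 2" using n by simp
  have pn: "m / N * n \<le> 12 * L" if "m \<le> m1" for m
    unfolding N_def by (rule edge_density_le(2)[OF n2]) (use that up in simp)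
  have E: "?E \<subseteq> all_edges n" by (rule sub)
  have disc: "discrepancy n ?E (2 * (m1 / N)) 24"
    by (rule discrepancy_mono[OF G4 graph_at_mono[OF t1]])
  have deg: "real (degree_of ?E v) \<le> 20 * L" if "v < n" for v
  proof -
    have "degree_of ?E v \<le> degree_of (graph_at es m1) v" by (rule degree_of_mono[OF graph_at_mono[OF t1] fin])
    then show ?thesis using G3[OF that] by linarith
  qed
  have M: "\<bar>centered_form n ?E (t / N) x y\<bar> \<le> 67988 * sqrt L * L2_set x {..<n} * L2_set y {..<n}" for x y
  proof -
    have "\<bar>centered_form n ?E (t / N) x y\<bar> \<le>
       2 * (98 + (4 * 20 + 257 * 24 + 1152 * 24)) * sqrt L * L2_set x {..<n} * L2_set y {..<n}"
    proof (rule centered_form_bound[OF E _ L deg disc])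
      show "1 \<le> n" using n by simp
      show "0 \<le> 2 * (m1 / N)" by simp
      show "2 * (m1 / N) * n \<le> 24 * L" using pn[of m1] by simp
      show "t / N * n \<le> 24 * L" using pn[OF t1] L by linarith
      fix z w :: "nat \<Rightarrow> int"
      assume zw: "(\<Sum>i<n. (z i)\<^sup>2) \<le> 16 * int n" "(\<Sum>i<n. (w i)\<^sup>2) \<le> 16 * int n"
      show "\<bar>\<Sum>i<n. \<Sum>j<n. centered_entry ?E (t / N) i j * light L (\<lambda>i. z i / 4) (\<lambda>i. w i / 4) i j\<bar> \<le> 98 * sqrt L * n"
        using not_light_bad[OF G5[OF t0 t1] zw] by simp
    qed auto
    then show ?thesis by simp
  qed
  have nse: "\<not> small_edge ?E (L / 100)"
    by (rule no_small_edge_persists[OF fin _ G7 G8 t0 t1]) (use len m01 in simp)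
  have "4 / 5 * L \<le> t / N * (real n - 1)"
    unfolding N_def by (rule edge_density_ge[OF n2]) (use low t0 in linarith)
  then have dp: "4 / 5 * L \<le> t / N * real (n - 1)" using n by (simp add: of_nat_diff)
  have tN: "0 < t / N" "t / N \<le> 1" using t0 t1 m01 Npos by (auto simp: divide_le_eq_1)
  have gform: "\<bar>edge_form n ?E y y\<bar> \<le> gap_const / sqrt L * (\<Sum>v<n. real (degree_of ?E v) * (y v)\<^sup>2)"
    if y: "(\<Sum>v<n. real (degree_of ?E v) * y v) = 0" for y
    unfolding gap_const_def
  proof (rule laplacian_form_bound[OF E _ L tN dp _ M _ _ y])
    show "2 \<le> n" using n by simp
    show "real (degree_of ?E v) \<ge> L / 100" if "{u, v} \<in> ?E" "real (degree_of ?E u) < L / 100" for u v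
    proof (rule ccontr)
      assume "\<not> real (degree_of ?E v) \<ge> L / 100"
      then have "small_edge ?E (L / 100)" using that unfolding small_edge_def
        by (intro exI[of _ u] exI[of _ v]) simp
      then show False using nse by simp
    qed
    show "card {v. v < n \<and> {u, v} \<in> ?E \<and> real (degree_of ?E v) < L / 100} \<le> 3" if "u < n" for u
      by (rule not_many_small[OF G6[OF t0 t1] that])
  qed simp
  have "spectral_lambda n ?E \<le> gap_const / sqrt L"
  proof (rule spectral_lambda_le[OF E _ _ gform gap])
    show "n \<ge> 2" using n by simp
    show "degree_of ?E v > 0" if "v < n" for v
    proof -
      have "?E \<inter> star n v \<noteq> {}" by (rule connected_imp_star[OF E _ tc that]) (use n in simp)
      then show ?thesis unfolding degree_of_eq_star[OF E] using fin[of t] by (simp add: card_gt_0_iff)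
    qed
  qed
  then show ?thesis unfolding t_def .
qed

section \<open>Failure probability\<close>

text \<open>The bound of \<open>no_isolated_prob\<close> with \<open>m\<close> replaced by
  \<open>2 / 5 * n * ln n + 1\<close>, the 1 allowing for rounding up. The denominator of the first
  fraction, a lower bound for the expected number of isolated vertices, grows like
  \<open>n powr (1 / 5)\<close>. The argument is real so that asymptotics of real functions
  apply.\<close>

definition fail_connected :: "real \<Rightarrow> real" where
  "fail_connected n = 1 / (n * exp (- (2 / 5 * n * ln n + 1) * ((n - 1) / (n * (n - 1) / 2 - (2 / 5 * n * ln n + 1)) +
    2 * ((n - 1) / (n * (n - 1) / 2 - (2 / 5 * n * ln n + 1)))\<^sup>2))) +
    (exp ((2 / 5 * n * ln n + 1) / (n * (n - 1) / 2 - (2 / 5 * n * ln n + 1) - n)) - 1)"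

text \<open>
  The summands bound the probabilities of the events of \<open>failure_prob\<close>, in the same order.
\<close>

definition fail_window :: "real \<Rightarrow> real" where
  "fail_window n = (exp (1 / n) - 1) + n * (1 / n\<^sup>2) + n * (2 * n + 3) / n ^ 4 + 3 * n * ln n * (2 * exp (- n)) +
    3 * n * ln n * (n ^ 5 * ((exp 1 * (3 * n * ln n / (n * (n - 1) / 2))) ^ 4 * exp (- (54 / 25 * ln n)))) +
    n ^ 2 * ((exp 1 * (3 * n * ln n / (n * (n - 1) / 2))) * exp (- (27 / 25 * ln n))) +
    3 * n * ln n * (n ^ 2 * exp (- (27 / 25 * ln n)) / (n * (n - 1) / 2 - 3 * n * ln n))"

lemma fail_tendsto_0: "((\<lambda>n. fail_connected n + fail_window n) \<longlongrightarrow> 0) at_top"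
proof -
  have "(fail_connected \<longlongrightarrow> 0) at_top" unfolding fail_connected_def[abs_def] by real_asymp
  moreover have "(fail_window \<longlongrightarrow> 0) at_top" unfolding fail_window_def[abs_def] by real_asymp
  ultimately show ?thesis by (auto intro: tendsto_add_zero)
qed

definition large :: "real \<Rightarrow> bool" where
  "large n \<longleftrightarrow> 3 * n * ln n + 2 * n \<le> n * (n - 1) / 2 \<and> 2 * n * ln n + 1 \<le> 3 * n * ln n \<and> ln n \<ge> 1 \<and>
    gap_const / sqrt (ln n) < 1 \<and> n \<ge> 41 \<and> (n - 1) / (n * (n - 1) / 2 - (2 / 5 * n * ln n + 1)) \<le> 1 / 2"

lemma eventually_large: "eventually large at_top"
  unfolding large_def gap_const_def by (intro eventually_conj; real_asymp)

lemma connected_early_prob: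
  fixes n m :: nat
  assumes n: "large n" and m: "real m \<le> 2 / 5 * n * ln n + 1"
  shows "measure_pmf.prob (graph_process n) {es. graph_connected n (graph_at es m)} \<le> fail_connected n"
proof -
  define a where "a = 2 / 5 * n * ln n + 1"
  define N where "N = real n * (real n - 1) / 2"
  define x where "x = (real n - 1) / (N - a)"
  note N = real_choose_two[of n, folded N_def]
  have n2: "n \<ge> 2" using n unfolding large_def by linarith
  have h: "3 * n * ln n + 2 * n \<le> N" "2 * n * ln n + 1 \<le> 3 * n * ln n" "ln n \<ge> 1" "x \<le> 1 / 2"
    using n unfolding large_def N_def x_def a_def by simp_all
  have nl: "real n * ln n \<ge> 0" using h(3) by simp
  have aN: "a + 2 * n \<le> N" "0 \<le> a" using h nl unfolding a_def by linarith+
  have ma: "real m \<le> a" using m unfolding a_def .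
  have mN: "m + 2 * n \<le> n choose 2"
  proof -
    have "real (m + 2 * n) \<le> real (n choose 2)" using aN ma unfolding N by simp
    then show ?thesis by (simp only: of_nat_le_iff)
  qed
  have Na: "N - a > 0" "N - m > 0" "N - a - n > 0" using aN ma n2 by auto
  have x0: "0 \<le> x" using Na n2 unfolding x_def by simp
  have "measure_pmf.prob (graph_process n) {es. graph_connected n (graph_at es m)} =
      gprob n m {S. graph_connected n S}"
    by (rule prob_graph_at) (use mN in simp)
  also have "\<dots> \<le> gprob n m {S. \<forall>v<n. S \<inter> star n v \<noteq> {}}"
    by (rule uniform_graph_prob_mono) (use mN connected_imp_star n2 in \<open>simp, blast\<close>)
  also have "\<dots> \<le> 1 / (n * (1 - (real n - 1) / (N - m)) ^ m) + (exp (m / (N - m - n)) - 1)"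
    using no_isolated_prob[OF n2 mN] unfolding N .
  also have "1 / (n * (1 - (real n - 1) / (N - m)) ^ m) \<le> 1 / (n * exp (- a * (x + 2 * x\<^sup>2)))"
  proof -
    have "exp (- a * (x + 2 * x\<^sup>2)) \<le> exp (m * (- x - 2 * x\<^sup>2))"
    proof -
      have "m * (x + 2 * x\<^sup>2) \<le> a * (x + 2 * x\<^sup>2)" using ma x0 by (intro mult_right_mono) auto
      then show ?thesis by (simp add: algebra_simps)
    qed
    also have "\<dots> = exp (- x - 2 * x\<^sup>2) ^ m" by (rule exp_of_nat_mult)
    also have "\<dots> \<le> (1 - x) ^ m"
    proof (rule power_mono)
      \<comment> \<open>The quadratic correction is harmless: \<open>x\<close> is of order
        \<open>1 / n\<close>, so \<open>a * x\<^sup>2\<close> tends to 0.\<close>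
      have "exp (- x - 2 * x\<^sup>2) \<le> exp (ln (1 - x))"
        using ln_one_minus_pos_lower_bound[OF x0 h(4)] by simp
      then show "exp (- x - 2 * x\<^sup>2) \<le> 1 - x" using h(4) by simp
    qed simp
    also have "\<dots> \<le> (1 - (real n - 1) / (N - m)) ^ m"
    proof (rule power_mono)
      have "(real n - 1) / (N - m) \<le> x" unfolding x_def
        using Na ma n2 by (intro divide_left_mono mult_pos_pos) auto
      then show "1 - x \<le> 1 - (real n - 1) / (N - m)" by simp
    qed (use h(4) in simp)
    finally have "exp (- a * (x + 2 * x\<^sup>2)) \<le> (1 - (real n - 1) / (N - m)) ^ m" .
    then have "n * exp (- a * (x + 2 * x\<^sup>2)) \<le> n * (1 - (real n - 1) / (N - m)) ^ m" by (rule mult_left_mono) simp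
    then show ?thesis by (intro frac_le) (use n2 in auto)
  qed
  also have "exp (m / (N - m - n)) \<le> exp (a / (N - a - n))"
    using ma Na aN by (subst exp_le_cancel_iff) (intro frac_le, auto)
  finally show ?thesis unfolding fail_connected_def x_def N_def a_def by simp
qed

lemma failure_prob:
  fixes n m0 m1 :: nat and L :: real
  defines "N \<equiv> n choose 2" and "L \<equiv> ln (real n)"
  assumes n: "large n" and m01: "0 < m0" "m0 \<le> m1"
    and low: "2 / 5 * real n * L \<le> m0" and up: "m1 \<le> 3 * real n * L" and low1: "2 * real n * L \<le> m1"
  shows "measure_pmf.prob (graph_process n) {es. \<not> graph_connected n (graph_at es m1) \<or>
      (\<exists>v\<in>{..<n}. 20 * L \<le> real (degree_of (graph_at es m1) v)) \<or>
      \<not> discrepancy n (graph_at es m1) (2 * (m1 / N)) 24 \<or>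
      (\<exists>m\<in>{m0..m1}. light_bad n (graph_at es m) (m / N) L (24 + 74)) \<or>
      (\<exists>m\<in>{m0..m1}. many_small n (graph_at es m) (L / 100)) \<or>
      small_edge (graph_at es m0) (L / 100) \<or>
      (\<exists>m\<in>{m0..<m1}. small_step es m (L / 100))} \<le> fail_window n"
proof -
  let ?N = "real n * (real n - 1) / 2"
  note N = real_choose_two[of n]
  have h: "3 * real n * L + 2 * n \<le> ?N" "L \<ge> 1" "real n \<ge> 41" using n unfolding large_def L_def by simp_all
  have n5: "n \<ge> 5" "n \<ge> 2" "n \<ge> 1" using h(3) by linarith+
  have M0: "0 \<le> 3 * real n * L" using h(2) by simp
  have mN: "m < n choose 2" if "m \<le> m1" for m
  proof -
    have "real m < real (n choose 2)" unfolding N using that up h n5 by linarith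
    then show ?thesis by (simp only: of_nat_less_iff)
  qed
  have mN': "m \<le> n choose 2" if "m \<le> m1" for m using mN[OF that] by simp
  have mup: "real m \<le> 3 * real n * L" if "m \<le> m1" for m using that up by linarith
  have pT: "7 / 10 * L \<le> m / (n choose 2) * (real n - 5)" if "m0 \<le> m" for m
  proof -
    have "4 / 5 * L \<le> m / (n choose 2) * (real n - 1)"
      by (rule edge_density_ge[OF n5(2)]) (use low that in linarith)
    then have "7 / 8 * (4 / 5 * L) \<le> 7 / 8 * (m / (n choose 2) * (real n - 1))" by (rule mult_left_mono) simp
    also have "\<dots> = m / (n choose 2) * (7 / 8 * (real n - 1))" by (rule mult.left_commute)
    \<comment> \<open>\<open>7 / 8 * (n - 1) \<le> n - 5\<close> holds from \<open>n = 33\<close>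
      on, and \<open>7 / 8 * (4 / 5) = 7 / 10\<close>.\<close>
    also have "\<dots> \<le> m / (n choose 2) * (real n - 5)" using h(3) by (intro mult_left_mono) auto
    finally show ?thesis by simp
  qed
  have dens: "m / (n choose 2) \<le> 3 * real n * L / ?N" if "m \<le> m1" for m
    unfolding N using mup[OF that] h n5 by (intro divide_right_mono) auto
  \<comment> \<open>The closed interval has \<open>m1 - m0 + 1\<close> elements, which is at most
    \<open>m1\<close> because \<open>m0 > 0\<close>.\<close>
  have cI: "real (card {m0..m1}) \<le> 3 * real n * L" "real (card {m0..<m1}) \<le> 3 * real n * L"
    using up m01 by (auto simp: of_nat_diff)
  have 1: "measure_pmf.prob (graph_process n) {es. \<not> graph_connected n (graph_at es m1)} \<le> exp (1 / n) - 1"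
  proof -
    have "4 * L \<le> m1 / (n choose 2) * n"
    proof -
      have "2 * (2 * real n * L) / real n \<le> 2 * real m1 / real n" by (rule divide_right_mono[OF mult_left_mono[OF low1]]) auto
      then have "4 * L \<le> m1 / (n choose 2) * (real n - 1)" unfolding edge_density[OF n5(2)] using n5 by simp
      also have "\<dots> \<le> m1 / (n choose 2) * n" by (intro mult_left_mono) auto
      finally show ?thesis .
    qed
    then have "gprob n m1 {S. \<not> graph_connected n S} \<le> (1 + 1 / real n ^ 2) ^ n - 1"
      unfolding L_def by (rule not_connected_prob[OF mN'[OF order_refl] n5(3)])
    also have "(1 + 1 / real n ^ 2) ^ n \<le> exp (1 / real n ^ 2) ^ n"
      by (intro power_mono exp_ge_add_one_self) auto
    also have "\<dots> = exp (1 / n)" using n5 by (simp add: exp_of_nat_mult[symmetric] power2_eq_square)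
    finally show ?thesis
      unfolding prob_graph_at[OF mN'[OF order_refl], where Q = "\<lambda>S. \<not> graph_connected n S"] by simp
  qed
  have 2: "measure_pmf.prob (graph_process n) {es. \<exists>v\<in>{..<n}. 20 * L \<le> real (degree_of (graph_at es m1) v)} \<le> n * (1 / real n ^ 2)"
    unfolding prob_graph_at[OF mN'[OF order_refl], where Q = "\<lambda>S. \<exists>v\<in>{..<n}. 20 * L \<le> real (degree_of S v)"]
    unfolding L_def
    by (rule max_degree_prob[OF mN'[OF order_refl] n5(3)])
      (use edge_density_le(1)[OF n5(2) up] in \<open>simp add: L_def\<close>)
  have 3: "measure_pmf.prob (graph_process n) {es. \<not> discrepancy n (graph_at es m1) (2 * (m1 / N)) 24} \<le>
      real n * (2 * real n + 3) / real n ^ 4"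
    unfolding prob_graph_at[OF mN'[OF order_refl], where Q = "\<lambda>S. \<not> discrepancy n S (2 * (m1 / N)) 24"]
    unfolding N_def
    by (rule not_discrepancy_prob[OF mN'[OF order_refl] n5(3)])
  have 4: "measure_pmf.prob (graph_process n) {es. \<exists>m\<in>{m0..m1}. light_bad n (graph_at es m) (m / N) L (24 + 74)} \<le>
      3 * real n * L * (2 * exp (- real n))"
  proof -
    have "measure_pmf.prob (graph_process n) {es. \<exists>m\<in>{m0..m1}. light_bad n (graph_at es m) (m / N) L (24 + 74)} \<le>
        real (card {m0..m1}) * (2 * exp (- real n))"
    proof (rule prob_exists_le_const)
      fix m assume "m \<in> {m0..m1}"
      then have m: "m \<le> m1" by simp
      have "m / (n choose 2) * n \<le> 24 * L"
        using edge_density_le(2)[OF n5(2) mup[OF m]] h(2) by linarith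
      then show "measure_pmf.prob (graph_process n) {es. light_bad n (graph_at es m) (m / N) L (24 + 74)} \<le> 2 * exp (- real n)"
        unfolding prob_graph_at[OF mN'[OF m], where Q = "\<lambda>S. light_bad n S (m / N) L (24 + 74)"]
    unfolding N_def
        by (intro light_bad_prob[OF mN'[OF m]]) (use h(2) in auto)
    qed simp
    also have "\<dots> \<le> 3 * real n * L * (2 * exp (- real n))" using cI by (intro mult_right_mono) auto
    finally show ?thesis .
  qed
  have 5: "measure_pmf.prob (graph_process n) {es. \<exists>m\<in>{m0..m1}. many_small n (graph_at es m) (L / 100)} \<le>
      3 * real n * L * (real n ^ 5 * ((exp 1 * (3 * real n * L / ?N)) ^ 4 * exp (- (54 / 25 * L))))"
  proof -
    have "measure_pmf.prob (graph_process n) {es. \<exists>m\<in>{m0..m1}. many_small n (graph_at es m) (L / 100)} \<le>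
        real (card {m0..m1}) * (real n ^ 5 * ((exp 1 * (3 * real n * L / ?N)) ^ 4 * exp (- (54 / 25 * L))))"
    proof (rule prob_exists_le_const)
      fix m assume "m \<in> {m0..m1}"
      then have m: "m \<le> m1" "m0 \<le> m" "0 < m" using m01 by auto
      have "measure_pmf.prob (graph_process n) {es. many_small n (graph_at es m) (L / 100)} \<le>
          real n ^ 5 * ((exp 1 * (m / (n choose 2))) ^ 4 * exp (- (54 / 25 * L)))"
        unfolding prob_graph_at[OF mN'[OF m(1)], where Q = "\<lambda>S. many_small n S (L / 100)"]
        by (rule many_small_prob[OF mN'[OF m(1)] m(3) pT[OF m(2)] n5(1)])
      also have "\<dots> \<le> real n ^ 5 * ((exp 1 * (3 * real n * L / ?N)) ^ 4 * exp (- (54 / 25 * L)))"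
        using dens[OF m(1)] by (intro mult_left_mono mult_right_mono power_mono) auto
      finally show "measure_pmf.prob (graph_process n) {es. many_small n (graph_at es m) (L / 100)} \<le>
          real n ^ 5 * ((exp 1 * (3 * real n * L / ?N)) ^ 4 * exp (- (54 / 25 * L)))" .
    qed simp
    also have "\<dots> \<le> 3 * real n * L * (real n ^ 5 * ((exp 1 * (3 * real n * L / ?N)) ^ 4 * exp (- (54 / 25 * L))))"
      using cI M0 h n5 by (intro mult_right_mono mult_nonneg_nonneg zero_le_power divide_nonneg_nonneg) auto
    finally show ?thesis .
  qed
  have 6: "measure_pmf.prob (graph_process n) {es. small_edge (graph_at es m0) (L / 100)} \<le>
      real n ^ 2 * ((exp 1 * (3 * real n * L / ?N)) * exp (- (27 / 25 * L)))"
  proof -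
    have "measure_pmf.prob (graph_process n) {es. small_edge (graph_at es m0) (L / 100)} \<le>
      real n ^ 2 * ((exp 1 * (m0 / (n choose 2))) * exp (- (27 / 25 * L)))"
      unfolding prob_graph_at[OF mN'[OF m01(2)], where Q = "\<lambda>S. small_edge S (L / 100)"]
      by (rule small_edge_prob[OF mN'[OF m01(2)] m01(1) pT[OF order_refl] n5(1)])
    also have "\<dots> \<le> real n ^ 2 * ((exp 1 * (3 * real n * L / ?N)) * exp (- (27 / 25 * L)))"
      using dens[OF m01(2)] by (intro mult_left_mono mult_right_mono) auto
    finally show ?thesis .
  qed
  have 7: "measure_pmf.prob (graph_process n) {es. \<exists>m\<in>{m0..<m1}. small_step es m (L / 100)} \<le>
      3 * real n * L * (real n ^ 2 * exp (- (27 / 25 * L)) / (?N - 3 * real n * L))"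
  proof -
    have pos: "?N - 3 * real n * L > 0" using h(1) n5 by linarith
    have "measure_pmf.prob (graph_process n) {es. \<exists>m\<in>{m0..<m1}. small_step es m (L / 100)} \<le>
      real (card {m0..<m1}) * (real n ^ 2 * exp (- (27 / 25 * L)) / (?N - 3 * real n * L))"
    proof (rule prob_exists_le_const)
      fix m assume "m \<in> {m0..<m1}"
      then have m: "m \<le> m1" "m0 \<le> m" "0 < m" using m01 by auto
      have "measure_pmf.prob (graph_process n) {es. small_step es m (L / 100)} \<le>
          real n ^ 2 * exp (- (27 / 25 * L)) / (real (n choose 2) - m)"
        by (rule small_step_prob[OF mN[OF m(1)] m(3) pT[OF m(2)] n5(1)])
      also have "\<dots> \<le> real n ^ 2 * exp (- (27 / 25 * L)) / (?N - 3 * real n * L)"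
        unfolding N using mup[OF m(1)] pos by (intro divide_left_mono mult_pos_pos) auto
      finally show "measure_pmf.prob (graph_process n) {es. small_step es m (L / 100)} \<le>
          real n ^ 2 * exp (- (27 / 25 * L)) / (?N - 3 * real n * L)" .
    qed simp
    also have "\<dots> \<le> 3 * real n * L * (real n ^ 2 * exp (- (27 / 25 * L)) / (?N - 3 * real n * L))"
      using cI(2) pos by (intro mult_right_mono) auto
    finally show ?thesis .
  qed
  have fw: "fail_window n = (exp (1 / n) - 1) + (n * (1 / real n ^ 2) + (real n * (2 * real n + 3) / real n ^ 4 +
     (3 * real n * L * (2 * exp (- real n)) +
     (3 * real n * L * (real n ^ 5 * ((exp 1 * (3 * real n * L / ?N)) ^ 4 * exp (- (54 / 25 * L)))) +
     (real n ^ 2 * ((exp 1 * (3 * real n * L / ?N)) * exp (- (27 / 25 * L))) +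
      3 * real n * L * (real n ^ 2 * exp (- (27 / 25 * L)) / (?N - 3 * real n * L)))))))"
    unfolding fail_window_def L_def by (simp only: add.assoc)
  show ?thesis unfolding fw
    by (rule prob_disj_le[OF 1 prob_disj_le[OF 2 prob_disj_le[OF 3 prob_disj_le[OF 4
      prob_disj_le[OF 5 prob_disj_le[OF 6 7]]]]]])
qed

lemma spectral_lambda_prob_ge:
  fixes n :: nat
  assumes n: "large n"
  shows "measure_pmf.prob (graph_process n)
      {es. spectral_lambda n (graph_at es (connection_time n es)) \<le> gap_const / sqrt (ln (real n))} \<ge>
    1 - (fail_connected n + fail_window n)"
proof -
  define L where "L = ln (real n)"
  \<comment> \<open>At \<open>m0\<close> the mean degree is about \<open>4 / 5 * ln n\<close>, below
    the connectivity threshold \<open>ln n\<close>. At \<open>m1\<close> it is about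
    \<open>4 * ln n\<close>, which makes the sum over cuts converge. The slack between
    \<open>2 * n * L\<close> and \<open>3 * n * L\<close> absorbs rounding.\<close>
  define m0 where "m0 = nat \<lceil>2 / 5 * real n * L\<rceil>"
  define m1 where "m1 = nat \<lceil>2 * real n * L\<rceil>"
  have h: "3 * real n * L + 2 * n \<le> real (n choose 2)" "2 * real n * L + 1 \<le> 3 * real n * L" "L \<ge> 1" "gap_const / sqrt L < 1" "real n \<ge> 41"
    using n unfolding large_def L_def real_choose_two by simp_all
  have nL: "real n * L > 0" using h by simp
  have m0: "2 / 5 * real n * L \<le> m0" "m0 \<le> 2 / 5 * real n * L + 1" using nL unfolding m0_def by linarith+
  have m1: "2 * real n * L \<le> m1" "m1 \<le> 2 * real n * L + 1" using nL unfolding m1_def by linarith+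
  have up: "m1 \<le> 3 * real n * L" using m1 h by linarith
  have "0 < real m0" using m0(1) nL by linarith
  then have m0p: "0 < m0" by simp
  have m01: "m0 \<le> m1" unfolding m0_def m1_def by (intro nat_mono ceiling_mono) (use nL in linarith)
  have m1N: "m1 \<le> n choose 2"
  proof -
    have "real m1 \<le> real (n choose 2)" using up h(1) by linarith
    then show ?thesis by (simp only: of_nat_le_iff)
  qed
  define Bad where "Bad es \<longleftrightarrow> graph_connected n (graph_at es m0) \<or> \<not> graph_connected n (graph_at es m1) \<or>
      (\<exists>v\<in>{..<n}. 20 * L \<le> real (degree_of (graph_at es m1) v)) \<or>
      \<not> discrepancy n (graph_at es m1) (2 * (m1 / (n choose 2))) 24 \<or>
      (\<exists>m\<in>{m0..m1}. light_bad n (graph_at es m) (m / (n choose 2)) L (24 + 74)) \<or>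
      (\<exists>m\<in>{m0..m1}. many_small n (graph_at es m) (L / 100)) \<or>
      small_edge (graph_at es m0) (L / 100) \<or>
      (\<exists>m\<in>{m0..<m1}. small_step es m (L / 100))" for es
  have bad: "measure_pmf.prob (graph_process n) {es. Bad es} \<le> fail_connected n + fail_window n"
    unfolding Bad_def
  proof (rule prob_disj_le)
    show "measure_pmf.prob (graph_process n) {es. graph_connected n (graph_at es m0)} \<le> fail_connected n"
      by (rule connected_early_prob[OF n]) (use m0(2) in \<open>simp add: L_def\<close>)
    show "measure_pmf.prob (graph_process n) {es. \<not> graph_connected n (graph_at es m1) \<or>
      (\<exists>v\<in>{..<n}. 20 * L \<le> real (degree_of (graph_at es m1) v)) \<or>
      \<not> discrepancy n (graph_at es m1) (2 * (m1 / (n choose 2))) 24 \<or>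
      (\<exists>m\<in>{m0..m1}. light_bad n (graph_at es m) (m / (n choose 2)) L (24 + 74)) \<or>
      (\<exists>m\<in>{m0..m1}. many_small n (graph_at es m) (L / 100)) \<or>
      small_edge (graph_at es m0) (L / 100) \<or>
      (\<exists>m\<in>{m0..<m1}. small_step es m (L / 100))} \<le> fail_window n"
      using failure_prob[OF n m0p m01] m0(1) up m1(1) unfolding L_def by blast
  qed
  have good: "spectral_lambda n (graph_at es (connection_time n es)) \<le> gap_const / sqrt (ln (real n))"
    if es: "es \<in> set_pmf (graph_process n)" and nb: "\<not> Bad es" for es
  proof -
    note g = nb[unfolded Bad_def]
    have len: "length es = n choose 2" using es unfolding graph_process_def by (rule length_edge_process)
    show ?thesis
    proof (rule spectral_lambda_connection_time_le[where n = n and ?m0.0 = m0 and ?m1.0 = m1])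
      show "n \<ge> 5" using h(5) by linarith
      show "graph_at es m \<subseteq> all_edges n" for m using es by (rule graph_process_subset)
      show "real (degree_of (graph_at es m1) v) \<le> 20 * ln (real n)" if "v < n" for v
      proof -
        have "\<not> 20 * L \<le> real (degree_of (graph_at es m1) v)" using g that by blast
        then show ?thesis unfolding L_def by linarith
      qed
      show "\<not> graph_connected n (graph_at es m0)" "graph_connected n (graph_at es m1)"
        "discrepancy n (graph_at es m1) (2 * (real m1 / real (n choose 2))) 24" using g by blast+
      show "\<not> light_bad n (graph_at es m) (real m / real (n choose 2)) (ln (real n)) (24 + 74)"
        "\<not> many_small n (graph_at es m) (ln (real n) / 100)" if "m0 \<le> m" "m \<le> m1" for m
      proof -
        have "m \<in> {m0..m1}" using that by simp
        then show "\<not> light_bad n (graph_at es m) (real m / real (n choose 2)) (ln (real n)) (24 + 74)"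
          "\<not> many_small n (graph_at es m) (ln (real n) / 100)" using g unfolding L_def by blast+
      qed
      show "\<not> small_edge (graph_at es m0) (ln (real n) / 100)" using g unfolding L_def by blast
      show "\<not> small_step es m (ln (real n) / 100)" if "m0 \<le> m" "m < m1" for m
      proof -
        have "m \<in> {m0..<m1}" using that by simp
        then show ?thesis using g unfolding L_def by blast
      qed
    qed (fact h(3,4)[unfolded L_def] m0(1)[unfolded L_def] up[unfolded L_def] m0p m01 m1N len)+
  qed
  have "measure_pmf.prob (graph_process n) {es. \<not> Bad es} \<le> measure_pmf.prob (graph_process n)
      {es. spectral_lambda n (graph_at es (connection_time n es)) \<le> gap_const / sqrt (ln (real n))}"
    by (rule measure_pmf.finite_measure_mono_AE, unfold AE_measure_pmf_iff mem_Collect_eq) (intro ballI impI good, auto)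
  with diff_left_mono[OF bad, of 1] show ?thesis unfolding prob_pmf_not by (rule order.trans)
qed

theorem theorem1p3:
  shows "\<exists>C::real.
    (\<lambda>n::nat. measure_pmf.prob (graph_process n)
        {es. spectral_lambda n (graph_at es (connection_time n es)) \<le> C / sqrt (ln (real n))})
      \<longlonglongrightarrow> 1"
proof (rule exI[of _ gap_const], rule tendsto_sandwich)
  show "\<forall>\<^sub>F n in sequentially. 1 - (fail_connected (real n) + fail_window (real n)) \<le>
    measure_pmf.prob (graph_process n)
        {es. spectral_lambda n (graph_at es (connection_time n es)) \<le> gap_const / sqrt (ln (real n))}"
    using eventually_compose_filterlim[OF eventually_large filterlim_real_sequentially]
    by eventually_elim (rule spectral_lambda_prob_ge)
  have "(\<lambda>n. fail_connected (real n) + fail_window (real n)) \<longlonglongrightarrow> 0"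
    by (rule filterlim_compose[OF fail_tendsto_0 filterlim_real_sequentially])
  from tendsto_diff[OF tendsto_const[of 1] this]
  show "(\<lambda>n. 1 - (fail_connected (real n) + fail_window (real n))) \<longlonglongrightarrow> 1" by simp
qed auto

end
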